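(* Suppose that $A_5^{(1)}(\alpha_j)_{0\leq j\leq 5}$ has a rational solution. Then, by some B\"acklund transformations, the parameters and the solution can be transformed so that one of the following occurs: (a-1) $(\alpha_0,\alpha_1,\alpha_2,\alpha_3,\alpha_4,\alpha_5)=(\alpha_0,1-\alpha_0,0,0,0,0)$ and $(f_0,f_1,f_2,f_3,f_4,f_5)=(t,t,0,0,0,0)$; (a-2) $(\alpha_0,\alpha_1,\alpha_2,\alpha_3,\alpha_4,\alpha_5)=(\alpha_0,0,0,1-\alpha_0,0,0)$ and $(f_0,f_1,f_2,f_3,f_4,f_5)=(t,0,0,t,0,0)$; (a-3) $(\alpha_0,\alpha_1,\alpha_2,\alpha_3,\alpha_4,\alpha_5)=(0,1,0,0,0,0)$ and $(f_0,f_1,f_2,f_3,f_4,f_5)$ is one of $(t,t,0,0,0,0)$, $(0,t,t,0,0,0)$, $(0,t,0,0,t,0)$, $(t,t,t,0,-t,0)$; (b) $(\alpha_0,\alpha_1,\alpha_2,\alpha_3,\alpha_4,\alpha_5)=(\alpha_0,-\alpha_0+1/2,\alpha_0,-\alpha_0+1/2,0,0)$ and $(f_0,f_1,f_2,f_3,f_4,f_5)=(t/2,t/2,t/2,t/2,0,0)$; (c) $(\alpha_0,\alpha_1,\alpha_2,\alpha_3,\alpha_4,\alpha_5)=(\alpha_4,-\alpha_4+1/3,\alpha_4,-\alpha_4+1/3,\alpha_4,-\alpha_4+1/3)$ and $(f_0,f_1,f_2,f_3,f_4,f_5)=(t/3,t/3,t/3,t/3,t/3,t/3)$.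
   Context: Indices of $f_i$ and $\alpha_i$ are taken in $\mathbb{Z}/6\mathbb{Z}$. For complex parameters $\alpha_0,\dots,\alpha_5$ with $\alpha_0+\cdots+\alpha_5=1$, $A_5^{(1)}(\alpha_j)_{0\leq j\leq 5}$ denotes the following system for functions $f_0,\dots,f_5$ of $t$ (with ${}'=d/dt$): for every $i\in\mathbb{Z}/6\mathbb{Z}$, $$\tfrac{t}{2}f_i'=f_i\left(f_{i+1}f_{i+2}+f_{i+1}f_{i+4}+f_{i+3}f_{i+4}-f_{i+2}f_{i+3}-f_{i+2}f_{i+5}-f_{i+4}f_{i+5}\right)+\left(\tfrac12-\alpha_{i+2}-\alpha_{i+4}\right)f_i+\alpha_i(f_{i+2}+f_{i+4}),$$ together with $f_0+f_2+f_4=f_1+f_3+f_5=t$. A rational solution is a solution with all $f_i$ rational functions of $t$. B\"acklund transformations: these are the finite compositions of $s_0,\dots,s_5,\pi$ (and inverses), each of which sends parameters and a solution to new parameters and a solution of the system with the new parameters: $s_i(f_i)=f_i$, $s_i(f_{i+1})=f_{i+1}+\alpha_i/f_i$, $s_i(f_{i-1})=f_{i-1}-\alpha_i/f_i$, $s_i(f_j)=f_j$ for the other $j$; $s_i(\alpha_i)=-\alpha_i$, $s_i(\alpha_{i\pm1})=\alpha_{i\pm1}+\alpha_i$, $s_i(\alpha_j)=\alpha_j$ for the other $j$; $\pi(f_i)=f_{i+1}$, $\pi(\alpha_i)=\alpha_{i+1}$. If $f_i\equiv0$ (which implies $\alpha_i=0$), $s_i$ is taken to be the identity. In the claim, after the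 transformation, the symbols $\alpha_j,f_j$ denote the new parameters and solution, and the free parameter appearing in each form is an arbitrary complex number. *)

theory Defs
  imports
    Complex_Main
    "HOL-Library.Numeral_Type"
    "HOL-Computational_Algebra.Polynomial"
    "HOL-Computational_Algebra.Fraction_Field"
begin

text \<open>
  Rational functions of \<open>t\<close> are the elements of the field \<open>\<complex>(t)\<close> of fractions of
  \<^typ>\<open>complex poly\<close>; equations between them are identities of rational functions, and
  \<open>f \<equiv> 0\<close> is \<open>f = 0\<close> in this field.  Indices live in the ring \<^typ>\<open>6\<close> of integers modulo 6.
\<close>

type_synonym ratfun = "complex poly fract"

definition rat_const :: "complex \<Rightarrow> ratfun" where
  "rat_const c = Fract [:c:] 1"

definition rat_t :: ratfun where
  "rat_t = Fract [:0, 1:] 1"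

text \<open>The derivation \<open>d/dt\<close> on \<open>\<complex>(t)\<close>, by the quotient rule on representatives \<open>(p, q)\<close>.\<close>

lift_definition rat_deriv :: "ratfun \<Rightarrow> ratfun" is
  "\<lambda>x. (pderiv (fst x) * snd x - fst x * pderiv (snd x), snd x * snd x)"
proof -
  fix x y :: "complex poly \<times> complex poly"
  assume A: "fractrel x y"
  obtain p q where x: "x = (p, q)" by (cases x)
  obtain r s where y: "y = (r, s)" by (cases y)
  from A x y have nz: "q \<noteq> 0" "s \<noteq> 0" and e: "p * s = r * q" by auto
  from e have "pderiv (p * s) = pderiv (r * q)" by simp
  then have d: "p * pderiv s + s * pderiv p = r * pderiv q + q * pderiv r"
    by (simp add: pderiv_mult)
  have "(pderiv p * q - p * pderiv q) * (s * s) - (pderiv r * s - r * pderiv s) * (q * q)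
      = q * s * ((p * pderiv s + s * pderiv p) - (r * pderiv q + q * pderiv r))
        + (r * q - p * s) * (q * pderiv s + s * pderiv q)"
    by (simp add: algebra_simps)
  also have "\<dots> = 0" using d e by simp
  finally show "fractrel
      (pderiv (fst x) * snd x - fst x * pderiv (snd x), snd x * snd x)
      (pderiv (fst y) * snd y - fst y * pderiv (snd y), snd y * snd y)"
    using nz by (simp add: x y)
qed

lemma rat_deriv_Fract:
  "q \<noteq> 0 \<Longrightarrow> rat_deriv (Fract p q) = Fract (pderiv p * q - p * pderiv q) (q * q)"
  by transfer simp

definition A5_rational_solution :: "(6 \<Rightarrow> complex) \<Rightarrow> (6 \<Rightarrow> ratfun) \<Rightarrow> bool" where
  "A5_rational_solution \<alpha> f \<longleftrightarrow>
     (\<forall>i. rat_t / 2 * rat_deriv (f i) =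
        f i * (f (i+1) * f (i+2) + f (i+1) * f (i+4) + f (i+3) * f (i+4)
               - f (i+2) * f (i+3) - f (i+2) * f (i+5) - f (i+4) * f (i+5))
        + rat_const (1/2 - \<alpha> (i+2) - \<alpha> (i+4)) * f i
        + rat_const (\<alpha> i) * (f (i+2) + f (i+4)))
     \<and> f 0 + f 2 + f 4 = rat_t
     \<and> f 1 + f 3 + f 5 = rat_t"

type_synonym state = "(6 \<Rightarrow> complex) \<times> (6 \<Rightarrow> ratfun)"

text \<open>
  The generators act on pairs (parameters, solution): the new value at index \<open>j\<close> is the image
  of \<open>\<alpha>\<^sub>j\<close> resp. \<open>f\<^sub>j\<close>, evaluated at the old pair.
\<close>

definition bt_s :: "6 \<Rightarrow> state \<Rightarrow> state" where
  "bt_s i = (\<lambda>(\<alpha>, f).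
     if f i = 0 then (\<alpha>, f)
     else ((\<lambda>j. if j = i then - \<alpha> i
                else if j = i + 1 \<or> j = i - 1 then \<alpha> j + \<alpha> i
                else \<alpha> j),
           (\<lambda>j. if j = i + 1 then f j + rat_const (\<alpha> i) / f i
                else if j = i - 1 then f j - rat_const (\<alpha> i) / f i
                else f j)))"

definition bt_pi :: "state \<Rightarrow> state" where
  "bt_pi = (\<lambda>(\<alpha>, f). ((\<lambda>j. \<alpha> (j + 1)), (\<lambda>j. f (j + 1))))"

inductive_set backlund :: "(state \<Rightarrow> state) set" where
  id: "id \<in> backlund"
| s: "T \<in> backlund \<Longrightarrow> bt_s i \<circ> T \<in> backlund"
| s_inv: "T \<in> backlund \<Longrightarrow> inv (bt_s i) \<circ> T \<in> backlund"
| pi: "T \<in> backlund \<Longrightarrow> bt_pi \<circ> T \<in> backlund"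
| pi_inv: "T \<in> backlund \<Longrightarrow> inv bt_pi \<circ> T \<in> backlund"

text \<open>The generators are bijections, so that \<^const>\<open>inv\<close> above is a genuine inverse.\<close>

lemma bt_s_involution: "bt_s i (bt_s i x) = x"
proof -
  have c: "rat_const (- c) = - rat_const c" for c
    by (simp add: rat_const_def)
  have n: "i + 1 \<noteq> i" "i - 1 \<noteq> i" "i + 1 \<noteq> i - 1" "i \<noteq> i + 1" "i \<noteq> i - 1"
    by (simp_all add: algebra_simps)
  show ?thesis
    using n by (cases x) (auto simp: bt_s_def c fun_eq_iff)
qed

lemma bij_bt_s: "bij (bt_s i)"
  by (rule o_bij[of "bt_s i"]) (simp_all add: fun_eq_iff bt_s_involution)

lemma bij_bt_pi: "bij bt_pi"
  by (rule o_bij[of "\<lambda>(\<alpha>, f). ((\<lambda>j. \<alpha> (j - 1)), (\<lambda>j. f (j - 1)))"])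
     (auto simp: fun_eq_iff bt_pi_def)

end

theory Submission
  imports Defs
    "HOL-Analysis.Continuum_Not_Denumerable"
    "HOL-Computational_Algebra.Formal_Laurent_Series"
    "HOL-Computational_Algebra.Fundamental_Theorem_Algebra"
begin

text \<open>  Put \<open>x = t\<^sup>2\<close> and \<open>g\<^sub>i = f\<^sub>i / t\<close>. The system becomes
  \<open>x dg\<^sub>i/dx = x g\<^sub>i Q\<^sub>i + \<alpha>\<^sub>i - A\<^sub>i g\<^sub>i\<close>, where
  \<open>Q\<^sub>i = 2 (g\<^bsub>i+1\<^esub> g\<^bsub>i+2\<^esub> - g\<^bsub>i+4\<^esub> g\<^bsub>i+5\<^esub>) + g\<^bsub>i+4\<^esub> - g\<^bsub>i+2\<^esub>\<close> and
  \<open>A\<^sub>i = \<alpha>\<^sub>i + \<alpha>\<^bsub>i+2\<^esub> + \<alpha>\<^bsub>i+4\<^esub>\<close>; the \<open>g\<^sub>i\<close> with even index add up to 1, and so do those with odd index.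
  The proof normalises the parameters by Baecklund transformations and then shows that the \<open>g\<^sub>i\<close> are constants.

  \<^emph>\<open>Normalising.\<close> The \<open>s\<^sub>i\<close> act on the parameters as the affine Weyl group of type \<open>A\<^sub>5\<close>. Choose a real-linear
  functional \<open>\<lambda>\<close> from the complex to the real numbers with \<open>\<lambda>(1) = 1\<close> that is injective on the additive group
  generated by 1 and the parameters (\<open>generic_functional_injective\<close>). Finitely many reflections
  move the point \<open>\<lambda>(\<alpha>)\<close> into the fundamental alcove: \<open>\<lambda>(\<alpha>\<^sub>i) \<ge> 0\<close> for all \<open>i\<close> (\<open>reach_alcove\<close>).

  \<^emph>\<open>Infinity.\<close> The \<open>g\<^sub>i\<close> are regular at infinity, and up to rotation their values there form one of five vectors
  \<open>v\<close> (\<open>infinity_regular\<close>, \<open>crit_classification\<close>). The vector \<open>v\<close> determines the whole expansion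
  (\<open>local_sol_unique\<close>). Since \<open>g(-t)\<close> solves the same system and has the same values, \<open>g\<close> is even in \<open>t\<close>, that is,
  a rational function of \<open>x\<close> (\<open>x_solution_of_t_solution\<close>).

  \<^emph>\<open>Counting residues.\<close> There are six polynomials \<open>h\<^sub>j\<close> in \<open>x\<close> and the \<open>g\<^sub>i\<close>, the Hamiltonians of the system, such that
  \<open>h\<^sub>j / x\<close> has a natural number as its residue at every finite \<open>x \<noteq> 0\<close> (\<open>finite_place\<close>). By the
  residue theorem the difference \<open>N\<^sub>j\<close> of the constant terms of \<open>h\<^sub>j\<close> at infinity and at 0 is a natural number
  (\<open>residue_count\<close>). Both constant terms are explicit quadratic polynomials in the parameters, which depend only on the
  type \<open>v\<close> (\<open>infinity_place\<close>) and on the places of the poles at 0 (\<open>zero_place\<close>).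

  \<^emph>\<open>Arithmetic.\<close> For a suitable set \<open>A\<close> of indices of one parity these polynomials satisfy
  \<open>\<Sum>\<^bsub>a\<in>A\<^esub> N\<^sub>a + |A| \<Sum>\<^sub>j \<alpha>\<^sub>j N\<^sub>j + \<Sum>\<^bsub>a\<in>A\<^esub> D\<^sub>a = 0\<close>, where every \<open>D\<^sub>a\<close> is a combination of the parameters with coefficients in
  \<open>\<nat>\<close>. Apply \<open>\<lambda>\<close>: all summands are nonnegative, so \<open>N\<^sub>a = 0\<close> and \<open>\<lambda>(D\<^sub>a) = 0\<close> for \<open>a \<in> A\<close> (\<open>balance\<close>).
  Now \<open>N\<^sub>j = N\<^sub>j - N\<^sub>a\<close> is linear in the parameters, and the inequalities \<open>N\<^sub>j \<ge> 0\<close> force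
  \<open>\<alpha>\<^sub>i = A\<^sub>i v\<^sub>i\<close> (\<open>parameters_a1\<close> to \<open>parameters_c\<close>). This says that the constant vector \<open>v\<close> solves the system.
  It has the same values at infinity as \<open>g\<close>, so \<open>g = v\<close> by uniqueness (\<open>constant_solution\<close>), and
  \<open>f\<^sub>i = v\<^sub>i t\<close> are the five families.
\<close>

section \<open>Indices modulo six\<close>

lemma six_exhaust: "j = 0 \<or> j = 1 \<or> j = 2 \<or> j = 3 \<or> j = 4 \<or> j = 5" for j :: 6
proof (cases j rule: bit0_cases)
  case (of_int z)
  then have "z = 0 \<or> z = 1 \<or> z = 2 \<or> z = 3 \<or> z = 4 \<or> z = 5" by auto
  with of_int show ?thesis by auto
qed

lemma six_numerals [simp]:
  "(6::6) = 0" "(7::6) = 1" "(8::6) = 2" "(9::6) = 3" "(10::6) = 4"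
  by simp_all

lemma six_add [simp]:
  "(i::6)+1+1 = i+2" "(i::6)+1+2 = i+3" "(i::6)+1+3 = i+4" "(i::6)+1+4 = i+5" "(i::6)+1+5 = i"
  "(i::6)+2+1 = i+3" "(i::6)+2+2 = i+4" "(i::6)+2+3 = i+5" "(i::6)+2+4 = i" "(i::6)+2+5 = i+1"
  "(i::6)+3+1 = i+4" "(i::6)+3+2 = i+5" "(i::6)+3+3 = i" "(i::6)+3+4 = i+1" "(i::6)+3+5 = i+2"
  "(i::6)+4+1 = i+5" "(i::6)+4+2 = i" "(i::6)+4+3 = i+1" "(i::6)+4+4 = i+2" "(i::6)+4+5 = i+3"
  "(i::6)+5+1 = i" "(i::6)+5+2 = i+1" "(i::6)+5+3 = i+2" "(i::6)+5+4 = i+3" "(i::6)+5+5 = i+4"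
  by (simp_all add: add.assoc)

lemma all_six: "(\<forall>j::6. P j) \<longleftrightarrow> P 0 \<and> P 1 \<and> P 2 \<and> P 3 \<and> P 4 \<and> P 5"
  using six_exhaust by metis

lemma all_six_from:
  "(\<forall>j::6. P j) \<longleftrightarrow> P i \<and> P (i+1) \<and> P (i+2) \<and> P (i+3) \<and> P (i+4) \<and> P (i+5)"
proof -
  have "(\<forall>j. P j) \<longleftrightarrow> (\<forall>j. P (i + j))"
    by (metis add.commute diff_add_cancel)
  then show ?thesis by (simp add: all_six)
qed

section \<open>The derivation on rational functions\<close>

text \<open>Makes numerals and rational coefficients available in the field of rational functions.\<close>

instance fract :: ("{idom,ring_char_0}") field_char_0
proof
  show "inj (of_nat :: nat \<Rightarrow> 'a fract)"
    by (rule injI) (simp add: of_nat_fract eq_fract)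
qed

lemma rat_const_hom [simp]:
  "rat_const 0 = 0" "rat_const 1 = 1"
  "rat_const (a + b) = rat_const a + rat_const b"
  "rat_const (a - b) = rat_const a - rat_const b"
  "rat_const (- a) = - rat_const a"
  "rat_const (a * b) = rat_const a * rat_const b"
  by (simp_all add: rat_const_def Zero_fract_def One_fract_def one_pCons mult.commute)

lemma rat_const_eq_iff [simp]: "rat_const a = rat_const b \<longleftrightarrow> a = b"
  by (simp add: rat_const_def eq_fract)

lemma rat_const_of_nat [simp]: "rat_const (of_nat n) = of_nat n"
  by (induction n) auto

lemma rat_const_numeral [simp]: "rat_const (numeral n) = numeral n"
  using rat_const_of_nat[of "numeral n"] by simp

lemma rat_const_inverse [simp]: "rat_const (inverse a) = inverse (rat_const a)"
proof (cases "a = 0")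
  case False
  then have "rat_const a * rat_const (inverse a) = 1"
    by (simp flip: rat_const_hom(6))
  with False show ?thesis by (metis inverse_unique)
qed auto

lemma rat_const_divide [simp]: "rat_const (a / b) = rat_const a / rat_const b"
  by (simp add: divide_inverse)

lemma rat_deriv_add: "rat_deriv (x + y) = rat_deriv x + rat_deriv y"
proof -
  obtain p q where x: "x = Fract p q" "q \<noteq> 0" by (cases x) auto
  obtain r s where y: "y = Fract r s" "s \<noteq> 0" by (cases y) auto
  show ?thesis using x y
    by (simp add: rat_deriv_Fract eq_fract pderiv_mult pderiv_add algebra_simps)
qed

lemma rat_deriv_mult: "rat_deriv (x * y) = x * rat_deriv y + rat_deriv x * y"
proof -
  obtain p q where x: "x = Fract p q" "q \<noteq> 0" by (cases x) auto
  obtain r s where y: "y = Fract r s" "s \<noteq> 0" by (cases y) auto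
  show ?thesis using x y
    by (simp add: rat_deriv_Fract eq_fract pderiv_mult pderiv_add algebra_simps)
qed

lemma rat_deriv_const [simp]: "rat_deriv (rat_const c) = 0"
  by (simp add: rat_const_def rat_deriv_Fract Zero_fract_def eq_fract)

lemma rat_deriv_t [simp]: "rat_deriv rat_t = 1"
  by (simp add: rat_t_def rat_deriv_Fract One_fract_def pderiv_pCons one_pCons)

lemma rat_deriv_0 [simp]: "rat_deriv 0 = 0" and rat_deriv_1 [simp]: "rat_deriv 1 = 0"
  using rat_deriv_const[of 0] rat_deriv_const[of 1] by simp_all

lemma rat_deriv_minus: "rat_deriv (- x) = - rat_deriv x"
  using rat_deriv_add[of x "- x"] by (simp add: eq_neg_iff_add_eq_0 add.commute)

lemma rat_deriv_diff: "rat_deriv (x - y) = rat_deriv x - rat_deriv y"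
  using rat_deriv_add[of x "- y"] by (simp add: rat_deriv_minus)

lemma rat_deriv_divide:
  assumes "y \<noteq> 0"
  shows "rat_deriv (x / y) = (rat_deriv x * y - x * rat_deriv y) / (y * y)"
proof -
  have "rat_deriv x = rat_deriv (x / y * y)" using assms by simp
  also have "\<dots> = x / y * rat_deriv y + rat_deriv (x / y) * y" by (rule rat_deriv_mult)
  finally show ?thesis using assms by (simp add: field_simps)
qed

lemma rat_t_nonzero [simp]: "rat_t \<noteq> 0"
  by (simp add: rat_t_def Zero_fract_def eq_fract)

section \<open>The system in normal form\<close>

text \<open>The cofactor of \<open>f\<^sub>i\<close> in the nonlinear part of the system, after the relation between the three
  \<open>f\<close> of the other parity has been used to shorten it. The parameter \<open>t\<close> is the common parity sum; it is 1
  for the rescaled functions \<open>g\<^sub>i\<close>.\<close>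

definition quadr :: "'a::comm_ring_1 \<Rightarrow> (6 \<Rightarrow> 'a) \<Rightarrow> 6 \<Rightarrow> 'a" where
  "quadr t f i = 2 * (f (i+1) * f (i+2) - f (i+4) * f (i+5)) + t * (f (i+4) - f (i+2))"

definition parsum :: "(6 \<Rightarrow> 'a::comm_monoid_add) \<Rightarrow> 6 \<Rightarrow> 'a" where
  "parsum \<alpha> i = \<alpha> i + \<alpha> (i+2) + \<alpha> (i+4)"

lemma parsum_const: "(\<forall>i. parsum f i = t) \<longleftrightarrow> f 0 + f 2 + f 4 = t \<and> f 1 + f 3 + f 5 = t"
  unfolding all_six by (simp add: parsum_def add.commute add.left_commute; metis add.commute add.left_commute)

lemma A5_normal_form:
  "A5_rational_solution \<alpha> f \<longleftrightarrow>
    (\<forall>i. rat_t / 2 * rat_deriv (f i) = f i * quadr rat_t f i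
        + (1/2 - rat_const (parsum \<alpha> i)) * f i + rat_const (\<alpha> i) * rat_t)
    \<and> (\<forall>i. parsum f i = rat_t)"
proof (cases "\<forall>i. parsum f i = rat_t")
  case True
  have "(rat_t / 2 * rat_deriv (f i) =
        f i * (f (i+1) * f (i+2) + f (i+1) * f (i+4) + f (i+3) * f (i+4)
               - f (i+2) * f (i+3) - f (i+2) * f (i+5) - f (i+4) * f (i+5))
        + rat_const (1/2 - \<alpha> (i+2) - \<alpha> (i+4)) * f i
        + rat_const (\<alpha> i) * (f (i+2) + f (i+4)))
     \<longleftrightarrow> rat_t / 2 * rat_deriv (f i) = f i * quadr rat_t f i
        + (1/2 - rat_const (parsum \<alpha> i)) * f i + rat_const (\<alpha> i) * rat_t" for i
  proof -
    have s: "f i = rat_t - f (i+2) - f (i+4)"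
      using True by (simp add: parsum_def algebra_simps)
    have s': "f (i+1) = rat_t - f (i+3) - f (i+5)"
      using True[rule_format, of "i+1"] by (simp add: parsum_def algebra_simps)
    have 1: "f (i+1) * f (i+2) + f (i+1) * f (i+4) + f (i+3) * f (i+4)
               - f (i+2) * f (i+3) - f (i+2) * f (i+5) - f (i+4) * f (i+5) = quadr rat_t f i"
      unfolding quadr_def s' by algebra
    have 2: "rat_const (1/2 - \<alpha> (i+2) - \<alpha> (i+4)) * f i + rat_const (\<alpha> i) * (f (i+2) + f (i+4))
       = (1/2 - rat_const (parsum \<alpha> i)) * f i + rat_const (\<alpha> i) * rat_t"
    proof -
      have "f (i+2) + f (i+4) = rat_t - f i" using s by simp
      then have "rat_const (\<alpha> i) * (f (i+2) + f (i+4)) = rat_const (\<alpha> i) * (rat_t - f i)" by simp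
      then show ?thesis by (simp add: parsum_def ring_distribs)
    qed
    show ?thesis unfolding 1 using 2 by (simp add: add.assoc)
  qed
  then show ?thesis using True parsum_const[of f rat_t] unfolding A5_rational_solution_def by simp
next
  case False
  then show ?thesis using parsum_const[of f rat_t] unfolding A5_rational_solution_def by auto
qed

lemma A5_eqD:
  assumes "A5_rational_solution \<alpha> f"
  shows "rat_t / 2 * rat_deriv (f i) = f i * quadr rat_t f i
        + (1/2 - rat_const (parsum \<alpha> i)) * f i + rat_const (\<alpha> i) * rat_t"
   and "f i + f (i+2) + f (i+4) = rat_t"
  using assms by (auto simp: A5_normal_form parsum_def)

lemma A5_zero_imp_zero:
  assumes "A5_rational_solution \<alpha> f" "f i = 0"
  shows "\<alpha> i = 0"
  using A5_eqD(1)[OF assms(1), of i] assms(2) rat_const_eq_iff[of "\<alpha> i" 0]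
  by (simp del: rat_const_eq_iff)

section \<open>Baecklund transformations preserve solutions\<close>

lemma bt_pi_solution:
  assumes "A5_rational_solution \<alpha> f"
  shows "A5_rational_solution (\<lambda>j. \<alpha> (j+1)) (\<lambda>j. f (j+1))"
  unfolding A5_normal_form
proof (intro conjI allI)
  fix i
  show "rat_t / 2 * rat_deriv (f (i+1)) = f (i+1) * quadr rat_t (\<lambda>j. f (j+1)) i
        + (1/2 - rat_const (parsum (\<lambda>j. \<alpha> (j+1)) i)) * f (i+1) + rat_const (\<alpha> (i+1)) * rat_t"
    using A5_eqD(1)[OF assms, of "i+1"] by (simp add: quadr_def parsum_def)
  show "parsum (\<lambda>j. f (j+1)) i = rat_t"
    using A5_eqD(2)[OF assms, of "i+1"] by (simp add: parsum_def)
qed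

definition reflect :: "6 \<Rightarrow> (6 \<Rightarrow> 'a::ab_group_add) \<Rightarrow> 6 \<Rightarrow> 'a" where
  "reflect i \<alpha> = (\<lambda>j. if j = i then - \<alpha> i else if j = i + 1 \<or> j = i - 1 then \<alpha> j + \<alpha> i else \<alpha> j)"

lemma reflect_at:
  "reflect i \<alpha> i = - \<alpha> i" "reflect i \<alpha> (i+1) = \<alpha> (i+1) + \<alpha> i" "reflect i \<alpha> (i+5) = \<alpha> (i+5) + \<alpha> i"
  "reflect i \<alpha> (i+2) = \<alpha> (i+2)" "reflect i \<alpha> (i+3) = \<alpha> (i+3)" "reflect i \<alpha> (i+4) = \<alpha> (i+4)"
  by (simp_all add: reflect_def)

text \<open>The polynomial content of the invariance under \<open>s\<^sub>i\<close>, with \<open>i\<close> rotated to 0 and \<open>w = \<alpha>\<^sub>0 / f\<^sub>0\<close>. The right-hand sides are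
  the old right-hand sides, corrected by the derivative of \<open>w\<close> at the two neighbours of 0.\<close>

lemma reflection_identities:
  fixes t w f0 f1 f2 f3 f4 f5 p0 p1 p2 p3 p4 p5 :: "'a::field_char_0"
  assumes "f4 = t - f0 - f2" "f5 = t - f1 - f3" "p5 = 1 - w * f0 - p1 - p2 - p3 - p4" "p0 = w * f0"
  shows
    "f0 * (2 * ((f1 + w) * f2 - f4 * (f5 - w)) + t * (f4 - f2)) + (1/2 - (- p0 + p2 + p4)) * f0 + - p0 * t
     = f0 * (2 * (f1 * f2 - f4 * f5) + t * (f4 - f2)) + (1/2 - (p0 + p2 + p4)) * f0 + p0 * t"
    "(f1 + w) * (2 * (f2 * f3 - (f5 - w) * f0) + t * (f5 - w - f3))
       + (1/2 - (p1 + p0 + p3 + (p5 + p0))) * (f1 + w) + (p1 + p0) * t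
     = (f1 * (2 * (f2 * f3 - f5 * f0) + t * (f5 - f3)) + (1/2 - (p1 + p3 + p5)) * f1 + p1 * t)
       + - w * (2 * (f1 * f2 - f4 * f5) + t * (f4 - f2) + (1/2 - (p0 + p2 + p4)) + w * t)"
    "f2 * (2 * (f3 * f4 - f0 * (f1 + w)) + t * (f0 - f4)) + (1/2 - (p2 + p4 + - p0)) * f2 + p2 * t
     = f2 * (2 * (f3 * f4 - f0 * f1) + t * (f0 - f4)) + (1/2 - (p2 + p4 + p0)) * f2 + p2 * t"
    "f3 * (2 * (f4 * (f5 - w) - (f1 + w) * f2) + t * (f1 + w - (f5 - w)))
       + (1/2 - (p3 + (p5 + p0) + (p1 + p0))) * f3 + p3 * t
     = f3 * (2 * (f4 * f5 - f1 * f2) + t * (f1 - f5)) + (1/2 - (p3 + p5 + p1)) * f3 + p3 * t"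
    "f4 * (2 * ((f5 - w) * f0 - f2 * f3) + t * (f2 - f0)) + (1/2 - (p4 + - p0 + p2)) * f4 + p4 * t
     = f4 * (2 * (f5 * f0 - f2 * f3) + t * (f2 - f0)) + (1/2 - (p4 + p0 + p2)) * f4 + p4 * t"
    "(f5 - w) * (2 * (f0 * (f1 + w) - f3 * f4) + t * (f3 - (f1 + w)))
       + (1/2 - (p5 + p0 + (p1 + p0) + p3)) * (f5 - w) + (p5 + p0) * t
     = (f5 * (2 * (f0 * f1 - f3 * f4) + t * (f3 - f1)) + (1/2 - (p5 + p1 + p3)) * f5 + p5 * t)
       - - w * (2 * (f1 * f2 - f4 * f5) + t * (f4 - f2) + (1/2 - (p0 + p2 + p4)) + w * t)"
  unfolding assms by (simp_all add: field_simps)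

lemma bt_s_solution:
  assumes sol: "A5_rational_solution \<alpha> f" and sum1: "parsum \<alpha> i + parsum \<alpha> (i+1) = 1"
    and nz: "f i \<noteq> 0"
  shows "A5_rational_solution (reflect i \<alpha>)
     (\<lambda>j. if j = i + 1 then f j + rat_const (\<alpha> i) / f i
          else if j = i - 1 then f j - rat_const (\<alpha> i) / f i else f j)"
    (is "A5_rational_solution _ ?g")
proof -
  define w where "w = rat_const (\<alpha> i) / f i"
  define p where "p = (\<lambda>j. rat_const (\<alpha> j))"
  define t where "t = rat_t"
  have pj: "rat_const (\<alpha> j) = p j" for j by (simp add: p_def)
  have pi: "p i = w * f i" using nz by (simp add: w_def p_def)
  have g: "?g i = f i" "?g (i+1) = f (i+1) + w" "?g (i+2) = f (i+2)" "?g (i+3) = f (i+3)"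
     "?g (i+4) = f (i+4)" "?g (i+5) = f (i+5) - w"
    by (simp_all add: w_def)
  note eq = A5_eqD(1)[OF sol, unfolded quadr_def parsum_def, folded t_def]
  have s0: "f i + f (i+2) + f (i+4) = t" and s1: "f (i+1) + f (i+3) + f (i+5) = t"
    using A5_eqD(2)[OF sol, of i] A5_eqD(2)[OF sol, of "i+1"] by (simp_all only: t_def six_add)
  have P: "p i + p (i+2) + p (i+4) + (p (i+1) + p (i+3) + p (i+5)) = 1"
    using arg_cong[OF sum1, of rat_const] by (simp only: p_def parsum_def rat_const_hom six_add)
  have e0: "t/2 * rat_deriv (f i) = f i * (2 * (f (i+1) * f (i+2) - f (i+4) * f (i+5)) + t * (f (i+4) - f (i+2)))
      + (1/2 - (p i + p (i+2) + p (i+4))) * f i + p i * t"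
    and e1: "t/2 * rat_deriv (f (i+1)) = f (i+1) * (2 * (f (i+2) * f (i+3) - f (i+5) * f i) + t * (f (i+5) - f (i+3)))
      + (1/2 - (p (i+1) + p (i+3) + p (i+5))) * f (i+1) + p (i+1) * t"
    and e2: "t/2 * rat_deriv (f (i+2)) = f (i+2) * (2 * (f (i+3) * f (i+4) - f i * f (i+1)) + t * (f i - f (i+4)))
      + (1/2 - (p (i+2) + p (i+4) + p i)) * f (i+2) + p (i+2) * t"
    and e3: "t/2 * rat_deriv (f (i+3)) = f (i+3) * (2 * (f (i+4) * f (i+5) - f (i+1) * f (i+2)) + t * (f (i+1) - f (i+5)))
      + (1/2 - (p (i+3) + p (i+5) + p (i+1))) * f (i+3) + p (i+3) * t"
    and e4: "t/2 * rat_deriv (f (i+4)) = f (i+4) * (2 * (f (i+5) * f i - f (i+2) * f (i+3)) + t * (f (i+2) - f i))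
      + (1/2 - (p (i+4) + p i + p (i+2))) * f (i+4) + p (i+4) * t"
    and e5: "t/2 * rat_deriv (f (i+5)) = f (i+5) * (2 * (f i * f (i+1) - f (i+3) * f (i+4)) + t * (f (i+3) - f (i+1)))
      + (1/2 - (p (i+5) + p (i+1) + p (i+3))) * f (i+5) + p (i+5) * t"
    using eq[of i] eq[of "i+1"] eq[of "i+2"] eq[of "i+3"] eq[of "i+4"] eq[of "i+5"]
    by (simp_all only: p_def t_def rat_const_hom six_add)
  have dw: "t/2 * rat_deriv w = - w * (2 * (f (i+1) * f (i+2) - f (i+4) * f (i+5)) + t * (f (i+4) - f (i+2))
      + (1/2 - (p i + p (i+2) + p (i+4))) + w * t)"
  proof -
    have "0 = t/2 * rat_deriv (w * f i)" using pi by (simp add: p_def flip: pi)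
    also have "\<dots> = (t/2 * rat_deriv w) * f i + w * (t/2 * rat_deriv (f i))"
      by (simp add: rat_deriv_mult algebra_simps)
    finally have "(t/2 * rat_deriv w) * f i = - w * (t/2 * rat_deriv (f i))"
      by (simp add: eq_neg_iff_add_eq_0)
    also have "\<dots> = - w * (2 * (f (i+1) * f (i+2) - f (i+4) * f (i+5)) + t * (f (i+4) - f (i+2))
      + (1/2 - (p i + p (i+2) + p (i+4))) + w * t) * f i"
      unfolding e0 using pi by algebra
    finally show ?thesis using nz by (metis mult_right_cancel)
  qed
  have h4: "f (i+4) = t - f i - f (i+2)" and h5: "f (i+5) = t - f (i+1) - f (i+3)"
    and h6: "p (i+5) = 1 - w * f i - p (i+1) - p (i+2) - p (i+3) - p (i+4)"
    using s0 s1 P pi by (auto simp: eq_diff_eq algebra_simps)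
  note ids = reflection_identities[OF h4 h5 h6 pi]
  have *: "(\<forall>j. rat_t / 2 * rat_deriv (?g j) = ?g j * quadr rat_t ?g j
        + (1/2 - rat_const (parsum (reflect i \<alpha>) j)) * ?g j + rat_const (reflect i \<alpha> j) * rat_t)"
    unfolding all_six_from[of _ i] quadr_def parsum_def
    apply (simp only: six_add g reflect_at rat_deriv_add rat_deriv_diff flip: t_def)
    apply (simp only: rat_const_hom pj distrib_left[of "t/2"] right_diff_distrib[of "t/2"] e0 e1 e2 e3 e4 e5 dw)
    apply (intro conjI)
    subgoal by (rule ids(1)[symmetric])
    subgoal by (rule ids(2)[symmetric])
    subgoal by (rule ids(3)[symmetric])
    subgoal by (rule ids(4)[symmetric])
    subgoal by (rule ids(5)[symmetric])
    subgoal by (rule ids(6)[symmetric])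
    done
  have **: "\<forall>j. parsum ?g j = rat_t"
    unfolding all_six_from[of _ i] parsum_def
    using s0 s1 by (simp only: t_def six_add g) (simp add: algebra_simps)
  from * ** show ?thesis by (simp add: A5_normal_form)
qed

lemma bt_s_eq_reflect: "f i \<noteq> 0 \<Longrightarrow> \<exists>g. bt_s i (\<alpha>, f) = (reflect i \<alpha>, g) \<and>
   (parsum \<alpha> i + parsum \<alpha> (i+1) = 1 \<longrightarrow> A5_rational_solution \<alpha> f \<longrightarrow> A5_rational_solution (reflect i \<alpha>) g)"
  using bt_s_solution[of \<alpha> f i] by (auto simp: bt_s_def reflect_def)

lemma total_parsum: "parsum \<alpha> i + parsum \<alpha> (i+1) = \<alpha> 0 + \<alpha> 1 + \<alpha> 2 + \<alpha> 3 + \<alpha> 4 + \<alpha> 5"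
  for \<alpha> :: "6 \<Rightarrow> 'a::comm_monoid_add"
  using six_exhaust[of i] by (elim disjE) (simp_all add: parsum_def add_ac)

lemma total_reflect: "parsum (reflect i \<alpha>) j + parsum (reflect i \<alpha>) (j+1) = parsum \<alpha> j + parsum \<alpha> (j+1)"
proof -
  have "parsum (reflect i \<alpha>) i + parsum (reflect i \<alpha>) (i+1) = parsum \<alpha> i + parsum \<alpha> (i+1)"
    by (simp add: parsum_def reflect_at)
  then show ?thesis by (simp add: total_parsum)
qed

section \<open>Moving the parameters into the fundamental alcove\<close>

text \<open>The number of integers that strictly separate \<open>d\<close> from the open unit interval.\<close>

definition wall_count :: "real \<Rightarrow> nat" where
  "wall_count d = nat \<lceil>\<bar>d - 1/2\<bar> - 1/2\<rceil>"

lemma wall_count_sym: "wall_count (1 - d) = wall_count d"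
  by (simp add: wall_count_def abs_minus_commute algebra_simps)

lemma wall_count_neg: "d < 0 \<Longrightarrow> wall_count (- d) < wall_count d"
proof -
  assume d: "d < 0"
  have 1: "\<lceil>\<bar>d - 1/2\<bar> - 1/2\<rceil> = \<lceil>- d\<rceil>" using d by simp
  have "\<bar>- d - 1/2\<bar> - 1/2 \<le> max (- d - 1) 0" using d by linarith
  then have "\<lceil>\<bar>- d - 1/2\<bar> - 1/2\<rceil> \<le> max (\<lceil>- d\<rceil> - 1) 0" by linarith
  moreover have "\<lceil>- d\<rceil> > 0" using d by simp
  ultimately show ?thesis unfolding wall_count_def 1 by linarith
qed

text \<open>The fifteen sums of consecutive coordinates are the positive roots of \<open>A\<^sub>5\<close>, so this is the number of reflection
  hyperplanes that separate \<open>q\<close> from the fundamental alcove.\<close>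

definition wall_distance :: "(6 \<Rightarrow> real) \<Rightarrow> nat" where
  "wall_distance q =
     wall_count (q 1) + wall_count (q 2) + wall_count (q 3) + wall_count (q 4) + wall_count (q 5)
   + wall_count (q 1 + q 2) + wall_count (q 2 + q 3) + wall_count (q 3 + q 4) + wall_count (q 4 + q 5)
   + wall_count (q 1 + q 2 + q 3) + wall_count (q 2 + q 3 + q 4) + wall_count (q 3 + q 4 + q 5)
   + wall_count (q 1 + q 2 + q 3 + q 4) + wall_count (q 2 + q 3 + q 4 + q 5)
   + wall_count (q 1 + q 2 + q 3 + q 4 + q 5)"

text \<open>The reflection permutes the fifteen roots up to \<open>d \<mapsto> 1 - d\<close>, which leaves the wall count unchanged; the one exception
  is the root belonging to \<open>q\<^sub>i\<close> itself, whose wall count drops because \<open>q\<^sub>i\<close> is negative.\<close>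

lemma wall_distance_reflect:
  assumes "q 0 + q 1 + q 2 + q 3 + q 4 + q 5 = 1" and "q i < 0"
  shows "wall_distance (reflect i q) < wall_distance q"
proof -
  note w = wall_count_neg[OF assms(2)]
  consider "i = 0" | "i = 1" | "i = 2" | "i = 3" | "i = 4" | "i = 5" using six_exhaust[of i] by blast
  then show ?thesis
  proof cases
    case 1
    have r: "reflect 0 q 0 = - q 0" "reflect 0 q 1 = q 1 + q 0" "reflect 0 q 2 = q 2" "reflect 0 q 3 = q 3"
      "reflect 0 q 4 = q 4" "reflect 0 q 5 = q 5 + q 0" by (simp_all add: reflect_def)
    have E: "wall_count (q 1 + q 2 + q 3 + q 4 + q 5) = wall_count (q 0)"
      "wall_count (q 1 + q 0 + q 2 + q 3 + q 4 + (q 5 + q 0)) = wall_count (- q 0)"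
      "wall_count (q 1 + q 0) = wall_count (q 2 + q 3 + q 4 + q 5)"
      "wall_count (q 1 + q 0 + q 2) = wall_count (q 3 + q 4 + q 5)"
      "wall_count (q 1 + q 0 + q 2 + q 3) = wall_count (q 4 + q 5)"
      "wall_count (q 1 + q 0 + q 2 + q 3 + q 4) = wall_count (q 5)"
      "wall_count (q 5 + q 0) = wall_count (q 1 + q 2 + q 3 + q 4)"
      "wall_count (q 4 + (q 5 + q 0)) = wall_count (q 1 + q 2 + q 3)"
      "wall_count (q 3 + q 4 + (q 5 + q 0)) = wall_count (q 1 + q 2)"
      "wall_count (q 2 + q 3 + q 4 + (q 5 + q 0)) = wall_count (q 1)"
      by (subst wall_count_sym[symmetric], rule arg_cong[where f = wall_count], use assms(1) in linarith)+
    show ?thesis using w unfolding 1 wall_distance_def r E by simp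
  next
    case 2
    have r: "reflect 1 q 1 = - q 1" "reflect 1 q 2 = q 2 + q 1" "reflect 1 q 3 = q 3" "reflect 1 q 4 = q 4" "reflect 1 q 5 = q 5" by (simp_all add: reflect_def)
    have E: "wall_count (q 2 + q 1) = wall_count (q 1 + q 2)"
      "wall_count (- q 1 + (q 2 + q 1)) = wall_count (q 2)"
      "wall_count ((q 2 + q 1) + q 3) = wall_count (q 1 + q 2 + q 3)"
      "wall_count (- q 1 + (q 2 + q 1) + q 3) = wall_count (q 2 + q 3)"
      "wall_count ((q 2 + q 1) + q 3 + q 4) = wall_count (q 1 + q 2 + q 3 + q 4)"
      "wall_count (- q 1 + (q 2 + q 1) + q 3 + q 4) = wall_count (q 2 + q 3 + q 4)"
      "wall_count ((q 2 + q 1) + q 3 + q 4 + q 5) = wall_count (q 1 + q 2 + q 3 + q 4 + q 5)"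
      "wall_count (- q 1 + (q 2 + q 1) + q 3 + q 4 + q 5) = wall_count (q 2 + q 3 + q 4 + q 5)"
      by (rule arg_cong[where f = wall_count], linarith)+
    show ?thesis using w unfolding 2 wall_distance_def r E by simp
  next
    case 3
    have r: "reflect 2 q 1 = q 1 + q 2" "reflect 2 q 2 = - q 2" "reflect 2 q 3 = q 3 + q 2" "reflect 2 q 4 = q 4" "reflect 2 q 5 = q 5" by (simp_all add: reflect_def)
    have E: "wall_count (q 3 + q 2) = wall_count (q 2 + q 3)"
      "wall_count ((q 1 + q 2) + - q 2) = wall_count (q 1)"
      "wall_count (- q 2 + (q 3 + q 2)) = wall_count (q 3)"
      "wall_count ((q 3 + q 2) + q 4) = wall_count (q 2 + q 3 + q 4)"
      "wall_count ((q 1 + q 2) + - q 2 + (q 3 + q 2)) = wall_count (q 1 + q 2 + q 3)"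
      "wall_count (- q 2 + (q 3 + q 2) + q 4) = wall_count (q 3 + q 4)"
      "wall_count ((q 3 + q 2) + q 4 + q 5) = wall_count (q 2 + q 3 + q 4 + q 5)"
      "wall_count ((q 1 + q 2) + - q 2 + (q 3 + q 2) + q 4) = wall_count (q 1 + q 2 + q 3 + q 4)"
      "wall_count (- q 2 + (q 3 + q 2) + q 4 + q 5) = wall_count (q 3 + q 4 + q 5)"
      "wall_count ((q 1 + q 2) + - q 2 + (q 3 + q 2) + q 4 + q 5) = wall_count (q 1 + q 2 + q 3 + q 4 + q 5)"
      by (rule arg_cong[where f = wall_count], linarith)+
    show ?thesis using w unfolding 3 wall_distance_def r E by simp
  next
    case 4
    have r: "reflect 3 q 1 = q 1" "reflect 3 q 2 = q 2 + q 3" "reflect 3 q 3 = - q 3" "reflect 3 q 4 = q 4 + q 3" "reflect 3 q 5 = q 5" by (simp_all add: reflect_def)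
    have E: "wall_count (q 4 + q 3) = wall_count (q 3 + q 4)"
      "wall_count (q 1 + (q 2 + q 3)) = wall_count (q 1 + q 2 + q 3)"
      "wall_count ((q 2 + q 3) + - q 3) = wall_count (q 2)"
      "wall_count (- q 3 + (q 4 + q 3)) = wall_count (q 4)"
      "wall_count ((q 4 + q 3) + q 5) = wall_count (q 3 + q 4 + q 5)"
      "wall_count (q 1 + (q 2 + q 3) + - q 3) = wall_count (q 1 + q 2)"
      "wall_count ((q 2 + q 3) + - q 3 + (q 4 + q 3)) = wall_count (q 2 + q 3 + q 4)"
      "wall_count (- q 3 + (q 4 + q 3) + q 5) = wall_count (q 4 + q 5)"
      "wall_count (q 1 + (q 2 + q 3) + - q 3 + (q 4 + q 3)) = wall_count (q 1 + q 2 + q 3 + q 4)"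
      "wall_count ((q 2 + q 3) + - q 3 + (q 4 + q 3) + q 5) = wall_count (q 2 + q 3 + q 4 + q 5)"
      "wall_count (q 1 + (q 2 + q 3) + - q 3 + (q 4 + q 3) + q 5) = wall_count (q 1 + q 2 + q 3 + q 4 + q 5)"
      by (rule arg_cong[where f = wall_count], linarith)+
    show ?thesis using w unfolding 4 wall_distance_def r E by simp
  next
    case 5
    have r: "reflect 4 q 1 = q 1" "reflect 4 q 2 = q 2" "reflect 4 q 3 = q 3 + q 4" "reflect 4 q 4 = - q 4" "reflect 4 q 5 = q 5 + q 4" by (simp_all add: reflect_def)
    have E: "wall_count (q 5 + q 4) = wall_count (q 4 + q 5)"
      "wall_count (q 2 + (q 3 + q 4)) = wall_count (q 2 + q 3 + q 4)"
      "wall_count ((q 3 + q 4) + - q 4) = wall_count (q 3)"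
      "wall_count (- q 4 + (q 5 + q 4)) = wall_count (q 5)"
      "wall_count (q 1 + q 2 + (q 3 + q 4)) = wall_count (q 1 + q 2 + q 3 + q 4)"
      "wall_count (q 2 + (q 3 + q 4) + - q 4) = wall_count (q 2 + q 3)"
      "wall_count ((q 3 + q 4) + - q 4 + (q 5 + q 4)) = wall_count (q 3 + q 4 + q 5)"
      "wall_count (q 1 + q 2 + (q 3 + q 4) + - q 4) = wall_count (q 1 + q 2 + q 3)"
      "wall_count (q 2 + (q 3 + q 4) + - q 4 + (q 5 + q 4)) = wall_count (q 2 + q 3 + q 4 + q 5)"
      "wall_count (q 1 + q 2 + (q 3 + q 4) + - q 4 + (q 5 + q 4)) = wall_count (q 1 + q 2 + q 3 + q 4 + q 5)"
      by (rule arg_cong[where f = wall_count], linarith)+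
    show ?thesis using w unfolding 5 wall_distance_def r E by simp
  next
    case 6
    have r: "reflect 5 q 1 = q 1" "reflect 5 q 2 = q 2" "reflect 5 q 3 = q 3" "reflect 5 q 4 = q 4 + q 5" "reflect 5 q 5 = - q 5" by (simp_all add: reflect_def)
    have E: "wall_count (q 3 + (q 4 + q 5)) = wall_count (q 3 + q 4 + q 5)"
      "wall_count ((q 4 + q 5) + - q 5) = wall_count (q 4)"
      "wall_count (q 2 + q 3 + (q 4 + q 5)) = wall_count (q 2 + q 3 + q 4 + q 5)"
      "wall_count (q 3 + (q 4 + q 5) + - q 5) = wall_count (q 3 + q 4)"
      "wall_count (q 1 + q 2 + q 3 + (q 4 + q 5)) = wall_count (q 1 + q 2 + q 3 + q 4 + q 5)"
      "wall_count (q 2 + q 3 + (q 4 + q 5) + - q 5) = wall_count (q 2 + q 3 + q 4)"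
      "wall_count (q 1 + q 2 + q 3 + (q 4 + q 5) + - q 5) = wall_count (q 1 + q 2 + q 3 + q 4)"
      by (rule arg_cong[where f = wall_count], linarith)+
    show ?thesis using w unfolding 6 wall_distance_def r E by simp
  qed
qed

definition generic_functional :: "real \<Rightarrow> complex \<Rightarrow> real" where
  "generic_functional e z = Re z + e * Im z"

lemma generic_functional_simps [simp]:
  "generic_functional e (x + y) = generic_functional e x + generic_functional e y"
  "generic_functional e (x - y) = generic_functional e x - generic_functional e y"
  "generic_functional e (- x) = - generic_functional e x"
  "generic_functional e 0 = 0" "generic_functional e 1 = 1"
  "generic_functional e (of_int n) = of_int n" "generic_functional e (of_nat m) = of_nat m"
  "generic_functional e (numeral k * x) = numeral k * generic_functional e x"
  "generic_functional e (numeral k) = numeral k"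
  "generic_functional e (of_int n * x) = of_int n * generic_functional e x"
  by (simp_all add: generic_functional_def algebra_simps)

definition int_span :: "(6 \<Rightarrow> complex) \<Rightarrow> complex set" where
  "int_span \<alpha> = range (\<lambda>(n, n0, n1, n2, n3, n4, n5). of_int n + of_int n0 * \<alpha> 0 + of_int n1 * \<alpha> 1 + of_int n2 * \<alpha> 2
      + of_int n3 * \<alpha> 3 + of_int n4 * \<alpha> 4 + of_int n5 * \<alpha> 5)"

lemma int_spanI: "z = of_int n + of_int n0 * \<alpha> 0 + of_int n1 * \<alpha> 1 + of_int n2 * \<alpha> 2
      + of_int n3 * \<alpha> 3 + of_int n4 * \<alpha> 4 + of_int n5 * \<alpha> 5 \<Longrightarrow> z \<in> int_span \<alpha>"
  unfolding int_span_def by (rule image_eqI[of _ _ "(n, n0, n1, n2, n3, n4, n5)"]) auto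

lemma int_span_closed:
  shows int_span_base: "\<alpha> i \<in> int_span \<alpha>"
    and int_span_int: "of_int m \<in> int_span \<alpha>"
    and int_span_add: "x \<in> int_span \<alpha> \<Longrightarrow> y \<in> int_span \<alpha> \<Longrightarrow> x + y \<in> int_span \<alpha>"
    and int_span_minus: "x \<in> int_span \<alpha> \<Longrightarrow> - x \<in> int_span \<alpha>"
proof -
  show "\<alpha> i \<in> int_span \<alpha>"
    using six_exhaust[of i]
  proof (elim disjE)
    assume "i = 0" then show ?thesis by (intro int_spanI[of _ 0 1 _ 0 0 0 0 0]) simp
  next
    assume "i = 1" then show ?thesis by (intro int_spanI[of _ 0 0 _ 1 0 0 0 0]) simp
  next
    assume "i = 2" then show ?thesis by (intro int_spanI[of _ 0 0 _ 0 1 0 0 0]) simp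
  next
    assume "i = 3" then show ?thesis by (intro int_spanI[of _ 0 0 _ 0 0 1 0 0]) simp
  next
    assume "i = 4" then show ?thesis by (intro int_spanI[of _ 0 0 _ 0 0 0 1 0]) simp
  next
    assume "i = 5" then show ?thesis by (intro int_spanI[of _ 0 0 _ 0 0 0 0 1]) simp
  qed
  show "of_int m \<in> int_span \<alpha>" by (rule int_spanI[of _ m 0 _ 0 0 0 0 0]) simp
  show "- x \<in> int_span \<alpha>" if "x \<in> int_span \<alpha>"
  proof -
    from that obtain n n0 n1 n2 n3 n4 n5 where x: "x = of_int n + of_int n0 * \<alpha> 0 + of_int n1 * \<alpha> 1 + of_int n2 * \<alpha> 2
      + of_int n3 * \<alpha> 3 + of_int n4 * \<alpha> 4 + of_int n5 * \<alpha> 5" by (auto simp: int_span_def)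
    show ?thesis unfolding x
      by (rule int_spanI[of _ "-n" "-n0" _ "-n1" "-n2" "-n3" "-n4" "-n5"]) (simp add: algebra_simps)
  qed
  show "x + y \<in> int_span \<alpha>" if xy: "x \<in> int_span \<alpha>" "y \<in> int_span \<alpha>"
  proof -
    from xy obtain n n0 n1 n2 n3 n4 n5 where x: "x = of_int n + of_int n0 * \<alpha> 0 + of_int n1 * \<alpha> 1 + of_int n2 * \<alpha> 2
      + of_int n3 * \<alpha> 3 + of_int n4 * \<alpha> 4 + of_int n5 * \<alpha> 5" by (auto simp: int_span_def)
    from xy obtain m m0 m1 m2 m3 m4 m5 where y: "y = of_int m + of_int m0 * \<alpha> 0 + of_int m1 * \<alpha> 1 + of_int m2 * \<alpha> 2
      + of_int m3 * \<alpha> 3 + of_int m4 * \<alpha> 4 + of_int m5 * \<alpha> 5" by (auto simp: int_span_def)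
    show ?thesis unfolding x y
      by (rule int_spanI[of _ "n+m" "n0+m0" _ "n1+m1" "n2+m2" "n3+m3" "n4+m4" "n5+m5"]) (simp add: algebra_simps)
  qed
qed

text \<open>Each nonzero \<open>z\<close> excludes at most one slope \<open>e\<close>, and the span is countable while the real line is not.\<close>

lemma generic_functional_injective:
  "\<exists>e. \<forall>z \<in> int_span \<alpha>. generic_functional e z = 0 \<longrightarrow> z = 0"
proof -
  have "countable (int_span \<alpha>)" unfolding int_span_def by (intro countable_image countableI_type)
  then have "countable ((\<lambda>z. - Re z / Im z) ` int_span \<alpha>)" by simp
  then obtain e where e: "e \<notin> (\<lambda>z. - Re z / Im z) ` int_span \<alpha>"
    using uncountable_UNIV_real by (metis (mono_tags) UNIV_eq_I)
  have "z = 0" if z: "z \<in> int_span \<alpha>" "generic_functional e z = 0" for z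
  proof (cases "Im z = 0")
    case True
    then show ?thesis using z(2) by (simp add: generic_functional_def complex_eq_iff)
  next
    case False
    then have "e = - Re z / Im z" using z(2) by (simp add: generic_functional_def field_simps)
    then show ?thesis using e z(1) by blast
  qed
  then show ?thesis by blast
qed

text \<open>As long as some \<open>\<lambda>(\<beta>\<^sub>i)\<close> is negative, \<open>\<beta>\<^sub>i\<close> and hence \<open>f\<^sub>i\<close> is not zero, so \<open>s\<^sub>i\<close> really acts as a
  reflection and brings the parameters closer to the alcove.\<close>

lemma reach_alcove:
  assumes sol: "A5_rational_solution \<alpha> f" and sum1: "\<alpha> 0 + \<alpha> 1 + \<alpha> 2 + \<alpha> 3 + \<alpha> 4 + \<alpha> 5 = 1"
  shows "\<exists>T\<in>backlund. \<exists>\<beta> g. T (\<alpha>, f) = (\<beta>, g) \<and> A5_rational_solution \<beta> g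
     \<and> \<beta> 0 + \<beta> 1 + \<beta> 2 + \<beta> 3 + \<beta> 4 + \<beta> 5 = 1
     \<and> (\<forall>i. \<beta> i \<in> int_span \<alpha>) \<and> (\<forall>i. generic_functional e (\<beta> i) \<ge> 0)"
proof -
  define P where "P \<beta> g \<longleftrightarrow> A5_rational_solution \<beta> g \<and> \<beta> 0 + \<beta> 1 + \<beta> 2 + \<beta> 3 + \<beta> 4 + \<beta> 5 = 1
     \<and> (\<forall>i. \<beta> i \<in> int_span \<alpha>)" for \<beta> g
  have "\<exists>T\<in>backlund. \<exists>\<gamma> h. T (\<alpha>, f) = (\<gamma>, h) \<and> P \<gamma> h \<and> (\<forall>i. generic_functional e (\<gamma> i) \<ge> 0)"
    if "P \<beta> g" "\<exists>T\<in>backlund. T (\<alpha>, f) = (\<beta>, g)" for \<beta> g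
    using that
  proof (induction "wall_distance (\<lambda>i. generic_functional e (\<beta> i))" arbitrary: \<beta> g rule: less_induct)
    case less
    show ?case
    proof (cases "\<forall>i. generic_functional e (\<beta> i) \<ge> 0")
      case True
      then show ?thesis using less.prems by blast
    next
      case False
      then obtain i where i: "generic_functional e (\<beta> i) < 0" by (auto simp: not_le)
      from less.prems(2) obtain T where T: "T \<in> backlund" "T (\<alpha>, f) = (\<beta>, g)" by blast
      have sol': "A5_rational_solution \<beta> g" and s: "parsum \<beta> i + parsum \<beta> (i+1) = 1"
        and sp: "\<forall>i. \<beta> i \<in> int_span \<alpha>"
        using less.prems(1) by (auto simp: P_def total_parsum)
      have "g i \<noteq> 0" using A5_zero_imp_zero[OF sol', of i] i by auto
      from bt_s_eq_reflect[of g i \<beta>, OF this] s sol' obtain h where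
        h: "bt_s i (\<beta>, g) = (reflect i \<beta>, h)" "A5_rational_solution (reflect i \<beta>) h" by blast
      have "(bt_s i \<circ> T) (\<alpha>, f) = (reflect i \<beta>, h)" using T h by simp
      moreover have "bt_s i \<circ> T \<in> backlund" by (rule backlund.s[OF T(1)])
      moreover have "P (reflect i \<beta>) h"
        using h(2) total_reflect[of i \<beta> i] s sp
        by (auto simp: P_def total_parsum reflect_def intro: int_span_add int_span_minus)
      moreover have "wall_distance (\<lambda>j. generic_functional e (reflect i \<beta> j))
          < wall_distance (\<lambda>j. generic_functional e (\<beta> j))"
      proof -
        have "(\<lambda>j. generic_functional e (reflect i \<beta> j)) = reflect i (\<lambda>j. generic_functional e (\<beta> j))"
          by (auto simp: reflect_def fun_eq_iff)
        moreover have "generic_functional e (\<beta> 0) + generic_functional e (\<beta> 1) + generic_functional e (\<beta> 2)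
           + generic_functional e (\<beta> 3) + generic_functional e (\<beta> 4) + generic_functional e (\<beta> 5) = 1"
          using arg_cong[OF s[unfolded total_parsum], of "generic_functional e"] by simp
        ultimately show ?thesis using wall_distance_reflect i by metis
      qed
      ultimately show ?thesis using less.hyps[of "reflect i \<beta>" h] by blast
    qed
  qed
  moreover have "P \<alpha> f" using sol sum1 int_span_base by (simp add: P_def)
  moreover have "\<exists>T\<in>backlund. T (\<alpha>, f) = (\<alpha>, f)" by (rule bexI[OF _ backlund.id]) simp
  ultimately obtain T \<gamma> h where "T \<in> backlund" "T (\<alpha>, f) = (\<gamma>, h)" "P \<gamma> h"
     "\<forall>i. generic_functional e (\<gamma> i) \<ge> 0" by blast
  then show ?thesis unfolding P_def by blast
qed

section \<open>Substituting into rational functions\<close>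

text \<open>Substituting an element \<open>T\<close> of a differential field for the variable of a rational function. This covers Laurent
  expansions at a finite point and at infinity, and the substitutions of \<open>-t\<close> and \<open>t\<^sup>2\<close> for \<open>t\<close>.\<close>

locale substitution =
  fixes emb :: "complex \<Rightarrow> 'k::field" and del :: "'k \<Rightarrow> 'k" and T :: 'k
  assumes emb_1: "emb 1 = 1" and emb_add: "emb (a + b) = emb a + emb b"
    and emb_mult: "emb (a * b) = emb a * emb b"
    and del_add: "del (x + y) = del x + del y" and del_mult: "del (x * y) = x * del y + del x * y"
    and del_emb: "del (emb c) = 0" and del_T: "del T \<noteq> 0"
begin

lemma emb_0: "emb 0 = 0" using emb_add[of 0 0] by (metis add_cancel_left_left)

lemma emb_eq_0: "emb c = 0 \<longleftrightarrow> c = 0"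
  using emb_mult[of c "inverse c"] emb_1 emb_0 by (cases "c = 0") auto

definition peval :: "complex poly \<Rightarrow> 'k" where "peval p = poly (map_poly emb p) T"

lemma map_poly_emb_pCons: "map_poly emb (pCons a p) = pCons (emb a) (map_poly emb p)"
  by (simp add: map_poly_pCons emb_0)

lemma peval_pCons: "peval (pCons a p) = emb a + T * peval p"
  by (simp add: peval_def map_poly_emb_pCons)

lemma peval_0 [simp]: "peval 0 = 0" by (simp add: peval_def)

lemma peval_add: "peval (p + q) = peval p + peval q"
proof (induction p arbitrary: q)
  case (pCons a p)
  obtain b r where q: "q = pCons b r" by (cases q) auto
  show ?case unfolding q using pCons(2)[of r] by (simp add: peval_pCons emb_add algebra_simps)
qed simp

lemma peval_smult: "peval (smult c p) = emb c * peval p"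
  by (induction p) (simp_all add: peval_pCons emb_mult algebra_simps)

lemma peval_mult: "peval (p * q) = peval p * peval q"
  by (induction p) (simp_all add: peval_pCons peval_add peval_smult emb_0 algebra_simps)

lemma peval_1: "peval 1 = 1" by (simp add: one_pCons peval_pCons emb_1)

lemma peval_minus: "peval (- p) = - peval p"
  using peval_add[of p "- p"] by (simp add: eq_neg_iff_add_eq_0 add.commute)

lemma peval_diff: "peval (p - q) = peval p - peval q"
  using peval_add[of p "- q"] by (simp add: peval_minus)

lemma del_peval: "del (peval p) = peval (pderiv p) * del T"
proof (induction p)
  case 0
  show ?case using del_emb[of 0] by (simp add: emb_0)
next
  case (pCons a p)
  then show ?case
    by (simp add: peval_pCons del_add del_mult del_emb pderiv_pCons peval_add emb_0 algebra_simps)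
qed

text \<open>An element that is not a constant for the derivation is transcendental: differentiating an algebraic relation
  would give one of lower degree.\<close>

lemma peval_eq_0: "peval p = 0 \<longleftrightarrow> p = 0"
proof
  assume "peval p = 0"
  then show "p = 0"
  proof (induction "degree p" arbitrary: p rule: less_induct)
    case less
    have "peval (pderiv p) * del T = 0" using del_peval[of p] less.prems del_emb[of 0] by (simp add: emb_0)
    then have d: "peval (pderiv p) = 0" using del_T by simp
    have "degree p = 0"
    proof (rule ccontr)
      assume "degree p \<noteq> 0"
      then have "degree (pderiv p) < degree p" "pderiv p \<noteq> 0" by (auto simp: degree_pderiv pderiv_eq_0_iff)
      with less.hyps d show False by blast
    qed
    then obtain c where "p = [:c:]" by (metis degree_eq_zeroE)
    then show ?case using less.prems by (simp add: peval_pCons emb_eq_0)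
  qed
qed simp

definition ev :: "ratfun \<Rightarrow> 'k" where
  "ev r = (THE y. \<forall>p q. q \<noteq> 0 \<longrightarrow> r = Fract p q \<longrightarrow> y = peval p / peval q)"

lemma ev_Fract: assumes "q \<noteq> 0" shows "ev (Fract p q) = peval p / peval q"
  unfolding ev_def
proof (rule the_equality)
  show "\<forall>p' q'. q' \<noteq> 0 \<longrightarrow> Fract p q = Fract p' q' \<longrightarrow> peval p / peval q = peval p' / peval q'"
  proof (intro allI impI)
    fix p' q' assume "q' \<noteq> 0" "Fract p q = Fract p' q'"
    then have "p * q' = p' * q" using assms by (simp add: eq_fract)
    then have "peval p * peval q' = peval p' * peval q" by (metis peval_mult)
    then show "peval p / peval q = peval p' / peval q'"
      using assms \<open>q' \<noteq> 0\<close> by (simp add: frac_eq_eq peval_eq_0)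
  qed
qed (use assms in blast)

lemma ev_add: "ev (x + y) = ev x + ev y"
proof -
  obtain p q where x: "x = Fract p q" "q \<noteq> 0" by (cases x) auto
  obtain r s where y: "y = Fract r s" "s \<noteq> 0" by (cases y) auto
  show ?thesis using x y
    by (simp add: ev_Fract peval_add peval_mult peval_eq_0 add_frac_eq)
qed

lemma ev_mult: "ev (x * y) = ev x * ev y"
proof -
  obtain p q where x: "x = Fract p q" "q \<noteq> 0" by (cases x) auto
  obtain r s where y: "y = Fract r s" "s \<noteq> 0" by (cases y) auto
  show ?thesis using x y by (simp add: ev_Fract peval_mult)
qed

lemma ev_const: "ev (rat_const c) = emb c"
  by (simp add: rat_const_def ev_Fract peval_pCons peval_1)

lemma ev_t: "ev rat_t = T"
  by (simp add: rat_t_def ev_Fract peval_pCons peval_1 emb_0 emb_1)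

lemma ev_0 [simp]: "ev 0 = 0" and ev_1 [simp]: "ev 1 = 1"
  using ev_const[of 0] ev_const[of 1] by (simp_all add: emb_0 emb_1)

lemma ev_minus: "ev (- x) = - ev x"
  using ev_add[of x "- x"] by (simp add: eq_neg_iff_add_eq_0 add.commute)

lemma ev_diff: "ev (x - y) = ev x - ev y"
  using ev_add[of x "- y"] by (simp add: ev_minus)

lemma ev_eq_0: "ev x = 0 \<longleftrightarrow> x = 0"
proof -
  obtain p q where x: "x = Fract p q" "q \<noteq> 0" by (cases x) auto
  show ?thesis using x by (simp add: ev_Fract peval_eq_0 Zero_fract_def eq_fract)
qed

lemma ev_inject: "ev x = ev y \<longleftrightarrow> x = y"
  using ev_eq_0[of "x - y"] by (simp add: ev_diff)

lemma ev_divide: "ev (x / y) = ev x / ev y"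
proof (cases "y = 0")
  case False
  have "ev x = ev (x / y) * ev y" using False by (simp flip: ev_mult)
  then show ?thesis using False by (simp add: ev_eq_0 field_simps)
qed simp

lemma ev_numeral [simp]: "ev (numeral n) = numeral n"
proof -
  have "ev (of_nat m) = of_nat m" for m by (induction m) (simp_all add: ev_add)
  from this[of "numeral n"] show ?thesis by simp
qed

lemma ev_quadr: "ev (quadr x f i) = quadr (ev x) (\<lambda>j. ev (f j)) i"
  by (simp add: quadr_def ev_add ev_mult ev_diff)

lemma ev_deriv: "del (ev x) = ev (rat_deriv x) * del T"
proof -
  obtain p q where x: "x = Fract p q" "q \<noteq> 0" by (cases x) auto
  then have nz: "peval q \<noteq> 0" by (simp add: peval_eq_0)
  have "ev x * peval q = peval p" using x nz by (simp add: ev_Fract)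
  then have "ev x * (peval (pderiv q) * del T) + del (ev x) * peval q = peval (pderiv p) * del T"
    by (metis del_mult del_peval)
  then have "del (ev x) * peval q = (peval (pderiv p) - ev x * peval (pderiv q)) * del T"
    by (simp add: algebra_simps)
  then have "del (ev x) = (peval (pderiv p) - ev x * peval (pderiv q)) * del T / peval q"
    using nz by (simp add: field_simps)
  also have "(peval (pderiv p) - ev x * peval (pderiv q)) * del T / peval q = ev (rat_deriv x) * del T"
  proof -
    have 1: "ev (rat_deriv x) * (peval q * peval q) = peval (pderiv p) * peval q - peval p * peval (pderiv q)"
      using x nz by (simp add: rat_deriv_Fract ev_Fract peval_mult peval_diff)
    have 2: "peval p = ev x * peval q" using x nz by (simp add: ev_Fract)
    have "(ev (rat_deriv x) * peval q) * peval q = (peval (pderiv p) - ev x * peval (pderiv q)) * peval q"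
      using 1 unfolding 2 by (simp add: algebra_simps)
    then have "peval (pderiv p) - ev x * peval (pderiv q) = ev (rat_deriv x) * peval q"
      using nz by simp
    then show ?thesis using nz by simp
  qed
  finally show ?thesis .
qed

end

lemma substitution_fls:
  "fls_deriv T \<noteq> 0 \<Longrightarrow> substitution (fls_const :: complex \<Rightarrow> _) fls_deriv T"
  by unfold_locales (auto simp: fls_plus_const fls_const_mult_const)

lemma substitution_ratfun:
  "rat_deriv T \<noteq> 0 \<Longrightarrow> substitution rat_const rat_deriv T"
  by unfold_locales (auto simp: rat_deriv_add rat_deriv_mult)

section \<open>Laurent series of bounded pole order\<close>

notation fls_nth (infixl "$$" 75)

text \<open>Vanishing order at least \<open>n\<close>, with the zero series included; negative \<open>n\<close> allows poles.\<close>

definition ord_ge :: "int \<Rightarrow> complex fls \<Rightarrow> bool" where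
  "ord_ge n y \<longleftrightarrow> (\<forall>k<n. y $$ k = 0)"

lemma ord_ge_iff: "ord_ge n y \<longleftrightarrow> y = 0 \<or> n \<le> fls_subdegree y"
proof
  assume "ord_ge n y" then show "y = 0 \<or> n \<le> fls_subdegree y"
    unfolding ord_ge_def by (metis linorder_not_le nth_fls_subdegree_nonzero)
qed (auto simp: ord_ge_def)

lemma ord_ge_mono: "ord_ge n y \<Longrightarrow> m \<le> n \<Longrightarrow> ord_ge m y" by (auto simp: ord_ge_def)

lemma ord_ge_simps [simp]: "ord_ge n 0" "ord_ge n (- y) \<longleftrightarrow> ord_ge n y" by (auto simp: ord_ge_def)

lemma ord_ge_add: "ord_ge n x \<Longrightarrow> ord_ge n y \<Longrightarrow> ord_ge n (x + y)" and
  ord_ge_diff: "ord_ge n x \<Longrightarrow> ord_ge n y \<Longrightarrow> ord_ge n (x - y)"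
  by (auto simp: ord_ge_def)

lemma ord_ge_const: "n \<le> 0 \<Longrightarrow> ord_ge n (fls_const c)" and ord_ge_1: "n \<le> 0 \<Longrightarrow> ord_ge n 1"
  and ord_ge_numeral: "n \<le> 0 \<Longrightarrow> ord_ge n (numeral w)"
  by (auto simp: ord_ge_def)

lemma ord_ge_mult: "ord_ge m x \<Longrightarrow> ord_ge n y \<Longrightarrow> ord_ge (m + n) (x * y)"
  by (cases "x = 0"; cases "y = 0") (simp_all add: ord_ge_iff)

lemma ord_ge_mult': "ord_ge m x \<Longrightarrow> ord_ge n y \<Longrightarrow> k \<le> m + n \<Longrightarrow> ord_ge k (x * y)"
  by (rule ord_ge_mono[OF ord_ge_mult])

lemma ord_ge_deriv: "ord_ge n y \<Longrightarrow> ord_ge (n - 1) (fls_deriv y)"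
  by (auto simp: ord_ge_def)

lemma ord_ge_Suc: "ord_ge n y \<Longrightarrow> y $$ n = 0 \<Longrightarrow> ord_ge (n + 1) y"
  by (auto simp: ord_ge_def le_less)

lemma ord_ge_cancel:
  assumes "ord_ge n (x * y)" "x $$ m \<noteq> 0" "ord_ge m x"
  shows "ord_ge (n - m) y"
proof (cases "y = 0")
  case False
  have x: "x \<noteq> 0" "fls_subdegree x = m"
    using assms(2,3) by (auto simp: ord_ge_def intro!: fls_subdegree_eqI)
  have "n \<le> fls_subdegree (x * y)" using assms(1) x False by (auto simp: ord_ge_iff)
  then show ?thesis using x False by (simp add: ord_ge_iff)
qed simp

lemma fls_eq_shift_fps: "ord_ge m x \<Longrightarrow> x = fls_shift (- m) (fps_to_fls (fls_regpart (fls_shift m x)))"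
  by (rule fls_eqI) (simp add: ord_ge_def fls_shift_nth)

lemma nth_mult_ord_ge:
  assumes "ord_ge m x" "ord_ge n y"
  shows "(x * y) $$ (m + n + int k) = (\<Sum>i\<le>k. x $$ (m + int i) * y $$ (n + int (k - i)))"
proof -
  define a where "a = fls_regpart (fls_shift m x)"
  define b where "b = fls_regpart (fls_shift n y)"
  have x: "x = fls_shift (- m) (fps_to_fls a)" and y: "y = fls_shift (- n) (fps_to_fls b)"
    unfolding a_def b_def by (rule fls_eq_shift_fps, fact)+
  have xy: "x * y = fls_shift (- m) (fls_shift (- n) (fps_to_fls (a * b)))"
    unfolding x y by (simp only: fls_shifted_times_simps fls_shift_fls_shift add.commute fls_times_fps_to_fls)
  have "(x * y) $$ (m + n + int k) = fps_to_fls (a * b) $$ int k"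
  proof -
    have "m + n + int k + - m + - n = int k" by simp
    then show ?thesis unfolding xy by (simp only: fls_shift_nth)
  qed
  also have "\<dots> = fps_nth (a * b) k" by (simp only: fps_to_fls_nth) simp
  also have "\<dots> = (\<Sum>i\<le>k. fps_nth a i * fps_nth b (k - i))"
    by (simp only: fps_mult_nth atLeast0AtMost)
  also have "\<dots> = (\<Sum>i\<le>k. x $$ (m + int i) * y $$ (n + int (k - i)))"
    by (rule sum.cong[OF refl]) (simp add: a_def b_def add.commute)
  finally show ?thesis .
qed

lemma nth_mult_lead:
  assumes "ord_ge m x" "ord_ge n y" "k = m + n"
  shows "(x * y) $$ k = x $$ m * y $$ n"
  unfolding assms(3) using nth_mult_ord_ge[OF assms(1,2), of 0] by simp

lemma nth_mult_lead1:
  assumes "ord_ge m x" "ord_ge n y" "k = m + n + 1"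
  shows "(x * y) $$ k = x $$ m * y $$ (n + 1) + x $$ (m + 1) * y $$ n"
proof -
  have "{..1::nat} = {0, 1}" by auto
  then show ?thesis unfolding assms(3) using nth_mult_ord_ge[OF assms(1,2), of 1] by simp
qed

lemma nth_mult_lead2:
  assumes "ord_ge m x" "ord_ge n y" "k = m + n + 2"
  shows "(x * y) $$ k = x $$ m * y $$ (n + 2) + x $$ (m + 1) * y $$ (n + 1) + x $$ (m + 2) * y $$ n"
proof -
  have S: "(\<Sum>i\<le>2. h i) = h 0 + h 1 + h (2::nat)" for h :: "nat \<Rightarrow> complex"
    by (simp add: eval_nat_numeral)
  have "(x * y) $$ (m + n + int 2) = (\<Sum>i\<le>2. x $$ (m + int i) * y $$ (n + int (2 - i)))"
    by (rule nth_mult_ord_ge[OF assms(1,2)])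
  then show ?thesis unfolding S assms(3) by simp
qed

section \<open>Pole orders of local solutions\<close>

lemma fls_two_nonzero [simp]: "(2 :: complex fls) \<noteq> 0"
  by (metis fls_const_numeral fls_const_nonzero zero_neq_numeral)

lemma half_double: "1/2 * (2 * y) = y" for y :: complex
  by simp

lemma ord_ge_2: "ord_ge n y \<Longrightarrow> ord_ge n (2 * y)"
  by (simp add: ord_ge_def)

text \<open>Six functions, arranged in opposite pairs \<open>(a, A)\<close>, \<open>(b, B)\<close>, \<open>(c, C)\<close>, whose quadratic cofactors are the
  cross products of \<open>(a, b, c)\<close> and of \<open>(A, B, C)\<close> with \<open>(Y\<^sub>0, Y\<^sub>1, Y\<^sub>2)\<close>. The cofactor of a function that does not vanish at
  the place is small. The claim is that two functions of the same parity cannot share a pole of order \<open>-n\<close> if the cofactors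
  are smaller than that.\<close>

lemma pole_order_core:
  fixes a b c A B C :: "complex fls"
  assumes s1: "a + b + c = 1" and s2: "A + B + C = 1" and n: "n < 0" "n < k"
    and v: "ord_ge n a" "ord_ge n b" "ord_ge n c" "ord_ge n A" "ord_ge n B" "ord_ge n C"
    and nz: "a $$ n \<noteq> 0" "b $$ n \<noteq> 0"
    and Y: "Y0 = 2*a + 2*A - 1" "Y1 = 2*b + 2*B - 1" "Y2 = 2*c + 2*C - 1"
    and H0: "\<not> ord_ge 1 a \<Longrightarrow> ord_ge k (b*Y2 - c*Y1)" and H1: "\<not> ord_ge 1 b \<Longrightarrow> ord_ge k (c*Y0 - a*Y2)"
    and H2: "\<not> ord_ge 1 c \<Longrightarrow> ord_ge k (a*Y1 - b*Y0)"
    and H3: "\<not> ord_ge 1 A \<Longrightarrow> ord_ge k (B*Y2 - C*Y1)" and H4: "\<not> ord_ge 1 B \<Longrightarrow> ord_ge k (C*Y0 - A*Y2)"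
    and H5: "\<not> ord_ge 1 C \<Longrightarrow> ord_ge k (A*Y1 - B*Y0)"
  shows False
proof -
  have pole: "\<not> ord_ge 1 y" if "y $$ n \<noteq> 0" for y using that n(1) by (auto simp: ord_ge_def intro!: exI[of _ n])
  have z0: "ord_ge k (b*Y2 - c*Y1)" and z1: "ord_ge k (c*Y0 - a*Y2)" using H0 H1 nz pole by auto
  have a: "a = 1 - b - c" and A: "A = 1 - B - C" using s1 s2 by (auto simp: algebra_simps)
  have sum_n: "a $$ n + b $$ n + c $$ n = 0"
    using arg_cong[OF s1, of "\<lambda>y. y $$ n"] n by simp
  show False
  proof (cases "ord_ge 1 c")
    case False
    then have z2: "ord_ge k (a*Y1 - b*Y0)" by (rule H2)
    \<comment> \<open>All three cofactors of one parity are small. Their differences are small as well, so \<open>A\<close> and \<open>B\<close> have poles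
      with leading coefficients \<open>-a/2\<close> and \<open>-b/2\<close>; their cofactors are then small too, which forces \<open>a\<close>, \<open>b\<close>, \<open>c\<close> to have
      equal leading coefficients, although these add up to 0.\<close>
    define e0 where "e0 = 2*A + a - 1"
    define e1 where "e1 = 2*B + b - 1"
    define e2 where "e2 = 2*C + c - 1"
    have "e0 = (c*Y0 - a*Y2) - (a*Y1 - b*Y0)" "e1 = (a*Y1 - b*Y0) - (b*Y2 - c*Y1)"
      "e2 = (b*Y2 - c*Y1) - (c*Y0 - a*Y2)"
      unfolding e0_def e1_def e2_def Y a A by algebra+
    then have e: "ord_ge k e0" "ord_ge k e1" "ord_ge k e2" using z0 z1 z2 by (simp_all add: ord_ge_diff)
    have "2 * A $$ n + a $$ n = 0" "2 * B $$ n + b $$ n = 0"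
      using e n unfolding e0_def e1_def ord_ge_def by (auto dest!: spec[of _ n])
    then have "A $$ n \<noteq> 0" "B $$ n \<noteq> 0" using nz by auto
    then have W: "ord_ge k (B*Y2 - C*Y1)" "ord_ge k (C*Y0 - A*Y2)" using H3 H4 pole by auto
    have "c - b = 2 * (B*Y2 - C*Y1) - e2 + e1 + 2 * (b*Y2 - c*Y1)"
      "a - c = 2 * (C*Y0 - A*Y2) - e0 + e2 + 2 * (c*Y0 - a*Y2)"
      unfolding e0_def e1_def e2_def Y by algebra+
    then have "ord_ge k (c - b)" "ord_ge k (a - c)"
      using W e z0 z1 by (simp_all only: mult_2 ord_ge_add ord_ge_diff)
    then have "c $$ n = b $$ n" "a $$ n = c $$ n" using n unfolding ord_ge_def by auto
    then show False using sum_n nz by simp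
  next
    case True
    \<comment> \<open>Here \<open>c\<close> vanishes, so \<open>b Y\<^sub>2\<close> is small and \<open>Y\<^sub>2\<close> vanishes. Hence \<open>C\<close> takes the value 1/2, its cofactor is small,
      but the coefficient of that cofactor at \<open>n\<close> turns out to be the one of \<open>-a\<close>.\<close>
    have Yn: "ord_ge n Y0" "ord_ge n Y1" "ord_ge n Y2" unfolding Y
      using v n by (auto intro!: ord_ge_add ord_ge_diff ord_ge_1 ord_ge_2)
    have "ord_ge (n + 1) (c * Y1)" by (rule ord_ge_mult'[OF True Yn(2)]) simp
    moreover have "ord_ge (n + 1) (b*Y2 - c*Y1)" using z0 n by (auto intro: ord_ge_mono)
    ultimately have "ord_ge (n + 1) ((b*Y2 - c*Y1) + c*Y1)" by (intro ord_ge_add)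
    then have "ord_ge (n + 1) (b * Y2)" by simp
    from ord_ge_cancel[OF this nz(2) v(2)] have Y2: "ord_ge 1 Y2" by simp
    have "Y2 $$ 0 = 0" "c $$ 0 = 0" using Y2 True by (simp_all add: ord_ge_def)
    then have C0: "C $$ 0 = 1/2" by (simp add: Y(3) field_simps)
    have C: "ord_ge 0 C"
      unfolding ord_ge_def
    proof (intro allI impI)
      fix j :: int assume "j < 0"
      then have "Y2 $$ j = 0" "c $$ j = 0" using Y2 True by (simp_all add: ord_ge_def)
      then show "C $$ j = 0" using \<open>j < 0\<close> by (simp add: Y(3))
    qed
    have "\<not> ord_ge 1 C" using C0 by (auto simp: ord_ge_def intro!: exI[of _ 0])
    then have W2: "ord_ge k (A*Y1 - B*Y0)" by (rule H5)
    have eq: "A*Y1 - B*Y0 = A - A*Y2 - (1 - C)*Y0"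
      unfolding Y a A by algebra
    have "(A * Y2) $$ n = 0"
      using ord_ge_mult[OF v(4) Y2] by (simp add: ord_ge_def)
    moreover have "((1 - C) * Y0) $$ n = a $$ n + A $$ n"
    proof -
      have "ord_ge 0 (1 - C)" using C by (simp add: ord_ge_diff ord_ge_1)
      from nth_mult_lead[OF this Yn(1), of n] have "((1 - C) * Y0) $$ n = (1 - C) $$ 0 * Y0 $$ n" by simp
      also have "(1 - C) $$ 0 = 1/2" by (simp only: fls_minus_nth C0) simp
      also have "Y0 $$ n = 2 * (a $$ n + A $$ n)" using n by (simp add: Y(1))
      also have "1/2 * (2 * (a $$ n + A $$ n)) = a $$ n + A $$ n"
        using half_double .
      finally show ?thesis .
    qed
    moreover have "(A*Y1 - B*Y0) $$ n = A $$ n - (A * Y2) $$ n - ((1 - C) * Y0) $$ n"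
      unfolding eq by (simp only: fls_minus_nth)
    ultimately have "(A*Y1 - B*Y0) $$ n = - a $$ n" by simp
    moreover have "(A*Y1 - B*Y0) $$ n = 0" using W2 n(2) unfolding ord_ge_def by blast
    ultimately show False using nz by simp
  qed
qed

text \<open>The expansion of a solution at a place: \<open>U d/dX\<close> is the derivation \<open>x d/dx\<close> in the local parameter, and \<open>T\<close>
  is the expansion of \<open>x\<close>. Keeping \<open>U\<close> and \<open>T\<close> free treats all places, and both variables \<open>t\<close> and \<open>x\<close>, at once.\<close>

definition local_sol :: "complex fls \<Rightarrow> complex fls \<Rightarrow> (6 \<Rightarrow> complex) \<Rightarrow> (6 \<Rightarrow> complex fls) \<Rightarrow> bool" where
  "local_sol U T \<alpha> F \<longleftrightarrow>
    (\<forall>i. U * fls_deriv (F i) = T * (F i * quadr 1 F i) + fls_const (\<alpha> i) - fls_const (parsum \<alpha> i) * F i)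
    \<and> (\<forall>i. parsum F i = 1)"

text \<open>Divide the equation by \<open>T F\<^sub>i\<close>: every other term has at least the stated order, because \<open>F\<^sub>i\<close> does not vanish.\<close>

lemma local_quadr_order:
  assumes sol: "local_sol U T \<alpha> F" and U: "ord_ge u U" and T: "ord_ge v T" "T $$ v \<noteq> 0"
    and k: "k + v \<le> 0" "k + v \<le> u - 1" and F: "\<not> ord_ge 1 (F i)"
  shows "ord_ge k (quadr 1 F i)"
proof -
  define n where "n = fls_subdegree (F i)"
  have Fn: "ord_ge n (F i)" "F i $$ n \<noteq> 0" and n0: "n \<le> 0"
    using F by (auto simp: n_def ord_ge_iff)
  have "T * (F i * quadr 1 F i) = U * fls_deriv (F i) - fls_const (\<alpha> i) + fls_const (parsum \<alpha> i) * F i"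
    using sol unfolding local_sol_def by (simp add: algebra_simps)
  moreover have "ord_ge (k + v + n) (U * fls_deriv (F i))"
    by (rule ord_ge_mult'[OF U ord_ge_deriv[OF Fn(1)]]) (use k in simp)
  moreover have "ord_ge (k + v + n) (fls_const (\<alpha> i))" using k n0 by (intro ord_ge_const) simp
  moreover have "ord_ge (k + v + n) (fls_const (parsum \<alpha> i) * F i)"
    by (rule ord_ge_mult'[OF ord_ge_const[of 0] Fn(1)]) (use k in simp_all)
  ultimately have "ord_ge (k + v + n) (T * (F i * quadr 1 F i))" by (simp add: ord_ge_add ord_ge_diff)
  from ord_ge_cancel[OF this T(2,1)] have "ord_ge (k + n) (F i * quadr 1 F i)" by (simp add: algebra_simps)
  from ord_ge_cancel[OF this Fn(2,1)] show ?thesis by simp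
qed

text \<open>Exhibits the cofactors as the cross products of \<open>pole_order_core\<close>.\<close>

lemma quadr_cross:
  "quadr 1 F i = F (i+2) * (2 * F (i+4) + 2 * F (i+1) - 1) - F (i+4) * (2 * F (i+2) + 2 * F (i+5) - 1)"
  for F :: "6 \<Rightarrow> 'a::comm_ring_1"
  by (simp add: quadr_def algebra_simps)

lemma local_pole_order_six:
  assumes sol: "local_sol U T \<alpha> F" and H: "\<And>i. \<not> ord_ge 1 (F i) \<Longrightarrow> ord_ge k (quadr 1 F i)"
    and n: "n < 0" "n < k" and v: "\<And>i. ord_ge n (F i)"
  shows "F i $$ n = 0"
proof (rule ccontr)
  assume i: "F i $$ n \<noteq> 0"
  have core: "False" if "F j $$ n \<noteq> 0" "F (j+2) $$ n \<noteq> 0" for j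
  proof (rule pole_order_core[of "F j" "F (j+2)" "F (j+4)" "F (j+3)" "F (j+5)" "F (j+1)" n k
      "2 * F j + 2 * F (j+3) - 1" "2 * F (j+2) + 2 * F (j+5) - 1" "2 * F (j+4) + 2 * F (j+1) - 1"])
    show "F j + F (j + 2) + F (j + 4) = 1" "F (j + 3) + F (j + 5) + F (j + 1) = 1"
      using sol unfolding local_sol_def parsum_def by (auto dest: spec[of _ j] spec[of _ "j+3"])
    show "ord_ge k (F (j + 2) * (2 * F (j + 4) + 2 * F (j + 1) - 1) - F (j + 4) * (2 * F (j + 2) + 2 * F (j + 5) - 1))"
      if "\<not> ord_ge 1 (F j)" using H[OF that] by (simp add: quadr_cross)
    show "ord_ge k (F (j + 4) * (2 * F j + 2 * F (j + 3) - 1) - F j * (2 * F (j + 4) + 2 * F (j + 1) - 1))"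
      if "\<not> ord_ge 1 (F (j+2))" using H[OF that] by (simp add: quadr_cross)
    show "ord_ge k (F j * (2 * F (j + 2) + 2 * F (j + 5) - 1) - F (j + 2) * (2 * F j + 2 * F (j + 3) - 1))"
      if "\<not> ord_ge 1 (F (j+4))" using H[OF that] by (simp add: quadr_cross)
    show "ord_ge k (F (j + 5) * (2 * F (j + 4) + 2 * F (j + 1) - 1) - F (j + 1) * (2 * F (j + 2) + 2 * F (j + 5) - 1))"
      if "\<not> ord_ge 1 (F (j+3))" using H[OF that] by (simp add: quadr_cross add.commute[of "2 * F (j+1)"] add.commute[of "2 * F (j+5)"])
    show "ord_ge k (F (j + 1) * (2 * F j + 2 * F (j + 3) - 1) - F (j + 3) * (2 * F (j + 4) + 2 * F (j + 1) - 1))"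
      if "\<not> ord_ge 1 (F (j+5))" using H[OF that] by (simp add: quadr_cross add.commute[of "2 * F (j+3)"] add.commute[of "2 * F (j+1)"])
    show "ord_ge k (F (j + 3) * (2 * F (j + 2) + 2 * F (j + 5) - 1) - F (j + 5) * (2 * F j + 2 * F (j + 3) - 1))"
      if "\<not> ord_ge 1 (F (j+1))" using H[OF that] by (simp add: quadr_cross add.commute[of "2 * F (j+5)"] add.commute[of "2 * F (j+3)"])
  qed (use v n that in simp_all)
  have "(F i + F (i+2) + F (i+4)) $$ n = 0"
    using sol n(1) unfolding local_sol_def parsum_def by (auto dest!: spec[of _ i])
  then have "F (i+2) $$ n \<noteq> 0 \<or> F (i+4) $$ n \<noteq> 0" using i by auto
  then show False using core[of i] core[of "i+4"] i by auto
qed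

text \<open>The order can be raised one step at a time: if a coefficient at the smallest order \<open>n < min 0 k\<close> is not zero, then neither
  is a second one of the same parity, since the sum is 1, and this contradicts \<open>pole_order_core\<close>.\<close>

lemma local_pole_order:
  assumes sol: "local_sol U T \<alpha> F" and H: "\<And>i. \<not> ord_ge 1 (F i) \<Longrightarrow> ord_ge k (quadr 1 F i)"
  shows "ord_ge (min 0 k) (F i)"
proof -
  define N where "N = Min ((\<lambda>i. fls_subdegree (F i)) ` (UNIV :: 6 set))"
  have "\<forall>i. ord_ge N (F i)"
    unfolding ord_ge_iff N_def by (auto intro!: Min_le)
  moreover have "\<forall>i. ord_ge (n + 1) (F i)" if "\<forall>i. ord_ge n (F i)" "n < min 0 k" for n
    using local_pole_order_six[OF sol H, of n] that by (auto intro!: ord_ge_Suc)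
  ultimately have "\<forall>i. ord_ge (N + int m) (F i)" if "N + int m \<le> min 0 k \<or> m = 0" for m
    using that
  proof (induction m)
    case (Suc m)
    then show ?case using \<open>\<And>n. _ \<Longrightarrow> _ \<Longrightarrow> \<forall>i. ord_ge (n + 1) (F i)\<close>[of "N + int m"] by (auto simp: algebra_simps)
  qed auto
  from this[of "nat (min 0 k - N)"] show ?thesis
    by (cases "N \<le> min 0 k") (auto intro: ord_ge_mono)
qed

section \<open>The possible values at infinity\<close>

definition vec6 :: "'a \<Rightarrow> 'a \<Rightarrow> 'a \<Rightarrow> 'a \<Rightarrow> 'a \<Rightarrow> 'a \<Rightarrow> 6 \<Rightarrow> 'a" where
  "vec6 a b c d e f = (\<lambda>i. if i = 0 then a else if i = 1 then b else if i = 2 then c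
     else if i = 3 then d else if i = 4 then e else f)"

lemma vec6_simps [simp]:
  "vec6 a b c d e f 0 = a" "vec6 a b c d e f 1 = b" "vec6 a b c d e f 2 = c"
  "vec6 a b c d e f 3 = d" "vec6 a b c d e f 4 = e" "vec6 a b c d e f 5 = f"
  by (simp_all add: vec6_def)

lemma shift_eq_vec6:
  "v k = a \<Longrightarrow> v (k+1) = b \<Longrightarrow> v (k+2) = c \<Longrightarrow> v (k+3) = d \<Longrightarrow> v (k+4) = e \<Longrightarrow> v (k+5) = f
   \<Longrightarrow> (\<lambda>i. v (i + k)) = vec6 a b c d e f"
  by (rule ext, rename_tac i, case_tac "i = 0 \<or> i = 1 \<or> i = 2 \<or> i = 3 \<or> i = 4 \<or> i = 5")
     (auto simp: add.commute[of _ k] dest: six_exhaust[THEN meta_mp])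

text \<open>The zeros of all \<open>v\<^sub>i Q\<^sub>i(v)\<close> under the two normalisations, up to rotation.\<close>

definition infinity_types :: "(6 \<Rightarrow> complex) set" where
  "infinity_types = {vec6 1 1 0 0 0 0, vec6 1 0 0 1 0 0, vec6 1 1 1 0 (-1) 0,
     vec6 (1/2) (1/2) (1/2) (1/2) 0 0, vec6 (1/3) (1/3) (1/3) (1/3) (1/3) (1/3)}"

text \<open>If none of three functions of one parity vanishes, their cofactors do, and the differences of the three cofactors express the
  values of the other parity.\<close>

lemma cross_zero_full:
  fixes a b c A B C :: complex
  assumes s: "a + b + c = 1" "A + B + C = 1"
    and Z: "b*(2*c + 2*C - 1) = c*(2*b + 2*B - 1)" "c*(2*a + 2*A - 1) = a*(2*c + 2*C - 1)"
      "a*(2*b + 2*B - 1) = b*(2*a + 2*A - 1)"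
  shows "2*A = 1 - a" "2*B = 1 - b" "2*C = 1 - c"
proof -
  have "a - (2*a + 2*A - 1) = (a*(2*b + 2*B - 1) - b*(2*a + 2*A - 1)) - (c*(2*a + 2*A - 1) - a*(2*c + 2*C - 1))"
    "b - (2*b + 2*B - 1) = (b*(2*c + 2*C - 1) - c*(2*b + 2*B - 1)) - (a*(2*b + 2*B - 1) - b*(2*a + 2*A - 1))"
    "c - (2*c + 2*C - 1) = (c*(2*a + 2*A - 1) - a*(2*c + 2*C - 1)) - (b*(2*c + 2*C - 1) - c*(2*b + 2*B - 1))"
    using s by algebra+
  then show "2*A = 1 - a" "2*B = 1 - b" "2*C = 1 - c" unfolding Z by (simp_all add: algebra_simps)
qed

context
  fixes v :: "6 \<Rightarrow> complex"
  assumes par: "\<And>i. v i + v (i+2) + v (i+4) = 1"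
    and crit: "\<And>i. v i \<noteq> 0 \<Longrightarrow> v (i+2) * (2 * v (i+4) + 2 * v (i+1) - 1) = v (i+4) * (2 * v (i+2) + 2 * v (i+5) - 1)"
begin

text \<open>Three nonzero values of one parity leave only the vector with all entries 1/3 and the rotations of
  \<open>(1, 1, 1, 0, -1, 0)\<close>.\<close>

lemma crit_three:
  assumes nz: "v j \<noteq> 0" "v (j+2) \<noteq> 0" "v (j+4) \<noteq> 0"
  shows "\<exists>k. (\<lambda>i. v (i + k)) \<in> infinity_types"
proof -
  have s: "v j + v (j+2) + v (j+4) = 1" "v (j+3) + v (j+5) + v (j+1) = 1"
    using par[of j] par[of "j+3"] by simp_all
  note Z = crit[of j, OF nz(1), simplified] crit[of "j+2", OF nz(2), simplified] crit[of "j+4", OF nz(3), simplified]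
  have o: "2 * v (j+3) = 1 - v j" "2 * v (j+5) = 1 - v (j+2)" "2 * v (j+1) = 1 - v (j+4)"
    using cross_zero_full[OF s, OF Z] by simp_all
  have special: "\<exists>k. (\<lambda>i. v (i + k)) \<in> infinity_types"
    if h: "v i = 1" "v (i+3) = 0" "2 * v (i+5) = 1 - v (i+2)" "2 * v (i+1) = 1 - v (i+4)" "v (i+2) \<noteq> 0" for i
  proof -
    have e: "v (i+4) = - v (i+2)" using par[of i] h(1) by (simp add: add_eq_0_iff)
    have "v (i+2) = 1 \<or> v (i+2) = -1"
    proof (rule ccontr)
      assume "\<not> ?thesis"
      then have "v (i+5) \<noteq> 0" "v (i+1) \<noteq> 0" using h e by (auto simp: add_eq_0_iff)
      from crit[OF this(1)] have "v (i+1) * (2 * v i + 2 * v (i+3) - 1) = v (i+3) * (2 * v (i+1) + 2 * v (i+4) - 1)"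
        by (simp add: algebra_simps)
      then show False using h \<open>v (i+1) \<noteq> 0\<close> by simp
    qed
    then show ?thesis
    proof
      assume 1: "v (i+2) = 1"
      then have "v (i+5) = 0" "v (i+1) = 1" using h(3,4) e by simp_all
      then have "(\<lambda>k. v (k + i)) = vec6 1 1 1 0 (-1) 0"
        using h e 1 by (intro shift_eq_vec6) simp_all
      then show ?thesis unfolding infinity_types_def by blast
    next
      assume 1: "v (i+2) = -1"
      then have "v (i+5) = 1" "v (i+1) = 0" using h(3,4) e by simp_all
      then have "(\<lambda>k. v (k + (i+4))) = vec6 1 1 1 0 (-1) 0"
        using h e 1 by (intro shift_eq_vec6) simp_all
      then show ?thesis unfolding infinity_types_def by blast
    qed
  qed
  show ?thesis
  proof (cases "v (j+3) = 0 \<or> v (j+5) = 0 \<or> v (j+1) = 0")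
    case True
    then show ?thesis
    proof (elim disjE)
      assume "v (j+3) = 0" then show ?thesis using special[of j] o nz by simp
    next
      assume "v (j+5) = 0" then show ?thesis using special[of "j+2"] o nz by simp
    next
      assume "v (j+1) = 0" then show ?thesis using special[of "j+4"] o nz by simp
    qed
  next
    case False
    then have W: "v (j+5) * (2 * v (j+4) + 2 * v (j+1) - 1) = v (j+1) * (2 * v (j+2) + 2 * v (j+5) - 1)"
       "v (j+1) * (2 * v j + 2 * v (j+3) - 1) = v (j+3) * (2 * v (j+4) + 2 * v (j+1) - 1)"
      using crit[of "j+3"] crit[of "j+5"] by (simp_all add: add.commute)
    have eqs: "v (j+4) = v (j+2)" "v j = v (j+4)"
      using W o s by algebra+
    then have "v j = 1/3" "v (j+2) = 1/3" "v (j+4) = 1/3" using s(1) by (simp_all add: field_simps)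
    moreover have "x = 1/3" if "2 * x = 1 - 1/3" for x :: complex using that by (simp add: field_simps)
    ultimately have "(\<lambda>k. v (k + j)) = vec6 (1/3) (1/3) (1/3) (1/3) (1/3) (1/3)"
      using o by (intro shift_eq_vec6) metis+
    then show ?thesis unfolding infinity_types_def by blast
  qed
qed

text \<open>Exactly two nonzero values of one parity leave only the rotations of \<open>(1/2, 1/2, 1/2, 1/2, 0, 0)\<close>.\<close>

lemma crit_two:
  assumes nz: "v j \<noteq> 0" "v (j+2) \<noteq> 0" "v (j+4) = 0"
  shows "\<exists>k. (\<lambda>i. v (i + k)) \<in> infinity_types"
proof -
  have s: "v j + v (j+2) = 1" "v (j+3) + v (j+5) + v (j+1) = 1"
    using par[of j] par[of "j+3"] nz by simp_all
  have C: "v (j+1) = 1/2"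
    using crit[OF nz(1)] nz by (simp add: field_simps)
  have W: "v (j+3) * (2 * v (j+2) + 2 * v (j+5) - 1) = v (j+5) * (2 * v j + 2 * v (j+3) - 1)"
  proof -
    have "v (j+1) \<noteq> 0" unfolding C by simp
    from crit[OF this, simplified] show ?thesis by algebra
  qed
  have ab: "v j = 1/2" "v (j+2) = 1/2"
  proof -
    have "2 * v j = 1" using W C s by algebra
    then show *: "v j = 1/2" by (simp add: field_simps)
    show "v (j+2) = 1/2" using s(1) unfolding * by (simp add: field_simps)
  qed
  have AB: "v (j+3) + v (j+5) = 1/2"
  proof -
    have "v (j+3) + v (j+5) = 1 - v (j+1)" using s(2) by algebra
    then show ?thesis unfolding C by simp
  qed
  have "v (j+3) = 0 \<or> v (j+5) = 0"
  proof (rule ccontr)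
    assume n: "\<not> ?thesis"
    then have "v (j+1) * (2 * v (j+2) + 2 * v (j+5) - 1) = 0"
    proof -
      have "v (j+3) \<noteq> 0" using n by simp
      from crit[OF this, simplified] have "v (j+5) * (2 * v (j+1) + 2 * v (j+4) - 1) = v (j+1) * (2 * v (j+5) + 2 * v (j+2) - 1)" .
      moreover have "2 * v (j+1) + 2 * v (j+4) - 1 = 0" unfolding C nz(3) by simp
      ultimately have "v (j+1) * (2 * v (j+5) + 2 * v (j+2) - 1) = 0" by simp
      then show ?thesis by algebra
    qed
    then have "v (j+5) = 0" using C ab by simp
    then show False using n by simp
  qed
  then show ?thesis
  proof
    assume "v (j+3) = 0"
    then have "(\<lambda>k. v (k + (j+5))) = vec6 (1/2) (1/2) (1/2) (1/2) 0 0"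
      using AB C ab nz by (intro shift_eq_vec6) simp_all
    then show ?thesis unfolding infinity_types_def by blast
  next
    assume "v (j+5) = 0"
    then have "(\<lambda>k. v (k + j)) = vec6 (1/2) (1/2) (1/2) (1/2) 0 0"
      using AB C ab nz by (intro shift_eq_vec6) simp_all
    then show ?thesis unfolding infinity_types_def by blast
  qed
qed

lemma crit_parity:
  "(\<exists>k. (\<lambda>i. v (i + k)) \<in> infinity_types) \<or> (\<exists>m \<in> {j, j+2, j+4}. v m = 1 \<and> v (m+2) = 0 \<and> v (m+4) = 0)"
  using par[of j] crit_three[of j] crit_two[of j] crit_two[of "j+2"] crit_two[of "j+4"]
  by (cases "v j = 0"; cases "v (j+2) = 0"; cases "v (j+4) = 0") auto

lemma crit_classification: "\<exists>k. (\<lambda>i. v (i + k)) \<in> infinity_types"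
proof (rule ccontr)
  assume n: "\<not> ?thesis"
  obtain m where m: "v m = 1" "v (m+2) = 0" "v (m+4) = 0" using n crit_parity[of 0] by blast
  obtain l where l: "l \<in> {m+1, m+1+2, m+1+4}" "v l = 1" "v (l+2) = 0" "v (l+4) = 0"
    using n crit_parity[of "m+1"] by blast
  from l(1) have "l = m+1 \<or> l = m+3 \<or> l = m+5" by simp
  then consider "l = m+1" | "l = m+3" | "l = m+5" by blast
  then show False
  proof cases
    case 1
    then have "(\<lambda>k. v (k + m)) = vec6 1 1 0 0 0 0" using m l by (intro shift_eq_vec6) simp_all
    then show False using n unfolding infinity_types_def by blast
  next
    case 2
    then have "(\<lambda>k. v (k + m)) = vec6 1 0 0 1 0 0" using m l by (intro shift_eq_vec6) simp_all
    then show False using n unfolding infinity_types_def by blast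
  next
    case 3
    then have "(\<lambda>k. v (k + (m+5))) = vec6 1 1 0 0 0 0" using m l by (intro shift_eq_vec6) simp_all
    then show False using n unfolding infinity_types_def by blast
  qed
qed

end

section \<open>Uniqueness of the expansion at infinity\<close>

text \<open>The differential of \<open>v\<^sub>i Q\<^sub>i(v)\<close> in the direction \<open>d\<close>.\<close>

definition quadr_lin :: "(6 \<Rightarrow> 'a::comm_ring_1) \<Rightarrow> (6 \<Rightarrow> 'a) \<Rightarrow> 6 \<Rightarrow> 'a" where
  "quadr_lin v d i = v i * (2 * (d (i+1) * v (i+2) + v (i+1) * d (i+2) - d (i+4) * v (i+5) - v (i+4) * d (i+5))
      + d (i+4) - d (i+2)) + d i * quadr 1 v i"

text \<open>The critical points are nondegenerate. This is what makes the expansion at infinity unique.\<close>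

lemma quadr_lin_inject:
  assumes v: "v \<in> infinity_types" and par: "\<forall>i. parsum d i = 0" and lin: "\<forall>i. quadr_lin v d i = 0"
  shows "d i = 0"
proof -
  have p: "d 0 + d 2 + d 4 = 0" "d 1 + d 3 + d 5 = 0"
    using par[rule_format, of 0] par[rule_format, of 1] by (simp_all add: parsum_def)
  note l = lin[unfolded all_six quadr_lin_def quadr_def, simplified]
  have "\<forall>i. d i = 0"
    using v unfolding infinity_types_def insert_iff empty_iff
  proof (elim disjE)
    assume v: "v = vec6 1 1 0 0 0 0" show ?thesis using l p unfolding v all_six by (simp add: add_eq_0_iff2; elim conjE; intro conjI; algebra)
  next
    assume v: "v = vec6 1 0 0 1 0 0" show ?thesis using l p unfolding v all_six by (simp add: add_eq_0_iff2; elim conjE; intro conjI; algebra)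
  next
    assume v: "v = vec6 1 1 1 0 (-1) 0" show ?thesis using l p unfolding v all_six by (simp add: add_eq_0_iff2; elim conjE; intro conjI; algebra)
  next
    assume v: "v = vec6 (1/2) (1/2) (1/2) (1/2) 0 0" show ?thesis using l p unfolding v all_six by (simp add: add_eq_0_iff2; elim conjE; intro conjI; algebra)
  next
    assume v: "v = vec6 (1/3) (1/3) (1/3) (1/3) (1/3) (1/3)" show ?thesis using l p unfolding v all_six by (simp add: add_eq_0_iff2; elim conjE; intro conjI; algebra)
  qed simp
  then show ?thesis by blast
qed

lemma ord_ge_quadr:
  assumes "\<And>i. ord_ge 0 (F i)" shows "ord_ge 0 (quadr 1 F i)"
  unfolding quadr_def using assms
  by (auto intro!: ord_ge_add ord_ge_diff ord_ge_2 ord_ge_mult'[of 0 _ 0])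

text \<open>At infinity \<open>T\<close> has a pole, so the quadratic term dominates: if two solutions agree up to order \<open>m\<close>, their difference at
  order \<open>m\<close> lies in the kernel of the linearisation at the common critical point, and that kernel is 0.\<close>

lemma local_sol_unique:
  assumes F: "local_sol U T \<alpha> F" and G: "local_sol U T \<alpha> G"
    and U: "ord_ge 1 U" and T: "ord_ge v T" "T $$ v \<noteq> 0" "v < 0"
    and reg: "\<And>i. ord_ge 0 (F i)" "\<And>i. ord_ge 0 (G i)" and val: "\<And>i. F i $$ 0 = w i" "\<And>i. G i $$ 0 = w i"
    and w: "w \<in> infinity_types"
  shows "F = G"
proof -
  define d where "d i = F i - G i" for i
  have step: "\<forall>i. ord_ge (m + 1) (d i)" if m: "\<forall>i. ord_ge m (d i)" "m \<ge> 1" for m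
  proof -
    have lin: "quadr_lin w (\<lambda>i. d i $$ m) i = 0" for i
    proof -
      define R where "R = 2 * (d (i+1) * F (i+2) + G (i+1) * d (i+2) - d (i+4) * F (i+5) - G (i+4) * d (i+5))
        + d (i+4) - d (i+2)"
      have "T * (F i * quadr 1 F i) - T * (G i * quadr 1 G i) =
          U * fls_deriv (d i) + fls_const (parsum \<alpha> i) * d i"
        using F G unfolding local_sol_def d_def by (auto simp: algebra_simps)
      moreover have "F i * quadr 1 F i - G i * quadr 1 G i = F i * R + d i * quadr 1 G i"
        unfolding R_def d_def quadr_def by algebra
      ultimately have "T * (F i * R + d i * quadr 1 G i) = U * fls_deriv (d i) + fls_const (parsum \<alpha> i) * d i"
        by (metis right_diff_distrib)
      moreover have "ord_ge m (U * fls_deriv (d i))"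
        by (rule ord_ge_mult'[OF U ord_ge_deriv[OF m(1)[rule_format]]]) simp
      moreover have "ord_ge m (fls_const (parsum \<alpha> i) * d i)"
        by (rule ord_ge_mult'[OF ord_ge_const[of 0] m(1)[rule_format]]) simp_all
      ultimately have "ord_ge m (T * (F i * R + d i * quadr 1 G i))" by (simp add: ord_ge_add)
      from ord_ge_cancel[OF this T(2,1)] have 0: "(F i * R + d i * quadr 1 G i) $$ m = 0"
        using T(3) by (simp add: ord_ge_def)
      have p: "(x * y) $$ m = x $$ 0 * y $$ m" "(y * x) $$ m = y $$ m * x $$ 0" "ord_ge m (x * y)" "ord_ge m (y * x)"
        if "ord_ge 0 x" "ord_ge m y" for x y
        using that nth_mult_lead[OF that(1,2)] nth_mult_lead[OF that(2,1)] ord_ge_mult[OF that] ord_ge_mult[OF that(2,1)] by auto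
      have R: "ord_ge m R"
        unfolding R_def using m(1) reg by (intro ord_ge_add ord_ge_diff ord_ge_2 p) auto
      have "R $$ m = 2 * (d (i+1) $$ m * w (i+2) + w (i+1) * d (i+2) $$ m - d (i+4) $$ m * w (i+5) - w (i+4) * d (i+5) $$ m)
        + d (i+4) $$ m - d (i+2) $$ m"
        unfolding R_def using m(1) reg by (simp add: p val)
      moreover have "(d i * quadr 1 G i) $$ m = d i $$ m * quadr 1 w i"
      proof -
        have "quadr 1 G i $$ 0 = quadr 1 w i"
          unfolding quadr_def using nth_mult_lead[OF reg(2) reg(2), of 0] by (simp add: val)
        then show ?thesis using p(2)[OF ord_ge_quadr[of G i]] reg m by simp
      qed
      moreover have "(F i * R) $$ m = w i * R $$ m" using p(1)[OF reg(1) R] val by simp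
      ultimately show ?thesis using 0 unfolding quadr_lin_def by simp
    qed
    have "parsum (\<lambda>i. d i $$ m) i = 0" for i
    proof -
      have "parsum F i = parsum G i" using F G unfolding local_sol_def by simp
      then have "parsum F i $$ m = parsum G i $$ m" by simp
      then show ?thesis by (simp add: d_def parsum_def algebra_simps)
    qed
    then have "d i $$ m = 0" for i
      using quadr_lin_inject[OF w, of "\<lambda>i. d i $$ m"] lin by blast
    then show ?thesis using m(1) ord_ge_Suc by blast
  qed
  have "\<forall>i. ord_ge (1 + int n) (d i)" for n
  proof (induction n)
    case 0
    have "ord_ge 0 (d i)" "d i $$ 0 = 0" for i using reg val by (auto simp: d_def ord_ge_diff)
    then show ?case using ord_ge_Suc[of 0] by simp
  next
    case (Suc n)
    then show ?case using step[of "1 + int n"] by (simp add: algebra_simps)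
  qed
  then have "d i = 0" for i
  proof (intro fls_eqI)
    fix j
    have "j < 1 + int (nat j)" by simp
    then show "d i $$ j = 0 $$ j" using \<open>\<And>n. \<forall>i. ord_ge (1 + int n) (d i)\<close>[of "nat j"] unfolding ord_ge_def by simp
  qed
  then show ?thesis by (auto simp: d_def fun_eq_iff)
qed

section \<open>The Hamiltonians\<close>

text \<open>The quartic and the bilinear part of the Hamiltonian; the quartic part does not depend on \<open>j\<close> for
  normalised \<open>f\<close> (\<open>quart_const\<close>), which the present form does not show.\<close>

definition quart :: "(6 \<Rightarrow> 'a::comm_ring_1) \<Rightarrow> 6 \<Rightarrow> 'a" where
  "quart f j = f (j+5) * (1 - f (j+5)) * (f (j+4) * (1 - f (j+4)))
     + f (j+1) * (1 - f (j+1)) * (f (j+2) * (1 - f (j+2)))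
     - 2 * (f (j+5) * f (j+4) * (f (j+1) * f (j+2)))"

definition bilin :: "(6 \<Rightarrow> 'a::comm_ring_1) \<Rightarrow> (6 \<Rightarrow> 'a) \<Rightarrow> 6 \<Rightarrow> 'a" where
  "bilin p f j = f (j+4) * (p (j+5) - parsum p (j+1) * f (j+5)) - f (j+2) * (p (j+1) - parsum p (j+1) * f (j+1))
     - p (j+4) * f (j+5) + p (j+2) * f (j+1)"

definition ham :: "'a::comm_ring_1 \<Rightarrow> (6 \<Rightarrow> 'a) \<Rightarrow> (6 \<Rightarrow> 'a) \<Rightarrow> 6 \<Rightarrow> 'a" where
  "ham x p f j = x * x * quart f j + x * bilin p f j"

definition ham_cubic :: "(6 \<Rightarrow> 'a::comm_ring_1) \<Rightarrow> 6 \<Rightarrow> 'a" where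
  "ham_cubic f j = f (j+5) * (1 - f (j+5)) * f (j+4) + f (j+1) * (1 - f (j+1)) * f (j+2)"

text \<open>Along a solution the terms of degree four and more cancel. The derivative is only cubic in \<open>f\<close>, so its leading coefficient at
  a simple pole needs the residues and one further coefficient of \<open>f\<close>. The derivation is abstract so that the identity applies
  to every Laurent expansion.\<close>

lemma ham_derivative:
  fixes x :: "'a::idom" and del :: "'a \<Rightarrow> 'a"
  assumes add: "\<And>a b. del (a + b) = del a + del b" and mult: "\<And>a b. del (a * b) = a * del b + del a * b"
    and x: "del x = x" and p: "\<And>i. del (p i) = 0" 
    and f: "\<And>i. del (f i) = x * (f i * quadr 1 f i) + p i - parsum p i * f i"
    and s: "\<And>i. parsum f i = 1" and sp: "\<And>i. parsum p i + parsum p (i+1) = 1"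
  shows "del (ham x p f j) = x * (x * ham_cubic f j + p (j+2) * f (j+1) - p (j+4) * f (j+5))"
proof -
  have d0: "del 0 = 0" using add[of 0 0] by (metis add_cancel_left_left add_0)
  have minus: "del (- a) = - del a" for a using add[of a "- a"] d0 by (simp add: eq_neg_iff_add_eq_0 add.commute)
  have diff: "del (a - b) = del a - del b" for a b using add[of a "- b"] by (simp add: minus)
  have d1: "del 1 = 0" using mult[of 1 1] by (metis add_cancel_left_left mult_1 mult_1_right)
  have d2: "del 2 = 0" using add[of 1 1] d1 by simp
  define b where "b = f (j+5)" define C where "C = f (j+4)" define c where "c = f (j+1)" define B where "B = f (j+2)"
  have a: "f (j+3) = 1 - b - c" and A: "f j = 1 - B - C"
    using s[of j] s[of "j+1"] by (simp_all add: parsum_def b_def C_def c_def B_def algebra_simps)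
  define E where "E = parsum p (j+1)"
  have O: "parsum p j = 1 - E" using sp[of j] by (simp add: E_def algebra_simps)
  have q: "parsum p (j+5) = E" "parsum p (j+4) = 1 - E" "parsum p (j+2) = 1 - E" "parsum p (j+1) = E"
    using O by (simp_all add: E_def parsum_def add_ac)
  note folds = six_add b_def[symmetric] C_def[symmetric] c_def[symmetric] B_def[symmetric] a A
  have db: "del b = x * (b * (2 * ((1 - B - C) * c - (1 - b - c) * C) + 1 * (1 - b - c - c))) + p (j+5) - E * b"
    using f[of "j+5"] by (simp only: q quadr_def folds)
  have dC: "del C = x * (C * (2 * (b * (1 - B - C) - B * (1 - b - c)) + 1 * (B - (1 - B - C)))) + p (j+4) - (1 - E) * C"
    using f[of "j+4"] by (simp only: q quadr_def folds)
  have dc: "del c = x * (c * (2 * (B * (1 - b - c) - b * (1 - B - C)) + 1 * (b - (1 - b - c)))) + p (j+1) - E * c"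
    using f[of "j+1"] by (simp only: q quadr_def folds)
  have dB: "del B = x * (B * (2 * ((1 - b - c) * C - (1 - B - C) * c) + 1 * (1 - B - C - C))) + p (j+2) - (1 - E) * B"
    using f[of "j+2"] by (simp only: q quadr_def folds)
  have dE: "del E = 0" unfolding E_def parsum_def by (simp add: add p)
  show ?thesis
    unfolding ham_def quart_def bilin_def ham_cubic_def E_def[symmetric] b_def[symmetric] C_def[symmetric] c_def[symmetric] B_def[symmetric]
    apply (simp only: add diff mult x p d1 d2 mult_zero_left mult_zero_right add_0_left add_0_right db dC dc dB dE)
    by algebra
qed

lemma simple_pole_nth_mult:
  "ord_ge 0 x \<Longrightarrow> ord_ge 0 y \<Longrightarrow> (x * y) $$ 0 = x $$ 0 * y $$ 0"
  "ord_ge 0 x \<Longrightarrow> ord_ge (-1) y \<Longrightarrow> (x * y) $$ (-1) = x $$ 0 * y $$ (-1)"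
  "ord_ge (-1) x \<Longrightarrow> ord_ge 0 y \<Longrightarrow> (x * y) $$ (-1) = x $$ (-1) * y $$ 0"
  "ord_ge (-1) x \<Longrightarrow> ord_ge (-1) y \<Longrightarrow> (x * y) $$ (-2) = x $$ (-1) * y $$ (-1)"
  "ord_ge (-2) x \<Longrightarrow> ord_ge 0 y \<Longrightarrow> (x * y) $$ (-2) = x $$ (-2) * y $$ 0"
  "ord_ge 0 x \<Longrightarrow> ord_ge (-2) y \<Longrightarrow> (x * y) $$ (-2) = x $$ 0 * y $$ (-2)"
  by (rule nth_mult_lead; simp)+

lemma simple_pole_ord_ge_mult:
  "ord_ge 0 x \<Longrightarrow> ord_ge 0 y \<Longrightarrow> ord_ge 0 (x * y)"
  "ord_ge 0 x \<Longrightarrow> ord_ge (-1) y \<Longrightarrow> ord_ge (-1) (x * y)"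
  "ord_ge (-1) x \<Longrightarrow> ord_ge 0 y \<Longrightarrow> ord_ge (-1) (x * y)"
  "ord_ge (-1) x \<Longrightarrow> ord_ge (-1) y \<Longrightarrow> ord_ge (-2) (x * y)"
  using ord_ge_mult[of 0 x 0 y] ord_ge_mult[of 0 x "-1" y] ord_ge_mult[of "-1" x 0 y] ord_ge_mult[of "-1" x "-1" y]
  by simp_all

lemma simple_pole_one_minus: "ord_ge 0 x \<Longrightarrow> ord_ge 0 (1 - x)" "ord_ge (-1) x \<Longrightarrow> ord_ge (-1) (1 - x)"
  by (simp_all add: ord_ge_diff ord_ge_1)

section \<open>Residues at the finite nonzero places\<close>

text \<open>Where can simple poles sit? The hypothesis on \<open>quadr\<close> is the leading coefficient of the equation at a pole;
  \<open>\<kappa>\<close> is \<open>-1\<close> at a finite nonzero place and \<open>A\<^sub>i - 1\<close> at the origin.\<close>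

context
  fixes F :: "6 \<Rightarrow> complex fls" and \<kappa> :: "6 \<Rightarrow> complex"
  assumes simple: "\<And>i. ord_ge (-1) (F i)" and par: "\<And>i. F i + F (i+2) + F (i+4) = 1"
    and Qsimple: "\<And>i. F i $$ (-1) \<noteq> 0 \<Longrightarrow> ord_ge (-1) (quadr 1 F i) \<and> quadr 1 F i $$ (-1) = \<kappa> i"
    and \<kappa>: "\<And>i. \<kappa> (i+2) = \<kappa> i"
begin

lemma residue_sum: "F i $$ (-1) + F (i+2) $$ (-1) + F (i+4) $$ (-1) = 0"
  using arg_cong[OF par[of i], of "\<lambda>y. y $$ (-1)"] by simp

lemma quadr_cycle:
  "F j - (2 * F j + 2 * F (j+3) - 1) = quadr 1 F (j+4) - quadr 1 F (j+2)"
proof -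
  have 1: "F j = 1 - F (j+2) - F (j+4)" and 2: "F (j+3) = 1 - F (j+5) - F (j+1)"
    using par[of j] par[of "j+3"] by (simp_all add: algebra_simps)
  have 3: "quadr 1 F (j+4) = 2 * (F (j+5) * F j - F (j+2) * F (j+3)) + (F (j+2) - F j)"
    "quadr 1 F (j+2) = 2 * (F (j+3) * F (j+4) - F j * F (j+1)) + (F j - F (j+4))"
    by (simp_all add: quadr_def)
  show ?thesis unfolding 3 1 2 by algebra
qed

text \<open>Two poles of one parity have the same \<open>\<kappa>\<close>, so the difference of the two cofactors, which is linear, has no pole.\<close>

lemma residue_opposite:
  assumes "F (j+2) $$ (-1) \<noteq> 0" "F (j+4) $$ (-1) \<noteq> 0"
  shows "F j $$ (-1) + 2 * F (j+3) $$ (-1) = 0"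
proof -
  have "(quadr 1 F (j+4) - quadr 1 F (j+2)) $$ (-1) = 0"
    using Qsimple[OF assms(1)] Qsimple[OF assms(2)] \<kappa>[of "j+2"] by simp
  then have "F j $$ (-1) - (2 * F j $$ (-1) + 2 * F (j+3) $$ (-1)) = 0"
    unfolding quadr_cycle[symmetric] by simp
  then show ?thesis by algebra
qed

lemma residue_two:
  assumes "F j $$ (-1) \<noteq> 0"
  shows "\<exists>m \<in> {j, j+2, j+4}. F m $$ (-1) = 0 \<and> F (m+3) $$ (-1) = 0"
proof -
  have False if n: "F (j+2) $$ (-1) \<noteq> 0" "F (j+4) $$ (-1) \<noteq> 0"
  proof -
    have 1: "F j $$ (-1) + 2 * F (j+3) $$ (-1) = 0" "F (j+2) $$ (-1) + 2 * F (j+5) $$ (-1) = 0"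
      "F (j+4) $$ (-1) + 2 * F (j+1) $$ (-1) = 0"
      using residue_opposite[of j] residue_opposite[of "j+2"] residue_opposite[of "j+4"] n assms by simp_all
    then have "F (j+5) $$ (-1) \<noteq> 0" "F (j+1) $$ (-1) \<noteq> 0" using n by auto
    then have "F (j+3) $$ (-1) + 2 * F j $$ (-1) = 0" using residue_opposite[of "j+3"] by simp
    then show False using 1(1) assms by algebra
  qed
  moreover have "F (j+2) $$ (-1) = 0 \<Longrightarrow> F (j+4) $$ (-1) \<noteq> 0" using residue_sum[of j] assms by auto
  ultimately consider "F (j+2) $$ (-1) = 0" "F (j+4) $$ (-1) \<noteq> 0" | "F (j+4) $$ (-1) = 0" "F (j+2) $$ (-1) \<noteq> 0"
    by blast
  then show ?thesis
  proof cases
    case 1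
    then have "F (j+2+3) $$ (-1) = 0" using residue_opposite[of "j+2"] assms by simp
    then show ?thesis using 1 by blast
  next
    case 2
    then have "F (j+4+3) $$ (-1) = 0" using residue_opposite[of "j+4"] assms by simp
    then show ?thesis using 2 by blast
  qed
qed

text \<open>Up to a rotation the poles occur only at the indices 0, 2, 3 and 5.\<close>

lemma residue_position: "\<exists>k. F (k+4) $$ (-1) = 0 \<and> F (k+1) $$ (-1) = 0"
proof (cases "\<forall>i. F i $$ (-1) = 0")
  case False
  then obtain j where "F j $$ (-1) \<noteq> 0" by blast
  then obtain m where "F m $$ (-1) = 0" "F (m+3) $$ (-1) = 0" using residue_two by blast
  then show ?thesis by (intro exI[of _ "m+2"]) simp
qed auto

end

text \<open>Standard position of the poles: \<open>F\<^sub>0, F\<^sub>2\<close> have the residues \<open>-r, r\<close>, and \<open>F\<^sub>3, F\<^sub>5\<close> the residues \<open>-r', r'\<close>, while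
  \<open>F\<^sub>4\<close> and \<open>F\<^sub>1\<close> are regular with the values \<open>c\<^sub>0\<close> and \<open>C\<^sub>0\<close>.\<close>

context
  fixes F :: "6 \<Rightarrow> complex fls" and r r' c0 C0 :: complex
  assumes simple: "\<And>i. ord_ge (-1) (F i)" and par: "F 0 + F 2 + F 4 = 1" "F 1 + F 3 + F 5 = 1"
    and reg: "F 4 $$ (-1) = 0" "F 1 $$ (-1) = 0"
    and r: "F 2 $$ (-1) = r" "F 5 $$ (-1) = r'" and c0: "F 4 $$ 0 = c0" "F 1 $$ 0 = C0"
begin

lemma std_orders: "ord_ge 0 (F 4)" "ord_ge 0 (F 1)" "F 0 $$ (-1) = - r" "F 3 $$ (-1) = - r'"
proof -
  show "ord_ge 0 (F 4)" "ord_ge 0 (F 1)" using ord_ge_Suc[OF simple[of 4]] ord_ge_Suc[OF simple[of 1]] reg by simp_all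
  show "F 0 $$ (-1) = - r" "F 3 $$ (-1) = - r'"
    using arg_cong[OF par(1), of "\<lambda>y. y $$ (-1)"] arg_cong[OF par(2), of "\<lambda>y. y $$ (-1)"] reg r
    by (simp_all add: eq_neg_iff_add_eq_0)
qed

lemma std_quadr:
  "quadr 1 F 0 $$ (-1) = 2 * (r * C0 - r' * c0) - r" "quadr 1 F 2 $$ (-1) = 2 * (r * C0 - r' * c0) - r"
  "quadr 1 F 3 $$ (-1) = 2 * (r' * c0 - r * C0) - r'" "quadr 1 F 5 $$ (-1) = 2 * (r' * c0 - r * C0) - r'"
  "quadr 1 F 4 $$ (-1) = 2 * (r' + r * C0 - r' * c0)" "quadr 1 F 1 $$ (-1) = 2 * (r + r' * c0 - r * C0)"
  "ord_ge (-1) (quadr 1 F 4)" "ord_ge (-1) (quadr 1 F 1)"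
proof -
  note o = std_orders simple
  have a: "F 0 = 1 - F 2 - F 4" and A: "F 3 = 1 - F 5 - F 1" using par by (simp_all add: algebra_simps)
  have q: "quadr 1 F 0 = 2 * (F 1 * F 2 - F 4 * F 5) + (F 4 - F 2)"
    "quadr 1 F 2 = 2 * (F 3 * F 4 - F 0 * F 1) + (F 0 - F 4)"
    "quadr 1 F 3 = 2 * (F 4 * F 5 - F 1 * F 2) + (F 1 - F 5)"
    "quadr 1 F 5 = 2 * (F 0 * F 1 - F 3 * F 4) + (F 3 - F 1)"
    by (simp_all add: quadr_def)
  show "quadr 1 F 0 $$ (-1) = 2 * (r * C0 - r' * c0) - r" "quadr 1 F 2 $$ (-1) = 2 * (r * C0 - r' * c0) - r"
    "quadr 1 F 3 $$ (-1) = 2 * (r' * c0 - r * C0) - r'" "quadr 1 F 5 $$ (-1) = 2 * (r' * c0 - r * C0) - r'"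
    unfolding q using r c0 reg o by (simp_all add: simple_pole_nth_mult)
  have q4: "quadr 1 F 4 = 2 * (F 5 * F 0 - F 2 * F 3) + (F 2 - F 0)"
    and q1: "quadr 1 F 1 = 2 * (F 2 * F 3 - F 5 * F 0) + (F 5 - F 3)"
    by (simp_all add: quadr_def)
  \<comment> \<open>In these two cofactors the double poles cancel. Writing \<open>F\<^sub>0\<close> and \<open>2 F\<^sub>0 + 2 F\<^sub>3 - 1\<close> with regular cofactors shows it.\<close>
  have Q4: "quadr 1 F 4 = F 0 * (2 - 2 * F 4 - 2 * F 1) - (1 - F 4) * (2 * F 0 + 2 * F 3 - 1)"
    unfolding q4 a A by algebra
  have Q1: "quadr 1 F 1 = F 3 * (2 - 2 * F 4 - 2 * F 1) - (1 - F 1) * (2 * F 0 + 2 * F 3 - 1)"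
    unfolding q1 a A by algebra
  have v: "ord_ge 0 (2 - 2 * F 4 - 2 * F 1)" "ord_ge (-1) (2 * F 0 + 2 * F 3 - 1)" "ord_ge 0 (1 - F 4)" "ord_ge 0 (1 - F 1)"
    using o by (auto intro!: ord_ge_diff ord_ge_add ord_ge_2 ord_ge_numeral ord_ge_1)
  show "quadr 1 F 4 $$ (-1) = 2 * (r' + r * C0 - r' * c0)" "quadr 1 F 1 $$ (-1) = 2 * (r + r' * c0 - r * C0)"
    unfolding Q4 Q1 using r c0 reg o v by (simp_all add: simple_pole_nth_mult) (simp_all add: algebra_simps)
  show "ord_ge (-1) (quadr 1 F 4)" "ord_ge (-1) (quadr 1 F 1)"
    unfolding Q4 Q1
    by (rule ord_ge_diff[OF simple_pole_ord_ge_mult(3)[OF simple v(1)] simple_pole_ord_ge_mult(2)[OF v(3) v(2)]]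
             ord_ge_diff[OF simple_pole_ord_ge_mult(3)[OF simple v(1)] simple_pole_ord_ge_mult(2)[OF v(4) v(2)]])+
qed

lemma std_cubic:
  "ham_cubic F 3 $$ (-2) = - (C0 * r^2)" "ham_cubic F 5 $$ (-2) = - (C0 * r^2)"
  "ham_cubic F 1 $$ (-2) = - (r^2 * (1 - C0) + 2 * c0 * r * r')"
  "ham_cubic F 0 $$ (-2) = - (c0 * r'^2)" "ham_cubic F 2 $$ (-2) = - (c0 * r'^2)"
  "ham_cubic F 4 $$ (-2) = - (r'^2 * (1 - c0) + 2 * C0 * r * r')"
  "ord_ge (-2) (ham_cubic F j)"
proof -
  note o = std_orders simple
  have 1: "ord_ge 0 (1 - F 4)" "ord_ge 0 (1 - F 1)" "ord_ge (-1) (1 - F i)" for i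
    using o by (simp_all add: simple_pole_one_minus)
  have a: "F 0 = 1 - F 2 - F 4" and A: "F 3 = 1 - F 5 - F 1" using par by (simp_all add: algebra_simps)
  have z: "y $$ (-2) = 0" if "ord_ge (-1) y" for y using that by (simp add: ord_ge_def)
  have h: "ham_cubic F 3 = F 2 * (1 - F 2) * F 1 + F 4 * (1 - F 4) * F 5"
    "ham_cubic F 5 = F 4 * (1 - F 4) * F 3 + F 0 * (1 - F 0) * F 1"
    "ham_cubic F 0 = F 5 * (1 - F 5) * F 4 + F 1 * (1 - F 1) * F 2"
    "ham_cubic F 2 = F 1 * (1 - F 1) * F 0 + F 3 * (1 - F 3) * F 4"
    by (simp_all add: ham_cubic_def)
  \<comment> \<open>The same happens to the triple poles of \<open>ham_cubic F 1\<close> and \<open>ham_cubic F 4\<close>.\<close>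
  have h1: "ham_cubic F 1 = F 0 * F 2 * (1 - F 1) + F 4 * (F 0 * F 5 + F 2 * F 3)"
  proof -
    have "ham_cubic F 1 = F 0 * (1 - F 0) * F 5 + F 2 * (1 - F 2) * F 3" by (simp add: ham_cubic_def)
    then show ?thesis unfolding a A by algebra
  qed
  have h4: "ham_cubic F 4 = F 3 * F 5 * (1 - F 4) + F 1 * (F 3 * F 2 + F 5 * F 0)"
  proof -
    have "ham_cubic F 4 = F 3 * (1 - F 3) * F 2 + F 5 * (1 - F 5) * F 0" by (simp add: ham_cubic_def)
    then show ?thesis unfolding a A by algebra
  qed
  have v2: "ord_ge (-2) (F i * (1 - F i))" "ord_ge (-2) (F i * F k)" for i k
    using o 1 by (auto intro: simple_pole_ord_ge_mult)
  have v0: "ord_ge 0 (F 4 * (1 - F 4))" "ord_ge 0 (F 1 * (1 - F 1))" using o 1 by (auto intro: simple_pole_ord_ge_mult)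
  have vz: "ord_ge (-1) (F 4 * (1 - F 4) * F i)" "ord_ge (-1) (F 1 * (1 - F 1) * F i)" for i
    using v0 simple by (auto intro: simple_pole_ord_ge_mult)
  have w: "ord_ge (-2) (x * y)" "ord_ge (-2) (y * x)" if "ord_ge (-2) x" "ord_ge 0 y" for x y
    using ord_ge_mult[OF that] ord_ge_mult[OF that(2,1)] by simp_all
  note vals = r c0 reg o 1 v2 z[OF vz(1)] z[OF vz(2)]
  show "ham_cubic F 3 $$ (-2) = - (C0 * r^2)" "ham_cubic F 5 $$ (-2) = - (C0 * r^2)"
    "ham_cubic F 0 $$ (-2) = - (c0 * r'^2)" "ham_cubic F 2 $$ (-2) = - (c0 * r'^2)"
    unfolding h using vals by (simp_all add: simple_pole_nth_mult power2_eq_square)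
  show "ham_cubic F 1 $$ (-2) = - (r^2 * (1 - C0) + 2 * c0 * r * r')"
    "ham_cubic F 4 $$ (-2) = - (r'^2 * (1 - c0) + 2 * C0 * r * r')"
    unfolding h1 h4 using vals by (simp_all add: simple_pole_nth_mult ord_ge_add power2_eq_square)
  show "ord_ge (-2) (ham_cubic F j)"
    using six_exhaust[of j]
  proof (elim disjE)
    assume j: "j = 1" show ?thesis unfolding j h1
      by (rule ord_ge_add[OF w(1)[OF v2(2) 1(2)] w(2)[OF ord_ge_add[OF v2(2) v2(2)] std_orders(1)]])
  next
    assume j: "j = 4" show ?thesis unfolding j h4
      by (rule ord_ge_add[OF w(1)[OF v2(2) 1(1)] w(2)[OF ord_ge_add[OF v2(2) v2(2)] std_orders(2)]])
  next
    assume j: "j = 0" show ?thesis unfolding j h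
      by (intro ord_ge_add w(1)[OF v2(1) std_orders(1)] ord_ge_mono[OF vz(2)]) simp
  next
    assume j: "j = 2" show ?thesis unfolding j h
      by (intro ord_ge_add w(1)[OF v2(1) std_orders(1)] ord_ge_mono[OF vz(2)]) simp
  next
    assume j: "j = 3" show ?thesis unfolding j h
      by (intro ord_ge_add w(1)[OF v2(1) std_orders(2)] ord_ge_mono[OF vz(1)]) simp
  next
    assume j: "j = 5" show ?thesis unfolding j h
      by (intro ord_ge_add w(1)[OF v2(1) std_orders(2)] ord_ge_mono[OF vz(1)]) simp
  qed
qed

end

text \<open>The possible \<open>(r, r', c\<^sub>0, C\<^sub>0)\<close> with \<open>r \<noteq> 0\<close> are \<open>(1, 0, c\<^sub>0, 0)\<close> and \<open>(-1, 0, 0, 1)\<close> with a single pair of poles, and \<open>(1, 1, 0, 0)\<close>,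
  \<open>(3, -1, 1, 0)\<close>, \<open>(-1, 3, 0, 1)\<close> with two pairs; the claim is read off from this list.\<close>

lemma finite_residues:
  fixes r r' c0 C0 :: complex
  assumes "r \<noteq> 0 \<Longrightarrow> 2 * (r * C0 - r' * c0) - r = -1" and "r' \<noteq> 0 \<Longrightarrow> 2 * (r' * c0 - r * C0) - r' = -1"
    and "c0 * (2 * (r' + r * C0 - r' * c0)) = 0" and "C0 * (2 * (r + r' * c0 - r * C0)) = 0"
  shows "C0 * r^2 \<in> \<nat> \<and> r^2 * (1 - C0) + 2 * c0 * r * r' \<in> \<nat>"
proof (cases "r = 0")
  case False
  note e = assms(1)[OF this]
  show ?thesis
  proof (cases "r' = 0")
    case True
    have "C0 * r * (1 - C0) = 0" using assms(4) True by (simp add: algebra_simps)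
    then consider "C0 = 0" | "C0 = 1" using False by auto
    then show ?thesis
    proof cases
      case 1
      then have "r = 1" using e True by simp
      then show ?thesis using 1 True by simp
    next
      case 2
      then have "r = -1" using e True by simp
      then show ?thesis using 2 True by simp
    qed
  next
    case f: False
    note e' = assms(2)[OF f]
    have s: "r' = 2 - r" using e e' by algebra
    have c: "c0 * (3 - r) = 0" "C0 * (r + 1) = 0" using assms(3,4) e s by algebra+
    consider "c0 = 0" "C0 = 0" | "r = 3" "C0 = 0" | "r = -1" "c0 = 0"
      using c by (metis eq_iff_diff_eq_0 mult_eq_0_iff add_eq_0_iff2 numeral_neq_neg_one minus_equation_iff)
    then show ?thesis
    proof cases
      case 1
      then have "r = 1" using e by simp
      then show ?thesis using 1 by simp
    next
      case 2
      then have "c0 = 1" using e s by (simp add: algebra_simps)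
      then show ?thesis using 2 s by simp
    next
      case 3
      then have "C0 = 1" using e s by (simp add: algebra_simps)
      then show ?thesis using 3 s by simp
    qed
  qed
qed simp

lemma local_sol_par: "local_sol U T \<alpha> F \<Longrightarrow> F i + F (i+2) + F (i+4) = 1"
  unfolding local_sol_def parsum_def by blast

lemma pole_not_ord_ge_1: "y $$ n \<noteq> 0 \<Longrightarrow> n < 1 \<Longrightarrow> \<not> ord_ge 1 y"
  by (auto simp: ord_ge_def)

text \<open>The numbers in \<open>\<nat>\<close> will be the residues of the \<open>h\<^sub>j / x\<close>. They come from \<open>std_cubic\<close> and \<open>finite_residues\<close>, whose
  hypotheses are the lowest coefficients of the six equations.\<close>

lemma finite_place:
  assumes x0: "x0 \<noteq> 0" and sol: "local_sol (fls_const x0 + fls_X) (fls_const x0 + fls_X) \<alpha> F"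
  shows "ord_ge (-1) (F j)" "ord_ge (-2) (ham_cubic F j)" "- (ham_cubic F j $$ (-2)) \<in> \<nat>"
proof -
  define T where "T = fls_const x0 + fls_X"
  have T: "ord_ge 0 T" "T $$ 0 \<noteq> 0" "T $$ 0 = x0"
    using x0 by (auto simp: T_def ord_ge_def)
  have sol': "local_sol T T \<alpha> F" using sol by (simp add: T_def)
  have H: "ord_ge (-1) (quadr 1 F i)" if "\<not> ord_ge 1 (F i)" for i
    by (rule local_quadr_order[where v = 0 and u = 0, OF sol' T(1) T(1,2)]) (use that in simp_all)
  have simple: "ord_ge (-1) (F i)" for i using local_pole_order[OF sol' H] by simp
  then show "ord_ge (-1) (F j)" .
  have eqn: "T * fls_deriv (F i) = T * (F i * quadr 1 F i) + fls_const (\<alpha> i) - fls_const (parsum \<alpha> i) * F i" for i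
    using sol' unfolding local_sol_def by blast
  have Tn: "(T * y) $$ n = x0 * y $$ n" if "ord_ge n y" for y n
    using nth_mult_lead[OF T(1) that] T(3) by simp
  have res: "quadr 1 F i $$ (-1) = -1" if r: "F i $$ (-1) \<noteq> 0" for i
  proof -
    have Q: "ord_ge (-1) (quadr 1 F i)" using H pole_not_ord_ge_1[OF r] by simp
    have "(T * fls_deriv (F i)) $$ (-2) = - x0 * F i $$ (-1)"
      using Tn[of "-2" "fls_deriv (F i)"] ord_ge_deriv[OF simple[of i]] by simp
    moreover have "(T * (F i * quadr 1 F i)) $$ (-2) = x0 * (F i $$ (-1) * quadr 1 F i $$ (-1))"
      using Tn[of "-2" "F i * quadr 1 F i"] simple_pole_ord_ge_mult(4)[OF simple Q] simple_pole_nth_mult(4)[OF simple Q] by simp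
    moreover have "F i $$ (-2) = 0" using simple[of i] by (simp add: ord_ge_def)
    ultimately have "- x0 * F i $$ (-1) = x0 * (F i $$ (-1) * quadr 1 F i $$ (-1))"
      using arg_cong[OF eqn[of i], of "\<lambda>y. y $$ (-2)"] by simp
    then have "x0 * (F i $$ (-1) * (quadr 1 F i $$ (-1) + 1)) = 0" by algebra
    then show ?thesis using r x0 by (simp add: eq_neg_iff_add_eq_0)
  qed
  have val: "F i $$ 0 * quadr 1 F i $$ (-1) = 0" if r: "F i $$ (-1) = 0" and Q: "ord_ge (-1) (quadr 1 F i)" for i
  proof -
    have F: "ord_ge 0 (F i)" using ord_ge_Suc[OF simple r] by simp
    have "(T * fls_deriv (F i)) $$ (-1) = 0"
      using Tn[of "-1" "fls_deriv (F i)"] ord_ge_deriv[OF F] by simp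
    moreover have "(T * (F i * quadr 1 F i)) $$ (-1) = x0 * (F i $$ 0 * quadr 1 F i $$ (-1))"
      using Tn[of "-1" "F i * quadr 1 F i"] simple_pole_ord_ge_mult(2)[OF F Q] simple_pole_nth_mult(2)[OF F Q] by simp
    ultimately have "0 = x0 * (F i $$ 0 * quadr 1 F i $$ (-1))"
      using arg_cong[OF eqn[of i], of "\<lambda>y. y $$ (-1)"] r by simp
    then show ?thesis using x0 by simp
  qed
  obtain k where k: "F (k+4) $$ (-1) = 0" "F (k+1) $$ (-1) = 0"
    using residue_position[of F "\<lambda>_. -1"] simple local_sol_par[OF sol'] H res pole_not_ord_ge_1
    by (metis (no_types, lifting) neg_less_0_iff_less zero_less_one less_trans)
  define G where "G = (\<lambda>j. F (j + k))"
  have G: "F i = G (i - k)" "quadr 1 F i = quadr 1 G (i - k)" "ham_cubic F i = ham_cubic G (i - k)" for i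
    by (simp_all add: G_def quadr_def ham_cubic_def algebra_simps)
  have simpleG: "ord_ge (-1) (G i)" for i using simple by (simp add: G_def)
  have parG: "G 0 + G 2 + G 4 = 1" "G 1 + G 3 + G 5 = 1"
    using local_sol_par[OF sol', of k] local_sol_par[OF sol', of "k+1"] by (simp_all add: G_def add.commute[of _ k])
  have regG: "G 4 $$ (-1) = 0" "G 1 $$ (-1) = 0" using k by (simp_all add: G_def add.commute[of _ k])
  note std = simpleG parG regG refl refl refl refl
  note sq = std_quadr[OF std] note sc = std_cubic[OF std]
  have resG: "quadr 1 G i $$ (-1) = -1" if "G i $$ (-1) \<noteq> 0" for i using res[of "i + k"] that G by simp
  have valG: "G i $$ 0 * quadr 1 G i $$ (-1) = 0" if "G i $$ (-1) = 0" "ord_ge (-1) (quadr 1 G i)" for i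
    using val[of "i + k"] that G by simp
  have a: "C0 * r\<^sup>2 \<in> \<nat> \<and> r\<^sup>2 * (1 - C0) + 2 * c0 * r * r' \<in> \<nat>"
    if "r = G 2 $$ (-1)" "r' = G 5 $$ (-1)" "c0 = G 4 $$ 0" "C0 = G 1 $$ 0" for r r' c0 C0
    by (rule finite_residues) (use that resG[of 2] resG[of 5] valG[of 4] valG[of 1] regG sq in auto)
  have b: "c0 * r'\<^sup>2 \<in> \<nat> \<and> r'\<^sup>2 * (1 - c0) + 2 * C0 * r' * r \<in> \<nat>"
    if "r = G 2 $$ (-1)" "r' = G 5 $$ (-1)" "c0 = G 4 $$ 0" "C0 = G 1 $$ 0" for r r' c0 C0
    by (rule finite_residues) (use that resG[of 2] resG[of 5] valG[of 4] valG[of 1] regG sq in auto)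
  have "ord_ge (-2) (ham_cubic G i) \<and> - (ham_cubic G i $$ (-2)) \<in> \<nat>" for i
    using six_exhaust[of i] a[OF refl refl refl refl] b[OF refl refl refl refl] sc
    by (elim disjE) (simp_all add: mult_ac add_ac)
  then show "ord_ge (-2) (ham_cubic F j)" "- (ham_cubic F j $$ (-2)) \<in> \<nat>" unfolding G by auto
qed

section \<open>The Hamiltonians at the origin\<close>

lemma quart_const:
  fixes f :: "6 \<Rightarrow> 'a::idom"
  assumes s: "\<And>i. f i + f (i+2) + f (i+4) = 1"
  shows "quart f j = quart f k"
proof -
  have "quart f (i+1) = quart f i" for i
  proof -
    have 1: "f i = 1 - f (i+2) - f (i+4)" and 2: "f (i+1) = 1 - f (i+3) - f (i+5)"
      using s[of i] s[of "i+1"] by (simp_all add: algebra_simps)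
    show ?thesis unfolding quart_def six_add 1 2 by algebra
  qed
  then have "quart f i = quart f 0" for i
    using six_exhaust[of i]
    by (metis six_add(1,6,7,8) add_0 add.left_neutral numeral_plus_one one_add_one six_add)
  then show ?thesis by metis
qed

text \<open>With \<open>quart_const\<close> this recursion reduces all six Hamiltonians to two of them.\<close>

lemma bilin_step:
  fixes f :: "6 \<Rightarrow> 'a::idom"
  assumes s: "\<And>i. f i + f (i+2) + f (i+4) = 1" and p: "\<And>i. parsum p i + parsum p (i+1) = 1"
  shows "bilin p f (i+1) = bilin p f (i+5) - f i + p i + p (i+3)"
proof -
  have 1: "f i = 1 - f (i+2) - f (i+4)" and 2: "f (i+1) = 1 - f (i+3) - f (i+5)"
    using s[of i] s[of "i+1"] by (simp_all add: algebra_simps)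
  have 3: "p i = 1 - p (i+1) - p (i+2) - p (i+3) - p (i+4) - p (i+5)"
    using p[of i] by (simp add: parsum_def algebra_simps)
  show ?thesis unfolding bilin_def parsum_def six_add 1 2 3 by algebra
qed

text \<open>The constant terms of the Hamiltonians at the origin, if \<open>g\<^sub>0, g\<^sub>2\<close> are the only functions with a pole there
  (\<open>zero_one\<close>), or if \<open>g\<^sub>0, g\<^sub>2, g\<^sub>3, g\<^sub>5\<close> have poles (\<open>zero_two\<close>).\<close>

definition zero_one :: "(6 \<Rightarrow> complex) \<Rightarrow> 6 \<Rightarrow> complex" where
  "zero_one p = (let d = p 1; Ae = parsum p 0; Ao = parsum p 1 in
     vec6 (d*(d-Ao)) (d*(d+Ae) + Ao - 2*d) (d*(d-Ao)) (d*(d+Ae)) (d*(d-Ao)) (d*(d+Ae)))"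

definition zero_two :: "(6 \<Rightarrow> complex) \<Rightarrow> 6 \<Rightarrow> complex" where
  "zero_two p = (let d = p 1 - p 4; Ae = parsum p 0; Ao = parsum p 1 in
     vec6 (d*(d-Ao)) (d*(d+Ae) + Ao - 2*d) (d*(d-Ao)) (d*(d+Ae)) (d*(d-Ao) + Ae + 2*d) (d*(d+Ae)))"

text \<open>The equations determine the nonzero residues, and the products \<open>r C\<^sub>0\<close> and \<open>r' c\<^sub>0\<close>, from the parameters. The unknowns \<open>c\<^sub>0\<close> and \<open>C\<^sub>0\<close>
  enter the constant terms \<open>h\<^sub>3\<close> and \<open>h\<^sub>0\<close> only through these products.\<close>

lemma zero_residues:
  fixes r r' c0 C0 :: complex
  assumes "r \<noteq> 0 \<Longrightarrow> 2 * (r * C0 - r' * c0) - r = Ae - 1" and "r' \<noteq> 0 \<Longrightarrow> 2 * (r' * c0 - r * C0) - r' = Ao - 1"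
    and "c0 * (2 * (r' + r * C0 - r' * c0)) + p4 - Ae * c0 = 0" and "C0 * (2 * (r + r' * c0 - r * C0)) + p1 - Ao * C0 = 0"
    and "Ae + Ao = 1"
    and h3: "h3 = - (r^2 * C0 * (1 - C0)) - r'^2 * c0 * (1 - c0) - 2 * r * r' * c0 * C0
       - Ae * C0 * r - r' * (p4 - Ae * c0) - p1 * r"
    and h0: "h0 = - (r^2 * C0 * (1 - C0)) - r'^2 * c0 * (1 - c0) - 2 * r * r' * c0 * C0
       - Ao * c0 * r' - r * (p1 - Ao * C0) - p4 * r'"
  shows "(r = 0 \<and> r' = 0 \<and> h3 = 0 \<and> h0 = 0)
    \<or> (r' = 0 \<and> r = Ao - 2 * p1 \<and> h3 = p1 * (p1 + Ae) \<and> h0 = p1 * (p1 - Ao))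
    \<or> (r = 0 \<and> r' = Ae - 2 * p4 \<and> h0 = p4 * (p4 + Ao) \<and> h3 = p4 * (p4 - Ae))
    \<or> (r = Ao - 2 * (p1 - p4) \<and> r' = 1 - r \<and> h3 = (p1 - p4) * (p1 - p4 + Ae) \<and> h0 = (p1 - p4) * (p1 - p4 - Ao))"
proof -
  have Ae: "Ae = 1 - Ao" using assms(5) by (simp add: algebra_simps)
  show ?thesis
  proof (cases "r = 0")
    case r: True
    show ?thesis
    proof (cases "r' = 0")
      case True
      then show ?thesis using r h3 h0 by simp
    next
      case False
      note e = assms(2)[OF this]
      have 1: "c0 * r' = - p4" using assms(3) e r Ae by algebra
      have 2: "r' = Ae - 2 * p4" using e 1 r Ae by algebra
      have "h0 = p4 * (p4 + Ao)" "h3 = p4 * (p4 - Ae)" using h0 h3 r e 1 2 Ae by algebra+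
      then show ?thesis using r 2 by simp
    qed
  next
    case False
    note e = assms(1)[OF this]
    show ?thesis
    proof (cases "r' = 0")
      case r': True
      have 1: "C0 * r = - p1" using assms(4) e r' Ae by algebra
      have 2: "r = Ao - 2 * p1" using e 1 r' Ae by algebra
      have "h0 = p1 * (p1 - Ao)" "h3 = p1 * (p1 + Ae)" using h0 h3 r' e 1 2 Ae by algebra+
      then show ?thesis using r' 2 by simp
    next
      case f: False
      note e' = assms(2)[OF this]
      have s: "r' = 1 - r" using e e' Ae by algebra
      have 1: "C0 * r = - p1" using assms(4) e s Ae by algebra
      have 3: "c0 * r' = - p4" using assms(3) e s Ae by algebra
      have 2: "r = Ao - 2 * (p1 - p4)" using e 1 3 Ae by algebra
      have "h0 = (p1 - p4) * (p1 - p4 - Ao)" "h3 = (p1 - p4) * (p1 - p4 + Ae)" using h0 h3 s e 1 2 3 Ae by algebra+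
      then show ?thesis using s 2 by simp
    qed
  qed
qed

lemma zero_place:
  assumes sol: "local_sol fls_X fls_X \<alpha> F" and total: "\<And>i. parsum \<alpha> i + parsum \<alpha> (i+1) = 1"
  defines "Z \<equiv> \<lambda>j. ham fls_X (\<lambda>i. fls_const (\<alpha> i)) F j $$ 0"
  shows "(\<forall>j. Z j = 0) \<or> (\<exists>k. (\<lambda>j. Z (j + k)) = zero_one (\<lambda>j. \<alpha> (j + k)))
     \<or> (\<exists>k. (\<lambda>j. Z (j + k)) = zero_two (\<lambda>j. \<alpha> (j + k)))"
proof -
  have T: "ord_ge 1 fls_X" "fls_X $$ 1 \<noteq> (0::complex)" by (simp_all add: ord_ge_def)
  have H: "ord_ge (-1) (quadr 1 F i)" if "\<not> ord_ge 1 (F i)" for i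
    by (rule local_quadr_order[where v = 1 and u = 1, OF sol T(1) T(1,2)]) (use that in simp_all)
  have simple: "ord_ge (-1) (F i)" for i using local_pole_order[OF sol H] by simp
  have eqn: "fls_X * fls_deriv (F i) = fls_X * (F i * quadr 1 F i) + fls_const (\<alpha> i) - fls_const (parsum \<alpha> i) * F i" for i
    using sol unfolding local_sol_def by blast
  have Tn: "(fls_X * y) $$ n = y $$ (n - 1)" for y :: "complex fls" and n
    by (simp add: fls_X_times_conv_shift)
  have res: "quadr 1 F i $$ (-1) = parsum \<alpha> i - 1" if r: "F i $$ (-1) \<noteq> 0" for i
  proof -
    have Q: "ord_ge (-1) (quadr 1 F i)" using H pole_not_ord_ge_1[OF r] by simp
    have "- (F i $$ (-1)) = F i $$ (-1) * quadr 1 F i $$ (-1) - parsum \<alpha> i * F i $$ (-1)"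
      using arg_cong[OF eqn[of i], of "\<lambda>y. y $$ (-1)"] simple_pole_nth_mult(4)[OF simple Q] by (simp add: Tn)
    then have "F i $$ (-1) * (quadr 1 F i $$ (-1) - (parsum \<alpha> i - 1)) = 0" by algebra
    then show ?thesis using r by simp
  qed
  have val: "F i $$ 0 * quadr 1 F i $$ (-1) + \<alpha> i - parsum \<alpha> i * F i $$ 0 = 0"
    if r: "F i $$ (-1) = 0" and Q: "ord_ge (-1) (quadr 1 F i)" for i
  proof -
    have F: "ord_ge 0 (F i)" using ord_ge_Suc[OF simple r] by simp
    show ?thesis
      using arg_cong[OF eqn[of i], of "\<lambda>y. y $$ 0"] simple_pole_nth_mult(2)[OF F Q] by (simp add: Tn)
  qed
  obtain k where k: "F (k+4) $$ (-1) = 0" "F (k+1) $$ (-1) = 0"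
  proof -
    have "\<exists>k. F (k + 4) $$ (-1) = 0 \<and> F (k + 1) $$ (-1) = 0"
    proof (rule residue_position[where \<kappa> = "\<lambda>i. parsum \<alpha> i - 1"])
      show "ord_ge (-1) (quadr 1 F i) \<and> quadr 1 F i $$ (-1) = parsum \<alpha> i - 1" if "F i $$ (-1) \<noteq> 0" for i
        using H[OF pole_not_ord_ge_1[OF that]] res[OF that] by simp
    qed (use simple local_sol_par[OF sol] in \<open>simp_all add: parsum_def add_ac\<close>)
    then show ?thesis using that by blast
  qed
  define G where "G = (\<lambda>j. F (j + k))"
  define p where "p = (\<lambda>j. \<alpha> (j + k))"
  define P where "P = (\<lambda>j. fls_const (p j))"
  have FG: "F (i + k) = G i" "quadr 1 F (i + k) = quadr 1 G i" for i
    by (simp_all add: G_def quadr_def add.assoc add.commute[of k])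
  have simpleG: "ord_ge (-1) (G i)" for i using simple by (simp add: G_def)
  have par: "G i + G (i+2) + G (i+4) = 1" for i
    using local_sol_par[OF sol, of "i+k"] by (simp add: G_def add.assoc add.commute[of k])
  have parG: "G 0 + G 2 + G 4 = 1" "G 1 + G 3 + G 5 = 1"
    using par[of 0] par[of 1] by simp_all
  have regG: "G 4 $$ (-1) = 0" "G 1 $$ (-1) = 0" using k by (simp_all add: G_def add.commute[of _ k])
  note std = simpleG parG regG refl refl refl refl
  note sq = std_quadr[OF std] note so = std_orders[OF std]
  have pp: "parsum \<alpha> (i + k) = parsum p i" for i by (simp add: p_def parsum_def add.assoc add.commute[of k])
  have PP: "parsum P i = fls_const (parsum p i)" for i by (simp add: P_def parsum_def fls_plus_const)
  have totp: "parsum p i + parsum p (i+1) = 1" for i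
    using total[of "i+k"] pp[of i] pp[of "i+1"] by (simp add: add.assoc add.commute[of k])
  have totP: "parsum P i + parsum P (i+1) = 1" for i
    unfolding PP fls_plus_const totp by simp
  have resG: "quadr 1 G i $$ (-1) = parsum p i - 1" if "G i $$ (-1) \<noteq> 0" for i
    using res[of "i + k"] that FG pp by simp
  have valG: "G i $$ 0 * quadr 1 G i $$ (-1) + p i - parsum p i * G i $$ 0 = 0"
    if "G i $$ (-1) = 0" "ord_ge (-1) (quadr 1 G i)" for i
    using val[of "i + k"] that FG pp by (simp add: p_def)
  define r where "r = G 2 $$ (-1)" define r' where "r' = G 5 $$ (-1)"
  define c0 where "c0 = G 4 $$ 0" define C0 where "C0 = G 1 $$ 0"
  define W where "W j = (quart G j) $$ (-2) + (bilin P G j) $$ (-1)" for j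
  have Zj: "Z (j + k) = W j" for j
  proof -
    have "ham fls_X (\<lambda>i. fls_const (\<alpha> i)) F (j + k) = ham fls_X P G j"
      by (simp add: ham_def quart_def bilin_def parsum_def G_def P_def p_def add.assoc add.commute[of k])
    then have "Z (j + k) = ham fls_X P G j $$ 0" by (simp only: Z_def)
    also have "\<dots> = W j" unfolding ham_def W_def by (simp add: Tn mult.assoc)
    finally show ?thesis .
  qed
  have step: "W (i+1) = W (i+5) - G i $$ (-1)" for i
    using quart_const[OF par, of "i+1" "i+5"] bilin_step[OF par totP, of i]
    by (simp add: W_def) (simp add: P_def)
  have q3: "quart G j $$ (-2) = - (r^2 * C0 * (1 - C0)) - r'^2 * c0 * (1 - c0) - 2 * r * r' * c0 * C0" for j
  proof -
    have "quart G j = quart G 3" by (rule quart_const[OF par])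
    also have "\<dots> = (G 2 * (1 - G 2)) * (G 1 * (1 - G 1)) + (G 4 * (1 - G 4)) * (G 5 * (1 - G 5))
       - 2 * (G 2 * G 5 * (G 1 * G 4))"
      by (simp add: quart_def) 
    also have "\<dots> $$ (-2) = - (r^2 * C0 * (1 - C0)) - r'^2 * c0 * (1 - c0) - 2 * r * r' * c0 * C0"
      using so simpleG by (simp add: simple_pole_nth_mult simple_pole_ord_ge_mult simple_pole_one_minus r_def r'_def c0_def C0_def power2_eq_square)
    finally show ?thesis .
  qed
  have b3: "bilin P G 3 $$ (-1) = - parsum p 0 * C0 * r - r' * (p 4 - parsum p 0 * c0) - p 1 * r"
  proof -
    have "bilin P G 3 = G 1 * (P 2 - parsum P 0 * G 2) - G 5 * (P 4 - parsum P 0 * G 4) - P 1 * G 2 + P 5 * G 4"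
      by (simp add: bilin_def parsum_def add_ac)
    also have "\<dots> $$ (-1) = - parsum p 0 * C0 * r - r' * (p 4 - parsum p 0 * c0) - p 1 * r"
      using so simpleG regG unfolding PP unfolding P_def
      by (simp add: simple_pole_nth_mult simple_pole_ord_ge_mult ord_ge_diff ord_ge_const ord_ge_mult'[OF ord_ge_const[of 0]] r_def r'_def c0_def C0_def)
    finally show ?thesis .
  qed
  have b0: "bilin P G 0 $$ (-1) = - parsum p 1 * c0 * r' - r * (p 1 - parsum p 1 * C0) - p 4 * r'"
  proof -
    have "bilin P G 0 = G 4 * (P 5 - parsum P 1 * G 5) - G 2 * (P 1 - parsum P 1 * G 1) - P 4 * G 5 + P 2 * G 1"
      by (simp add: bilin_def parsum_def add_ac)
    also have "\<dots> $$ (-1) = - parsum p 1 * c0 * r' - r * (p 1 - parsum p 1 * C0) - p 4 * r'"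
      using so simpleG regG unfolding PP unfolding P_def
      by (simp add: simple_pole_nth_mult simple_pole_ord_ge_mult ord_ge_diff ord_ge_const ord_ge_mult'[OF ord_ge_const[of 0]] r_def r'_def c0_def C0_def)
    finally show ?thesis .
  qed
  have evenodd: "parsum p 2 = parsum p 0" "parsum p 4 = parsum p 0" "parsum p 5 = parsum p 1"
    by (simp_all add: parsum_def add_ac)
  have cases: "(r = 0 \<and> r' = 0 \<and> W 3 = 0 \<and> W 0 = 0)
    \<or> (r' = 0 \<and> r = parsum p 1 - 2 * p 1 \<and> W 3 = p 1 * (p 1 + parsum p 0) \<and> W 0 = p 1 * (p 1 - parsum p 1))
    \<or> (r = 0 \<and> r' = parsum p 0 - 2 * p 4 \<and> W 0 = p 4 * (p 4 + parsum p 1) \<and> W 3 = p 4 * (p 4 - parsum p 0))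
    \<or> (r = parsum p 1 - 2 * (p 1 - p 4) \<and> r' = 1 - r \<and> W 3 = (p 1 - p 4) * (p 1 - p 4 + parsum p 0)
        \<and> W 0 = (p 1 - p 4) * (p 1 - p 4 - parsum p 1))"
    by (rule zero_residues[of r C0 r' c0 _ _])
       (use resG[of 2] resG[of 5] valG[of 4] valG[of 1] regG sq totp[of 0] q3 b3 b0 in
         \<open>simp_all add: W_def r_def r'_def c0_def C0_def evenodd\<close>)
  have W: "W 2 = W 0" "W 4 = W 0 + r'" "W 5 = W 3" "W 1 = W 3 + r"
    using step[of 1] step[of 5] step[of 4] step[of 2] regG
    by (simp_all add: r_def r'_def)
  from cases show ?thesis
  proof (elim disjE conjE)
    assume "r = 0" "r' = 0" "W 3 = 0" "W 0 = 0"
    then have "W j = 0" for j using W six_exhaust[of j] by auto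
    then have "Z j = 0" for j using Zj[of "j - k"] by simp
    then show ?thesis by blast
  next
    assume h: "r' = 0" "r = parsum p 1 - 2 * p 1" "W 3 = p 1 * (p 1 + parsum p 0)" "W 0 = p 1 * (p 1 - parsum p 1)"
    have "(\<lambda>j. Z (j + k)) = zero_one p"
    proof (rule ext)
      fix j
      show "Z (j + k) = zero_one p j"
        unfolding Zj using six_exhaust[of j] W h by (elim disjE) (simp_all add: zero_one_def Let_def)
    qed
    then show ?thesis unfolding p_def by blast
  next
    assume h: "r = 0" "r' = parsum p 0 - 2 * p 4" "W 0 = p 4 * (p 4 + parsum p 1)" "W 3 = p 4 * (p 4 - parsum p 0)"
    have "(\<lambda>j. Z (j + (k + 3))) = zero_one (\<lambda>j. \<alpha> (j + (k + 3)))"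
    proof (rule ext)
      fix j
      have e: "Z (j + (k + 3)) = W (j + 3)" using Zj[of "j+3"] by (simp add: ac_simps)
      have s: "(\<lambda>j. \<alpha> (j + (k + 3))) = (\<lambda>j. p (j + 3))" by (simp add: p_def ac_simps)
      show "Z (j + (k + 3)) = zero_one (\<lambda>j. \<alpha> (j + (k + 3))) j"
        unfolding e s using six_exhaust[of j] W h
        by (elim disjE) (simp_all add: zero_one_def Let_def parsum_def algebra_simps)
    qed
    then show ?thesis by blast
  next
    assume h: "r = parsum p 1 - 2 * (p 1 - p 4)" "r' = 1 - r" "W 3 = (p 1 - p 4) * (p 1 - p 4 + parsum p 0)"
      "W 0 = (p 1 - p 4) * (p 1 - p 4 - parsum p 1)"
    have t: "1 - parsum p 1 = parsum p 0" using totp[of 0] by (simp add: algebra_simps)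
    have "(\<lambda>j. Z (j + k)) = zero_two p"
    proof (rule ext)
      fix j
      show "Z (j + k) = zero_two p j"
        unfolding Zj using six_exhaust[of j] W h t[symmetric]
        by (elim disjE) (simp_all add: zero_two_def Let_def)
    qed
    then show ?thesis unfolding p_def by blast
  qed
qed

section \<open>The Hamiltonians at infinity\<close>

text \<open>The constant terms of the Hamiltonians at infinity, for each of the five types. In all cases they differ from each
  other by linear functions of the parameters.\<close>

definition inf_a1 :: "(6 \<Rightarrow> complex) \<Rightarrow> 6 \<Rightarrow> complex" where
  "inf_a1 p = (let n = p 2 * (p 3 + p 5) + p 4 * p 5 in
     vec6 n n (n - p 3 - p 5) (n - p 2) (n - p 5) (n - p 2 - p 4))"

definition inf_a2 :: "(6 \<Rightarrow> complex) \<Rightarrow> 6 \<Rightarrow> complex" where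
  "inf_a2 p = (let n = p 1 * p 2 + p 4 * p 5 in
     vec6 n (n - p 2) (n - p 1) n (n - p 5) (n - p 4))"

definition inf_a3 :: "(6 \<Rightarrow> complex) \<Rightarrow> 6 \<Rightarrow> complex" where
  "inf_a3 p = (let n = p 3 * (p 0 + p 4 + p 5) + p 5 * (p 2 + p 3 + p 4) in
     vec6 (n - p 3) n (n - p 5) (n - p 0 - p 4 - 2 * p 5) (n - p 3 - p 5) (n - p 2 - p 4 - 2 * p 3))"

definition inf_b :: "(6 \<Rightarrow> complex) \<Rightarrow> 6 \<Rightarrow> complex" where
  "inf_b p = (let X = p 1 + p 2; S = p 2 + p 3 + p 5; n = (X * X + S * S) / 2 + 2 * (p 4 * p 5) in
     vec6 (n - 1/4) (n + 1/4 - X) (n + 3/4 - X - S) (n + 1/4 - S) (n - 1/4 - 2 * p 5) (n + 1/4 - S - 2 * p 4))"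

definition inf_c :: "(6 \<Rightarrow> complex) \<Rightarrow> 6 \<Rightarrow> complex" where
  "inf_c p = (let b = \<lambda>i. p i + p (i+1); T = \<lambda>i. b (i+2) * b (i+2) + b (i+2) * b (i+4) + b (i+4) * b (i+4) - 1/3 in
     (\<lambda>j. T j + T (j+5)))"

lemma reg_nth:
  assumes "ord_ge 0 x" "ord_ge 0 y"
  shows "ord_ge 0 (x * y)" "(x * y) $$ 0 = x $$ 0 * y $$ 0" "(x * y) $$ 1 = x $$ 0 * y $$ 1 + x $$ 1 * y $$ 0"
    "(x * y) $$ 2 = x $$ 0 * y $$ 2 + x $$ 1 * y $$ 1 + x $$ 2 * y $$ 0"
  using ord_ge_mult[OF assms] nth_mult_lead[OF assms, of 0] nth_mult_lead1[OF assms, of 1] nth_mult_lead2[OF assms, of 2]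
  by simp_all

text \<open>The coefficient at order 2 of the quartic part, for functions with the expansion \<open>v + u X + w X\<^sup>2 + \<dots>\<close>; this order is needed
  because the quartic part is multiplied by \<open>x\<^sup>2\<close>.\<close>

definition quart2 :: "(6 \<Rightarrow> complex) \<Rightarrow> (6 \<Rightarrow> complex) \<Rightarrow> (6 \<Rightarrow> complex) \<Rightarrow> complex" where
  "quart2 v u w = (let a = \<lambda>i. v i * (1 - v i); b = \<lambda>i. u i * (1 - v i) - v i * u i;
     c = \<lambda>i. w i * (1 - v i) - u i * u i - v i * w i in
     (a 2 * c 1 + b 2 * b 1 + c 2 * a 1) + (a 4 * c 5 + b 4 * b 5 + c 4 * a 5)
     - 2 * ((v 2 * v 1) * (v 4 * w 5 + u 4 * u 5 + w 4 * v 5) + (v 2 * u 1 + u 2 * v 1) * (v 4 * u 5 + u 4 * v 5)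
        + (v 2 * w 1 + u 2 * u 1 + w 2 * v 1) * (v 4 * v 5)))"

lemma quart_nth2:
  assumes "\<And>i. ord_ge 0 (F i)"
  shows "quart F 3 $$ 2 = quart2 (\<lambda>i. F i $$ 0) (\<lambda>i. F i $$ 1) (\<lambda>i. F i $$ 2)"
proof -
  have e: "ord_ge 0 (1 - F i)" for i using assms by (simp add: ord_ge_diff ord_ge_1)
  have E: "ord_ge 0 (F i * (1 - F i))" "(F i * (1 - F i)) $$ 0 = F i $$ 0 * (1 - F i $$ 0)"
    "(F i * (1 - F i)) $$ 1 = F i $$ 1 * (1 - F i $$ 0) - F i $$ 0 * F i $$ 1"
    "(F i * (1 - F i)) $$ 2 = F i $$ 2 * (1 - F i $$ 0) - F i $$ 1 * F i $$ 1 - F i $$ 0 * F i $$ 2" for i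
    using reg_nth[OF assms e, of i i] by simp_all
  have q: "quart F 3 = F 2 * (1 - F 2) * (F 1 * (1 - F 1)) + F 4 * (1 - F 4) * (F 5 * (1 - F 5)) - 2 * (F 2 * F 1 * (F 4 * F 5))"
    by (simp add: quart_def)
  show ?thesis unfolding q quart2_def Let_def
    by (simp only: fls_plus_nth fls_minus_nth fls_mult_of_numeral_nth reg_nth[OF E(1) E(1)]
       reg_nth[OF reg_nth(1)[OF assms assms] reg_nth(1)[OF assms assms]] reg_nth[OF assms assms] E)
qed

definition bilin1 :: "(6 \<Rightarrow> complex) \<Rightarrow> (6 \<Rightarrow> complex) \<Rightarrow> (6 \<Rightarrow> complex) \<Rightarrow> 6 \<Rightarrow> complex" where
  "bilin1 p v u j = u (j+4) * (p (j+5) - parsum p (j+1) * v (j+5)) - v (j+4) * (parsum p (j+1) * u (j+5))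
     - u (j+2) * (p (j+1) - parsum p (j+1) * v (j+1)) + v (j+2) * (parsum p (j+1) * u (j+1))
     - p (j+4) * u (j+5) + p (j+2) * u (j+1)"

lemma bilin_nth1:
  assumes "\<And>i. ord_ge 0 (F i)" and "\<And>i. P i = fls_const (p i)"
  shows "bilin P F j $$ 1 = bilin1 p (\<lambda>i. F i $$ 0) (\<lambda>i. F i $$ 1) j"
proof -
  have PP: "parsum P i = fls_const (parsum p i)" for i by (simp add: assms(2) parsum_def fls_plus_const)
  have e: "ord_ge 0 (P i)" "ord_ge 0 (parsum P i)" "ord_ge 0 (P i - parsum P k * F m)" for i k m
    unfolding PP using assms ord_ge_mult[of 0 "fls_const (parsum p k)" 0 "F m"]
    by (auto intro!: ord_ge_diff ord_ge_const)
  show ?thesis unfolding bilin_def bilin1_def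
    using assms(1) e by (simp add: reg_nth) (simp add: PP assms(2) algebra_simps)
qed

text \<open>The first coefficient \<open>u\<close> at infinity solves a linear system that is nonsingular, so a solution of it can be guessed and checked.\<close>

lemma quadr_lin_solve:
  assumes v: "v \<in> infinity_types" and u: "\<And>i. u i + u (i+2) + u (i+4) = 0" "\<And>i. u' i + u' (i+2) + u' (i+4) = 0"
    and e: "\<And>i. quadr_lin v u i = quadr_lin v u' i"
  shows "u = u'"
proof -
  have "u i - u' i = 0" for i
  proof (rule quadr_lin_inject[OF v, of "\<lambda>i. u i - u' i"])
    show "\<forall>i. parsum (\<lambda>i. u i - u' i) i = 0"
    proof
      fix i show "parsum (\<lambda>i. u i - u' i) i = 0" using u(1)[of i] u(2)[of i] unfolding parsum_def by algebra
    qed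
    show "\<forall>i. quadr_lin v (\<lambda>i. u i - u' i) i = 0"
    proof
      fix i show "quadr_lin v (\<lambda>i. u i - u' i) i = 0" using e[of i] unfolding quadr_lin_def by algebra
    qed
  qed
  then show ?thesis by (auto simp: fun_eq_iff)
qed

lemma six_sums:
  "(1::6)+1 = 2" "(1::6)+2 = 3" "(1::6)+3 = 4" "(1::6)+4 = 5" "(1::6)+5 = 0"
  "(2::6)+1 = 3" "(2::6)+2 = 4" "(2::6)+3 = 5" "(2::6)+4 = 0" "(2::6)+5 = 1"
  "(3::6)+1 = 4" "(3::6)+2 = 5" "(3::6)+3 = 0" "(3::6)+4 = 1" "(3::6)+5 = 2"
  "(4::6)+1 = 5" "(4::6)+2 = 0" "(4::6)+3 = 1" "(4::6)+4 = 2" "(4::6)+5 = 3"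
  "(5::6)+1 = 0" "(5::6)+2 = 1" "(5::6)+3 = 2" "(5::6)+4 = 3" "(5::6)+5 = 4"
  by simp_all

text \<open>The proof finds \<open>u\<close> and inserts it. The second coefficient \<open>w\<close> cancels: the differential of the quartic
  part at each of the five vectors vanishes on vectors with parity sums 0. The other four types go in the same way.\<close>

lemma infinity_value_a1:
  assumes v: "v = vec6 1 1 0 0 0 0" and u: "\<And>i. u i + u (i+2) + u (i+4) = 0" and w: "\<And>i. w i + w (i+2) + w (i+4) = 0"
    and e: "\<And>i. quadr_lin v u i = parsum p i * v i - p i" and p: "p 0 + p 1 + p 2 + p 3 + p 4 + p 5 = 1"
  shows "quart2 v u w + bilin1 p v u j = inf_a1 p j"
proof -
  have p0: "p 0 = 1 - p 1 - p 2 - p 3 - p 4 - p 5" using p by algebra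
  have U: "u = vec6 (- p 2 - p 4) (p 3 + p 5) (p 2) (- p 3) (p 4) (- p 5)" (is "u = ?u")
  proof (rule quadr_lin_solve[of v])
    show "v \<in> infinity_types" unfolding v infinity_types_def by simp
    show "?u i + ?u (i+2) + ?u (i+4) = 0" for i using six_exhaust[of i] by (elim disjE) simp_all
    show "quadr_lin v u i = quadr_lin v ?u i" for i
      unfolding e using six_exhaust[of i]
      by (elim disjE; hypsubst; simp only: quadr_lin_def quadr_def parsum_def v p0 six_sums add_0_left vec6_simps; simp add: algebra_simps add_divide_distrib)
  qed (rule u)
  have W0: "w 0 = - w 2 - w 4" using w[of 0, simplified] by algebra
  have W: "w 1 = - w 3 - w 5" using w[of 1, simplified] by algebra
  show ?thesis
    using six_exhaust[of j] unfolding U v quart2_def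
    by (elim disjE; hypsubst; simp only: bilin1_def inf_a1_def Let_def parsum_def W W0 p0 six_sums add_0_left vec6_simps; simp add: algebra_simps add_divide_distrib)
qed

lemma infinity_value_a2:
  assumes v: "v = vec6 1 0 0 1 0 0" and u: "\<And>i. u i + u (i+2) + u (i+4) = 0" and w: "\<And>i. w i + w (i+2) + w (i+4) = 0"
    and e: "\<And>i. quadr_lin v u i = parsum p i * v i - p i" and p: "p 0 + p 1 + p 2 + p 3 + p 4 + p 5 = 1"
  shows "quart2 v u w + bilin1 p v u j = inf_a2 p j"
proof -
  have p0: "p 0 = 1 - p 1 - p 2 - p 3 - p 4 - p 5" using p by algebra
  have U: "u = vec6 (p 2 - p 4) (p 1) (- p 2) (- p 1 + p 5) (p 4) (- p 5)" (is "u = ?u")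
  proof (rule quadr_lin_solve[of v])
    show "v \<in> infinity_types" unfolding v infinity_types_def by simp
    show "?u i + ?u (i+2) + ?u (i+4) = 0" for i using six_exhaust[of i] by (elim disjE) simp_all
    show "quadr_lin v u i = quadr_lin v ?u i" for i
      unfolding e using six_exhaust[of i]
      by (elim disjE; hypsubst; simp only: quadr_lin_def quadr_def parsum_def v p0 six_sums add_0_left vec6_simps; simp add: algebra_simps add_divide_distrib)
  qed (rule u)
  have W0: "w 0 = - w 2 - w 4" using w[of 0, simplified] by algebra
  have W: "w 1 = - w 3 - w 5" using w[of 1, simplified] by algebra
  show ?thesis
    using six_exhaust[of j] unfolding U v quart2_def
    by (elim disjE; hypsubst; simp only: bilin1_def inf_a2_def Let_def parsum_def W W0 p0 six_sums add_0_left vec6_simps; simp add: algebra_simps add_divide_distrib)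
qed

lemma infinity_value_a3:
  assumes v: "v = vec6 1 1 1 0 (-1) 0" and u: "\<And>i. u i + u (i+2) + u (i+4) = 0" and w: "\<And>i. w i + w (i+2) + w (i+4) = 0"
    and e: "\<And>i. quadr_lin v u i = parsum p i * v i - p i" and p: "p 0 + p 1 + p 2 + p 3 + p 4 + p 5 = 1"
  shows "quart2 v u w + bilin1 p v u j = inf_a3 p j"
proof -
  have p0: "p 0 = 1 - p 1 - p 2 - p 3 - p 4 - p 5" using p by algebra
  have U: "u = vec6 (- p 2 - 2 * p 3 - p 4) (- p 3 + p 5) (p 0 + p 4 + 2 * p 5) (p 3) (- p 0 + p 2 + 2 * p 3 - 2 * p 5) (- p 5)" (is "u = ?u")
  proof (rule quadr_lin_solve[of v])
    show "v \<in> infinity_types" unfolding v infinity_types_def by simp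
    show "?u i + ?u (i+2) + ?u (i+4) = 0" for i using six_exhaust[of i] by (elim disjE) simp_all
    show "quadr_lin v u i = quadr_lin v ?u i" for i
      unfolding e using six_exhaust[of i]
      by (elim disjE; hypsubst; simp only: quadr_lin_def quadr_def parsum_def v p0 six_sums add_0_left vec6_simps; simp add: algebra_simps add_divide_distrib)
  qed (rule u)
  have W0: "w 0 = - w 2 - w 4" using w[of 0, simplified] by algebra
  have W: "w 1 = - w 3 - w 5" using w[of 1, simplified] by algebra
  show ?thesis
    using six_exhaust[of j] unfolding U v quart2_def
    by (elim disjE; hypsubst; simp only: bilin1_def inf_a3_def Let_def parsum_def W W0 p0 six_sums add_0_left vec6_simps; simp add: algebra_simps add_divide_distrib)
qed

lemma infinity_value_b:
  assumes v: "v = vec6 (1/2) (1/2) (1/2) (1/2) 0 0" and u: "\<And>i. u i + u (i+2) + u (i+4) = 0" and w: "\<And>i. w i + w (i+2) + w (i+4) = 0"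
    and e: "\<And>i. quadr_lin v u i = parsum p i * v i - p i" and p: "p 0 + p 1 + p 2 + p 3 + p 4 + p 5 = 1"
  shows "quart2 v u w + bilin1 p v u j = inf_b p j"
proof -
  have p0: "p 0 = 1 - p 1 - p 2 - p 3 - p 4 - p 5" using p by algebra
  have U: "u = vec6 (p 1 - p 3 - 2 * p 4 - p 5) (- p 0 + p 2 - p 4) (- p 1 + p 3 + p 5) (p 0 - p 2 + p 4 + 2 * p 5) (2 * p 4) (- 2 * p 5)" (is "u = ?u")
  proof (rule quadr_lin_solve[of v])
    show "v \<in> infinity_types" unfolding v infinity_types_def by simp
    show "?u i + ?u (i+2) + ?u (i+4) = 0" for i using six_exhaust[of i] by (elim disjE) simp_all
    show "quadr_lin v u i = quadr_lin v ?u i" for i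
      unfolding e using six_exhaust[of i]
      by (elim disjE; hypsubst; simp only: quadr_lin_def quadr_def parsum_def v p0 six_sums add_0_left vec6_simps; simp add: algebra_simps add_divide_distrib)
  qed (rule u)
  have W0: "w 0 = - w 2 - w 4" using w[of 0, simplified] by algebra
  have W: "w 1 = - w 3 - w 5" using w[of 1, simplified] by algebra
  show ?thesis
    using six_exhaust[of j] unfolding U v quart2_def
    by (elim disjE; hypsubst; simp only: bilin1_def inf_b_def Let_def parsum_def W W0 p0 six_sums add_0_left vec6_simps; simp add: algebra_simps add_divide_distrib)
qed

lemma infinity_value_c:
  assumes v: "v = vec6 (1/3) (1/3) (1/3) (1/3) (1/3) (1/3)" and u: "\<And>i. u i + u (i+2) + u (i+4) = 0" and w: "\<And>i. w i + w (i+2) + w (i+4) = 0"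
    and e: "\<And>i. quadr_lin v u i = parsum p i * v i - p i" and p: "p 0 + p 1 + p 2 + p 3 + p 4 + p 5 = 1"
  shows "quart2 v u w + bilin1 p v u j = inf_c p j"
proof -
  have p0: "p 0 = 1 - p 1 - p 2 - p 3 - p 4 - p 5" using p by algebra
  have U: "u = vec6 (2 * p 1 + p 2 - p 4 - 2 * p 5) (- 2 * p 0 + 2 * p 2 + p 3 - p 5) (- p 0 - 2 * p 1 + 2 * p 3 + p 4) (- p 1 - 2 * p 2 + 2 * p 4 + p 5) (p 0 - p 2 - 2 * p 3 + 2 * p 5) (2 * p 0 + p 1 - p 3 - 2 * p 4)" (is "u = ?u")
  proof (rule quadr_lin_solve[of v])
    show "v \<in> infinity_types" unfolding v infinity_types_def by simp
    show "?u i + ?u (i+2) + ?u (i+4) = 0" for i using six_exhaust[of i] by (elim disjE) simp_all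
    show "quadr_lin v u i = quadr_lin v ?u i" for i
      unfolding e using six_exhaust[of i]
      by (elim disjE; hypsubst; simp only: quadr_lin_def quadr_def parsum_def v p0 six_sums add_0_left vec6_simps; simp add: algebra_simps add_divide_distrib)
  qed (rule u)
  have W0: "w 0 = - w 2 - w 4" using w[of 0, simplified] by algebra
  have W: "w 1 = - w 3 - w 5" using w[of 1, simplified] by algebra
  show ?thesis
    using six_exhaust[of j] unfolding U v quart2_def
    by (elim disjE; hypsubst; simp only: bilin1_def inf_c_def Let_def parsum_def W W0 p0 six_sums add_0_left vec6_simps; simp add: algebra_simps add_divide_distrib)
qed

lemma quadr_nth:
  assumes "\<And>i. ord_ge 0 (F i)"
  shows "quadr 1 F i $$ 0 = quadr 1 (\<lambda>i. F i $$ 0) i"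
    and "(F i * quadr 1 F i) $$ 1 = quadr_lin (\<lambda>i. F i $$ 0) (\<lambda>i. F i $$ 1) i"
proof -
  show 0: "quadr 1 F i $$ 0 = quadr 1 (\<lambda>i. F i $$ 0) i"
    unfolding quadr_def using assms by (simp add: reg_nth)
  have 1: "quadr 1 F i $$ 1 = 2 * (F (i+1) $$ 0 * F (i+2) $$ 1 + F (i+1) $$ 1 * F (i+2) $$ 0
     - (F (i+4) $$ 0 * F (i+5) $$ 1 + F (i+4) $$ 1 * F (i+5) $$ 0)) + (F (i+4) $$ 1 - F (i+2) $$ 1)"
    unfolding quadr_def using assms by (simp add: reg_nth)
  have "(F i * quadr 1 F i) $$ 1 = F i $$ 0 * quadr 1 F i $$ 1 + F i $$ 1 * quadr 1 F i $$ 0"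
    using assms ord_ge_quadr[of F i] by (simp add: reg_nth)
  then show "(F i * quadr 1 F i) $$ 1 = quadr_lin (\<lambda>i. F i $$ 0) (\<lambda>i. F i $$ 1) i"
    unfolding 0 1 quadr_lin_def by algebra
qed

text \<open>Since \<open>T\<close> has a pole, the equation forces \<open>v\<^sub>i Q\<^sub>i(v) = 0\<close> at order 0.\<close>

lemma infinity_regular:
  assumes sol: "local_sol U T \<alpha> F" and U: "ord_ge 1 U" and T: "ord_ge v T" "T $$ v \<noteq> 0" "v < 0"
  shows "ord_ge 0 (F i)" "\<exists>k. (\<lambda>i. F (i + k) $$ 0) \<in> infinity_types"
proof -
  have H: "ord_ge 0 (quadr 1 F i)" if "\<not> ord_ge 1 (F i)" for i
    by (rule local_quadr_order[OF sol U T(1,2) _ _ that]) (use T(3) in simp_all)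
  have reg: "ord_ge 0 (F i)" for i using local_pole_order[OF sol H, of i] by simp
  then show "ord_ge 0 (F i)" .
  define w where "w i = F i $$ 0" for i
  have par: "w i + w (i+2) + w (i+4) = 1" for i
    using arg_cong[OF local_sol_par[OF sol, of i], of "\<lambda>y. y $$ 0"] by (simp add: w_def)
  have crit: "w i * quadr 1 w i = 0" for i
  proof -
    have eq: "T * (F i * quadr 1 F i) = U * fls_deriv (F i) - fls_const (\<alpha> i) + fls_const (parsum \<alpha> i) * F i"
      using sol unfolding local_sol_def by simp
    have "ord_ge 0 (T * (F i * quadr 1 F i))" unfolding eq
      by (intro ord_ge_add ord_ge_diff ord_ge_const ord_ge_mult'[OF U ord_ge_deriv[OF reg]] ord_ge_mult'[OF ord_ge_const[of 0] reg]) simp_all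
    from ord_ge_cancel[OF this T(2,1)] have "(F i * quadr 1 F i) $$ 0 = 0" using T(3) by (simp add: ord_ge_def)
    then show ?thesis using reg_nth(2)[OF reg ord_ge_quadr[of F, OF reg]] quadr_nth(1)[OF reg] by (simp add: w_def[abs_def])
  qed
  have "\<exists>k. (\<lambda>i. w (i + k)) \<in> infinity_types"
  proof (rule crit_classification)
    show "w i + w (i+2) + w (i+4) = 1" for i by (rule par)
    show "w (i+2) * (2 * w (i+4) + 2 * w (i+1) - 1) = w (i+4) * (2 * w (i+2) + 2 * w (i+5) - 1)" if "w i \<noteq> 0" for i
      using crit[of i] that unfolding quadr_cross by simp
  qed
  then show "\<exists>k. (\<lambda>i. F (i + k) $$ 0) \<in> infinity_types" by (simp add: w_def)
qed

lemma infinity_place: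
  assumes sol: "local_sol (- fls_X) fls_X_inv \<alpha> F" and total: "\<alpha> 0 + \<alpha> 1 + \<alpha> 2 + \<alpha> 3 + \<alpha> 4 + \<alpha> 5 = 1"
  defines "v \<equiv> \<lambda>i. F i $$ 0" and "Z \<equiv> \<lambda>j. ham fls_X_inv (\<lambda>i. fls_const (\<alpha> i)) F j $$ 0"
  assumes v: "v \<in> infinity_types"
  shows "v = vec6 1 1 0 0 0 0 \<and> Z = inf_a1 \<alpha> \<or> v = vec6 1 0 0 1 0 0 \<and> Z = inf_a2 \<alpha>
    \<or> v = vec6 1 1 1 0 (-1) 0 \<and> Z = inf_a3 \<alpha> \<or> v = vec6 (1/2) (1/2) (1/2) (1/2) 0 0 \<and> Z = inf_b \<alpha>
    \<or> v = vec6 (1/3) (1/3) (1/3) (1/3) (1/3) (1/3) \<and> Z = inf_c \<alpha>"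
proof -
  have X: "fls_X_inv * y = fls_shift 1 y" for y :: "complex fls"
    by (simp add: fls_X_inv_times_conv_shift)
  have reg: "ord_ge 0 (F i)" for i
    by (rule infinity_regular(1)[OF sol, of "-1"]) (auto simp: ord_ge_def)
  define u w where "u = (\<lambda>i. F i $$ 1)" and "w = (\<lambda>i. F i $$ 2)"
  have u: "u i + u (i+2) + u (i+4) = 0" and w: "w i + w (i+2) + w (i+4) = 0" for i
    using arg_cong[OF local_sol_par[OF sol, of i], of "\<lambda>y. y $$ 1"] arg_cong[OF local_sol_par[OF sol, of i], of "\<lambda>y. y $$ 2"]
    by (simp_all add: u_def w_def)
  have e: "quadr_lin v u i = parsum \<alpha> i * v i - \<alpha> i" for i
  proof -
    have "- fls_X * fls_deriv (F i) = fls_X_inv * (F i * quadr 1 F i) + fls_const (\<alpha> i) - fls_const (parsum \<alpha> i) * F i"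
      using sol unfolding local_sol_def by blast
    then have "(- fls_X * fls_deriv (F i)) $$ 0 = (fls_X_inv * (F i * quadr 1 F i) + fls_const (\<alpha> i) - fls_const (parsum \<alpha> i) * F i) $$ 0"
      by simp
    moreover have "(fls_X * fls_deriv (F i)) $$ 0 = 0"
      by (simp add: fls_X_times_conv_shift)
    ultimately have "0 = (F i * quadr 1 F i) $$ 1 + \<alpha> i - parsum \<alpha> i * v i"
      unfolding X by (simp add: v_def)
    then show ?thesis using quadr_nth(2)[of F i, OF reg] by (simp add: v_def u_def algebra_simps)
  qed
  have Z: "Z j = quart2 v u w + bilin1 \<alpha> v u j" for j
  proof -
    have "quart F j = quart F 3" by (rule quart_const) (rule local_sol_par[OF sol])
    then have "Z j = (fls_X_inv * (fls_X_inv * quart F 3)) $$ 0 + (fls_X_inv * bilin (\<lambda>i. fls_const (\<alpha> i)) F j) $$ 0"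
      unfolding Z_def ham_def by (simp add: mult.assoc)
    then show ?thesis unfolding X using quart_nth2[OF reg] bilin_nth1[OF reg, of "\<lambda>i. fls_const (\<alpha> i)" \<alpha>]
      by (simp add: v_def u_def w_def)
  qed
  note vals = infinity_value_a1[OF _ u w e total] infinity_value_a2[OF _ u w e total] infinity_value_a3[OF _ u w e total]
    infinity_value_b[OF _ u w e total] infinity_value_c[OF _ u w e total]
  show ?thesis using v vals unfolding infinity_types_def fun_eq_iff[of Z] Z by blast
qed

section \<open>The residue theorem for rational functions\<close>

text \<open>Expansion at the point \<open>a\<close> in the parameter \<open>t - a\<close>.\<close>

definition place :: "complex \<Rightarrow> ratfun \<Rightarrow> complex fls" where
  "place a = substitution.ev fls_const (fls_const a + fls_X)"

text \<open>Expansion in the parameter \<open>1/t\<close>.\<close>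

definition place_inf :: "ratfun \<Rightarrow> complex fls" where
  "place_inf = substitution.ev fls_const fls_X_inv"

lemma subst_place: "substitution (fls_const :: complex \<Rightarrow> _) fls_deriv (fls_const a + fls_X)"
  by (rule substitution_fls) simp

lemma subst_inf: "substitution (fls_const :: complex \<Rightarrow> _) fls_deriv fls_X_inv"
proof (rule substitution_fls)
  have "fls_deriv fls_X_inv $$ (-2) = (-1 :: complex)" by (subst fls_deriv_nth) simp
  then show "fls_deriv fls_X_inv \<noteq> (0 :: complex fls)" by auto
qed

lemma fls_X_mult_nth: "(fls_X * y) $$ n = y $$ (n - 1)" for y :: "complex fls"
  by (simp add: fls_X_times_conv_shift)

lemma fls_X_X_inv: "fls_X * fls_X_inv = (1 :: complex fls)"
  by (rule fls_eqI) (simp add: fls_X_mult_nth)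

lemmas place_hom = substitution.ev_add[OF subst_place, folded place_def] substitution.ev_mult[OF subst_place, folded place_def]
  substitution.ev_diff[OF subst_place, folded place_def] substitution.ev_const[OF subst_place, folded place_def]
  substitution.ev_t[OF subst_place, folded place_def] substitution.ev_divide[OF subst_place, folded place_def]
  substitution.ev_minus[OF subst_place, folded place_def] substitution.ev_0[OF subst_place, folded place_def]
  substitution.ev_1[OF subst_place, folded place_def] substitution.ev_numeral[OF subst_place, folded place_def]

lemmas inf_hom = substitution.ev_add[OF subst_inf, folded place_inf_def] substitution.ev_mult[OF subst_inf, folded place_inf_def]
  substitution.ev_diff[OF subst_inf, folded place_inf_def] substitution.ev_const[OF subst_inf, folded place_inf_def]
  substitution.ev_t[OF subst_inf, folded place_inf_def] substitution.ev_divide[OF subst_inf, folded place_inf_def]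
  substitution.ev_minus[OF subst_inf, folded place_inf_def] substitution.ev_0[OF subst_inf, folded place_inf_def]
  substitution.ev_1[OF subst_inf, folded place_inf_def] substitution.ev_numeral[OF subst_inf, folded place_inf_def]

lemma place_deriv: "place a (rat_deriv r) = fls_deriv (place a r)"
  using substitution.ev_deriv[OF subst_place, folded place_def, of a r] by simp

lemma inf_deriv: "place_inf (rat_deriv r) = - (fls_X * fls_X) * fls_deriv (place_inf r)"
proof -
  have "fls_deriv (place_inf r) = place_inf (rat_deriv r) * - (fls_X_inv\<^sup>2)"
    using substitution.ev_deriv[OF subst_inf, folded place_inf_def, of r] by simp
  moreover have "fls_X * fls_X * (fls_X_inv\<^sup>2) = (1 :: complex fls)"
    using fls_X_X_inv by algebra
  ultimately show ?thesis by algebra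
qed

text \<open>The residue theorem for the differential \<open>r dt\<close>: as \<open>dt = - X\<^sup>-\<^sup>2 dX\<close> for \<open>X = 1/t\<close>, minus its residue at infinity is the
  coefficient of \<open>X\<close>.\<close>

definition residues_sum :: "ratfun \<Rightarrow> bool" where
  "residues_sum r \<longleftrightarrow> (\<exists>S. finite S \<and> (\<forall>a. a \<notin> S \<longrightarrow> place a r $$ (-1) = 0)
     \<and> (\<Sum>a\<in>S. place a r $$ (-1)) = place_inf r $$ 1)"

lemma residues_sum_add:
  assumes "residues_sum r" "residues_sum s"
  shows "residues_sum (r + s)"
proof -
  obtain S where S: "finite S" "\<forall>a. a \<notin> S \<longrightarrow> place a r $$ (-1) = 0" "(\<Sum>a\<in>S. place a r $$ (-1)) = place_inf r $$ 1"
    using assms(1) unfolding residues_sum_def by blast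
  obtain R where R: "finite R" "\<forall>a. a \<notin> R \<longrightarrow> place a s $$ (-1) = 0" "(\<Sum>a\<in>R. place a s $$ (-1)) = place_inf s $$ 1"
    using assms(2) unfolding residues_sum_def by blast
  have "(\<Sum>a\<in>S \<union> R. place a r $$ (-1)) = place_inf r $$ 1" "(\<Sum>a\<in>S \<union> R. place a s $$ (-1)) = place_inf s $$ 1"
    unfolding S(3)[symmetric] R(3)[symmetric] using S(1,2) R(1,2)
    by (intro sum.mono_neutral_right; blast)+
  then show ?thesis unfolding residues_sum_def using S R
    by (intro exI[of _ "S \<union> R"]) (simp add: place_hom inf_hom sum.distrib)
qed

text \<open>The expansion of a derivative has no residue at any place.\<close>

lemma residues_sum_deriv: "residues_sum (rat_deriv r)"
proof -
  have "place_inf (rat_deriv r) $$ 1 = 0"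
    unfolding inf_deriv mult_minus_left mult.assoc fls_uminus_nth fls_X_mult_nth by simp
  then show ?thesis unfolding residues_sum_def
    by (intro exI[of _ "{}"]) (simp add: place_deriv)
qed

lemma residues_sum_simple: "residues_sum (rat_const c / (rat_t - rat_const a))"
proof -
  have 1: "place b (rat_const c / (rat_t - rat_const a)) $$ (-1) = (if b = a then c else 0)" for b
  proof -
    define y where "y = place b (rat_const c / (rat_t - rat_const a))"
    have T: "fls_const b + fls_X - fls_const a \<noteq> (0 :: complex fls)"
    proof -
      have "(fls_const b + fls_X - fls_const a) $$ 1 = (1 :: complex)" by simp
      then show ?thesis by (metis fls_zero_nth zero_neq_one)
    qed
    have y: "(fls_const b + fls_X - fls_const a) * y = fls_const c"
      unfolding y_def using T by (simp add: place_hom)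
    show ?thesis
    proof (cases "b = a")
      case True
      then have "fls_X * y = fls_const c" using y by simp
      then have "(fls_X * y) $$ 0 = c" by simp
      then show ?thesis using True by (simp add: fls_X_mult_nth y_def)
    next
      case False
      have "ord_ge (0 - 0) y"
        by (rule ord_ge_cancel[of 0 "fls_const b + fls_X - fls_const a"]) (use False y in \<open>auto simp: ord_ge_def\<close>)
      then show ?thesis using False by (simp add: ord_ge_def y_def)
    qed
  qed
  have 2: "place_inf (rat_const c / (rat_t - rat_const a)) $$ 1 = c"
  proof -
    define y where "y = place_inf (rat_const c / (rat_t - rat_const a))"
    have v: "ord_ge (-1) (fls_X_inv - fls_const a :: complex fls)" "(fls_X_inv - fls_const a :: complex fls) $$ (-1) = 1"
      by (auto simp: ord_ge_def)
    then have T: "fls_X_inv - fls_const a \<noteq> (0 :: complex fls)" by (metis fls_zero_nth zero_neq_one)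
    have y: "(fls_X_inv - fls_const a) * y = fls_const c"
      unfolding y_def using T by (simp add: inf_hom)
    have "ord_ge (0 - (-1)) y"
      by (rule ord_ge_cancel[of 0 "fls_X_inv - fls_const a"]) (use y v ord_ge_const[of 0 c] in auto)
    then have "((fls_X_inv - fls_const a) * y) $$ 0 = y $$ 1"
      using nth_mult_lead[OF v(1), of 1 y 0] v(2) by simp
    then show ?thesis unfolding y by (simp add: y_def)
  qed
  show ?thesis unfolding residues_sum_def
    by (intro exI[of _ "{a}"]) (simp add: 1 2)
qed

lemma rat_deriv_power: "rat_deriv (x ^ n) = of_nat n * x ^ (n - 1) * rat_deriv x"
proof (induction n)
  case (Suc n)
  then show ?case by (cases n) (simp_all add: rat_deriv_mult algebra_simps)
qed simp

lemma rat_deriv_inverse_power: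
  assumes "x \<noteq> 0" "rat_deriv x = 1"
  shows "rat_deriv (rat_const (- c / of_nat (Suc n)) / x ^ Suc n) = rat_const c / x ^ Suc (Suc n)"
proof -
  have "rat_deriv (rat_const (- c / of_nat (Suc n)) / x ^ Suc n)
     = (0 * x ^ Suc n - rat_const (- c / of_nat (Suc n)) * (of_nat (Suc n) * x ^ n * 1)) / (x ^ Suc n * x ^ Suc n)"
    using assms by (subst rat_deriv_divide) (simp_all only: rat_deriv_const rat_deriv_power power_not_zero diff_Suc_1 not_False_eq_True)
  also have "rat_const (- c / of_nat (Suc n)) * (of_nat (Suc n) * x ^ n * 1) = - rat_const c * x ^ n"
  proof -
    have "rat_const (- c / of_nat (Suc n)) * rat_const (of_nat (Suc n)) = rat_const (- c)"
      by (simp only: rat_const_hom(6)[symmetric]) (simp del: of_nat_Suc)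
    then show ?thesis unfolding rat_const_of_nat by (simp only: mult.assoc[symmetric] rat_const_hom mult_1_right)
  qed
  finally show ?thesis using assms by (simp add: field_simps)
qed

lemma poly_antiderivative: "\<exists>P. pderiv P = (p :: complex poly)"
proof -
  define P where "P = Abs_poly (\<lambda>n. if n = 0 then 0 else coeff p (n - 1) / of_nat n)"
  have "\<forall>\<^sub>\<infinity>n. (if n = 0 then 0 else coeff p (n - 1) / of_nat n) = 0"
    by (rule MOST_nat[THEN iffD2], rule exI[of _ "Suc (degree p)"]) (auto simp: coeff_eq_0)
  then have c: "coeff P n = (if n = 0 then 0 else coeff p (n - 1) / of_nat n)" for n
    unfolding P_def by (subst Abs_poly_inverse) auto
  have "pderiv P = p"
    by (rule poly_eqI) (simp add: coeff_pderiv c del: of_nat_Suc)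
  then show ?thesis by blast
qed

text \<open>Partial fractions, by induction on the degree of the denominator: subtracting a multiple of \<open>(t - a)\<^sup>-\<^sup>k\<close>
  lowers the order \<open>k\<close> of the pole at \<open>a\<close>. That multiple is a derivative unless \<open>k = 1\<close>, and polynomials are derivatives.\<close>

theorem residues_sum: "residues_sum r"
proof -
  have "residues_sum (Fract p q)" if "q \<noteq> 0" for p q
    using that
  proof (induction "degree q" arbitrary: p q rule: less_induct)
    case less
    show ?case
    proof (cases "degree q = 0")
      case True
      then obtain c where c: "q = [:c:]" "c \<noteq> 0" using less.prems by (metis degree_eq_zeroE pCons_0_0)
      obtain P where P: "pderiv P = smult (1/c) p" using poly_antiderivative by blast
      have "Fract p q = rat_deriv (Fract P 1)"
        using c P by (simp add: rat_deriv_Fract eq_fract one_pCons)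
      then show ?thesis by (simp add: residues_sum_deriv)
    next
      case False
      then obtain a where a: "poly q a = 0"
        using fundamental_theorem_of_algebra[of q] by (auto simp: constant_degree)
      define k where "k = order a q"
      obtain q1 where q1: "q = [:-a, 1:] ^ k * q1" "\<not> [:-a, 1:] dvd q1"
        using order_decomp[OF less.prems, of a] unfolding k_def by blast
      have k: "k > 0" using a less.prems order_root[of q a] by (simp add: k_def)
      have nz: "poly q1 a \<noteq> 0" using q1(2) unfolding poly_eq_0_iff_dvd .
      then have nz0: "q1 \<noteq> 0" by (metis poly_0)
      define c where "c = poly p a / poly q1 a"
      have "poly (p - smult c q1) a = 0" using nz by (simp add: c_def)
      then have "[:-a, 1:] dvd p - smult c q1" by (simp only: poly_eq_0_iff_dvd)
      then obtain p2 where p2: "p - smult c q1 = [:-a, 1:] * p2" by (rule dvdE)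
      define q2 where "q2 = [:-a, 1:] ^ (k - 1) * q1"
      have "[:-a, 1:] ^ k = [:-a, 1:] * [:-a, 1:] ^ (k - 1)" using k by (cases k) simp_all
      then have q2: "q = [:-a, 1:] * q2" by (simp only: q1(1) q2_def mult.assoc)
      then have q20: "q2 \<noteq> 0" using less.prems by (metis mult_zero_right)
      have "degree q2 < degree q" unfolding q2 using q20 by (subst degree_mult_eq) auto
      then have 1: "residues_sum (Fract p2 q2)" using less.hyps q20 by blast
      have x: "rat_t - rat_const a = Fract [:-a, 1:] 1" by (simp add: rat_t_def rat_const_def)
      have x0: "rat_t - rat_const a \<noteq> 0" by (simp add: x Zero_fract_def eq_fract)
      have xk: "(rat_t - rat_const a) ^ n = Fract ([:-a, 1:] ^ n) 1" for n
        unfolding x by (induction n) (simp_all add: One_fract_def)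
      have "Fract p q = Fract p2 q2 + rat_const c / (rat_t - rat_const a) ^ k"
      proof -
        have "rat_const c / (rat_t - rat_const a) ^ k = Fract [:c:] ([:-a, 1:] ^ k)"
          unfolding xk rat_const_def[of c] by simp
        also have "\<dots> = Fract (smult c q1) q"
          using nz0 less.prems q1(1) by (simp add: eq_fract mult.commute)
        finally have 2: "rat_const c / (rat_t - rat_const a) ^ k = Fract (smult c q1) q" .
        have "Fract p2 q2 = Fract (p - smult c q1) q"
          unfolding p2 q2 by (rule mult_fract_cancel[symmetric]) simp
        then show ?thesis unfolding 2 using less.prems by (simp add: eq_fract algebra_simps)
      qed
      moreover have "residues_sum (rat_const c / (rat_t - rat_const a) ^ k)"
      proof (cases "k = 1")
        case True
        then show ?thesis using residues_sum_simple by simp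
      next
        case False
        then obtain n where n: "k = Suc (Suc n)" using k by (metis One_nat_def gr0_implies_Suc not0_implies_Suc)
        have "rat_deriv (rat_t - rat_const a) = 1" by (simp add: rat_deriv_diff)
        then show ?thesis unfolding n
          by (subst rat_deriv_inverse_power[OF x0, symmetric]) (simp_all only: residues_sum_deriv)
      qed
      ultimately show ?thesis using 1 residues_sum_add by simp
    qed
  qed
  then show ?thesis by (cases r) auto
qed

section \<open>From the residue counts to the parameters\<close>

lemma generic_functional_divide [simp]:
  "generic_functional e (x / numeral k) = generic_functional e x / numeral k"
  by (simp add: generic_functional_def add_divide_distrib)

lemma sum_six_aux: "sum h {0, 1, 2, 3, 4, 5::6} = h 0 + h 1 + h 2 + h 3 + h 4 + h 5"
  by (simp add: add.assoc)

lemma sum_six: "(\<Sum>j\<in>(UNIV::6 set). h j) = h 0 + h 1 + h 2 + h 3 + h 4 + h (5::6)"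
proof -
  have "(UNIV::6 set) = {0, 1, 2, 3, 4, 5}" using six_exhaust by auto
  then show ?thesis by (metis (no_types) sum_six_aux)
qed

lemma sum_six_shift: "(\<Sum>j\<in>(UNIV::6 set). h (j + k)) = (\<Sum>j\<in>UNIV. h j)"
  by (rule sum.reindex_bij_witness[of _ "\<lambda>j. j - k" "\<lambda>j. j + k"]) auto

text \<open>For the constant terms \<open>Z\<close> at the origin, the quantity \<open>Z\<^sub>a + \<Sum>\<^sub>j p\<^sub>j Z\<^sub>j\<close> is linear in the parameters \<open>p\<close> although \<open>Z\<close> is
  quadratic, and all its coefficients are natural numbers. It is \<open>defect_one\<close> or \<open>defect_two\<close> for \<open>zero_one\<close>
  and \<open>zero_two\<close>.\<close>

definition defect_one :: "(6 \<Rightarrow> complex) \<Rightarrow> 6 \<Rightarrow> complex" where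
  "defect_one p = vec6 0 (p 3 + p 5) 0 (p 1) 0 (p 1)"

definition defect_two :: "(6 \<Rightarrow> complex) \<Rightarrow> 6 \<Rightarrow> complex" where
  "defect_two p = vec6 (p 4) (p 3 + p 5 + 2 * p 4) (p 4) (p 1) (p 0 + p 2 + 2 * p 1) (p 1)"

lemma zero_one_defect:
  assumes "p 0 + p 1 + p 2 + p 3 + p 4 + p 5 = 1"
  shows "zero_one p a + (\<Sum>j\<in>UNIV. p j * zero_one p j) = defect_one p a"
proof -
  have p0: "p 0 = 1 - p 1 - p 2 - p 3 - p 4 - p 5" using assms by algebra
  show ?thesis using six_exhaust[of a]
    by (elim disjE; hypsubst; simp only: sum_six zero_one_def defect_one_def Let_def parsum_def p0 six_sums add_0_left vec6_simps;
        simp add: algebra_simps)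
qed

lemma zero_two_defect:
  assumes "p 0 + p 1 + p 2 + p 3 + p 4 + p 5 = 1"
  shows "zero_two p a + (\<Sum>j\<in>UNIV. p j * zero_two p j) = defect_two p a"
proof -
  have p0: "p 0 = 1 - p 1 - p 2 - p 3 - p 4 - p 5" using assms by algebra
  show ?thesis using six_exhaust[of a]
    by (elim disjE; hypsubst; simp only: sum_six zero_two_def defect_two_def Let_def parsum_def p0 six_sums add_0_left vec6_simps;
        simp add: algebra_simps)
qed

definition defects :: "(6 \<Rightarrow> complex) \<Rightarrow> (6 \<Rightarrow> complex) set" where
  "defects p = {D. (\<forall>a. D a = 0) \<or> (\<exists>k. (\<lambda>a. D (a + k)) = defect_one (\<lambda>j. p (j + k)))
     \<or> (\<exists>k. (\<lambda>a. D (a + k)) = defect_two (\<lambda>j. p (j + k)))}"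

lemma zero_defect:
  assumes total: "p 0 + p 1 + p 2 + p 3 + p 4 + p 5 = 1"
    and Z: "(\<forall>j. Z j = 0) \<or> (\<exists>k. (\<lambda>j. Z (j + k)) = zero_one (\<lambda>j. p (j + k)))
     \<or> (\<exists>k. (\<lambda>j. Z (j + k)) = zero_two (\<lambda>j. p (j + k)))"
  shows "(\<lambda>a. Z a + (\<Sum>j\<in>UNIV. p j * Z j)) \<in> defects p"
proof -
  have t: "p (0+k) + p (1+k) + p (2+k) + p (3+k) + p (4+k) + p (5+k) = 1" for k
    using total sum_six_shift[of p k] unfolding sum_six by simp
  have s: "(\<Sum>j\<in>UNIV. p j * Z j) = (\<Sum>j\<in>UNIV. p (j + k) * Z (j + k))" for k
    using sum_six_shift[of "\<lambda>j. p j * Z j" k] by simp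
  from Z show ?thesis
  proof (elim disjE exE)
    assume "\<forall>j. Z j = 0" then show ?thesis by (simp add: defects_def)
  next
    fix k assume e: "(\<lambda>j. Z (j + k)) = zero_one (\<lambda>j. p (j + k))"
    then have "Z (a + k) + (\<Sum>j\<in>UNIV. p j * Z j) = defect_one (\<lambda>j. p (j + k)) a" for a
      unfolding s[of k] fun_eq_iff using zero_one_defect[of "\<lambda>j. p (j + k)", OF t] by simp
    then show ?thesis unfolding defects_def by blast
  next
    fix k assume e: "(\<lambda>j. Z (j + k)) = zero_two (\<lambda>j. p (j + k))"
    then have "Z (a + k) + (\<Sum>j\<in>UNIV. p j * Z j) = defect_two (\<lambda>j. p (j + k)) a" for a
      unfolding s[of k] fun_eq_iff using zero_two_defect[of "\<lambda>j. p (j + k)", OF t] by simp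
    then show ?thesis unfolding defects_def by blast
  qed
qed

lemma vec6_eta: "D = vec6 (D 0) (D 1) (D 2) (D 3) (D 4) (D 5)"
proof
  fix x show "D x = vec6 (D 0) (D 1) (D 2) (D 3) (D 4) (D 5) x"
    using six_exhaust[of x] by (elim disjE) simp_all
qed

lemma vec6_unshift:
  assumes "(\<lambda>a. D (a + k)) = vec6 a0 a1 a2 a3 a4 a5"
  shows "(k = 0 \<longrightarrow> D = vec6 a0 a1 a2 a3 a4 a5) \<and>
     (k = 1 \<longrightarrow> D = vec6 a5 a0 a1 a2 a3 a4) \<and>
     (k = 2 \<longrightarrow> D = vec6 a4 a5 a0 a1 a2 a3) \<and>
     (k = 3 \<longrightarrow> D = vec6 a3 a4 a5 a0 a1 a2) \<and>
     (k = 4 \<longrightarrow> D = vec6 a2 a3 a4 a5 a0 a1) \<and>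
     (k = 5 \<longrightarrow> D = vec6 a1 a2 a3 a4 a5 a0)"
proof -
  have w: "D x = vec6 a0 a1 a2 a3 a4 a5 (x - k)" for x unfolding assms[symmetric] by simp
  have m: "(- 1 :: 6) = 5" "(- 2 :: 6) = 4" "(- 3 :: 6) = 3" "(- 4 :: 6) = 2" "(- 5 :: 6) = 1"
    by (rule minus_unique; simp)+
  have m': "(11 :: 6) = 5" by simp
  show ?thesis
    by (intro conjI impI; rule trans[OF vec6_eta]; simp add: w m m')
qed

text \<open>Parameters in the fundamental alcove, as provided by \<open>reach_alcove\<close>.\<close>

locale alcove =
  fixes p :: "6 \<Rightarrow> complex" and e :: real
  assumes total: "p 0 + p 1 + p 2 + p 3 + p 4 + p 5 = 1"
    and nonneg: "generic_functional e (p i) \<ge> 0"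
    and inj: "z \<in> int_span p \<Longrightarrow> generic_functional e z = 0 \<Longrightarrow> z = 0"
begin

abbreviation lam :: "complex \<Rightarrow> real" where "lam \<equiv> generic_functional e"

lemma lam_sum: "lam (sum h A) = (\<Sum>a\<in>A. lam (h a))"
  by (induction A rule: infinite_finite_induct) simp_all

lemma p0: "p 0 = 1 - p 1 - p 2 - p 3 - p 4 - p 5" using total by algebra

lemma lam_total: "lam (p 0) + lam (p 1) + lam (p 2) + lam (p 3) + lam (p 4) + lam (p 5) = 1"
  using arg_cong[OF total, of lam] by simp

lemma lam_zero: "lam (p i) = 0 \<Longrightarrow> p i = 0"
  using inj int_span_base by blast

lemma lam_eq: "lam (p i) = lam (p j) \<Longrightarrow> p i = p j"
  using inj[OF int_span_add[OF int_span_base int_span_minus[OF int_span_base]], of i j] by simp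

text \<open>The rotations of the defects, listed. There are three of \<open>defect_two\<close>, not six, because it is symmetric under
  the rotation by three steps.\<close>

lemma defects_cases:
  assumes "D \<in> defects p"
  shows "D \<in> {vec6 0 0 0 0 0 0,
     vec6 0 (p 3 + p 5) 0 (p 1) 0 (p 1),
     vec6 (p 2) 0 (p 4 + p 0) 0 (p 2) 0,
     vec6 0 (p 3) 0 (p 5 + p 1) 0 (p 3),
     vec6 (p 4) 0 (p 4) 0 (p 0 + p 2) 0,
     vec6 0 (p 5) 0 (p 5) 0 (p 1 + p 3),
     vec6 (p 2 + p 4) 0 (p 0) 0 (p 0) 0,
     vec6 (p 4) (p 3 + p 5 + 2 * p 4) (p 4) (p 1) (p 0 + p 2 + 2 * p 1) (p 1),
     vec6 (p 2) (p 5) (p 4 + p 0 + 2 * p 5) (p 5) (p 2) (p 1 + p 3 + 2 * p 2),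
     vec6 (p 2 + p 4 + 2 * p 3) (p 3) (p 0) (p 5 + p 1 + 2 * p 0) (p 0) (p 3)}"
  using assms unfolding defects_def mem_Collect_eq
proof (elim disjE exE)
  assume "\<forall>a. D a = 0"
  then have "D = vec6 0 0 0 0 0 0" using vec6_eta[of D] by simp
  then show ?thesis by blast
next
  fix k assume s: "(\<lambda>a. D (a + k)) = defect_one (\<lambda>j. p (j + k))"
  note u = vec6_unshift[OF s[unfolded defect_one_def]]
  show ?thesis using six_exhaust[of k]
    by (elim disjE; hypsubst; use u in \<open>simp only: six_sums add_0_left add_0_right simp_thms insert_iff\<close>)
next
  fix k assume s: "(\<lambda>a. D (a + k)) = defect_two (\<lambda>j. p (j + k))"
  note u = vec6_unshift[OF s[unfolded defect_two_def]]
  show ?thesis using six_exhaust[of k]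
    by (elim disjE; hypsubst; use u in \<open>simp only: six_sums add_0_left add_0_right simp_thms insert_iff\<close>)
qed


lemma defect_nonneg:
  assumes "D \<in> defects p" shows "lam (D a) \<ge> 0"
  using defects_cases[OF assms] six_exhaust[of a] nonneg[of 0] nonneg[of 1] nonneg[of 2] nonneg[of 3] nonneg[of 4] nonneg[of 5]
  unfolding insert_iff empty_iff by (elim disjE; simp)

text \<open>Under \<open>\<lambda>\<close> the identity becomes a sum of nonnegative terms: the \<open>N\<^sub>j\<close> are natural numbers and may be taken out of
  \<open>\<lambda>(p\<^sub>j N\<^sub>j)\<close>.\<close>

lemma balance:
  assumes nat: "\<And>j. N j \<in> \<nat>" and D: "\<And>a. lam (D a) \<ge> 0" and A: "finite A"
    and id: "(\<Sum>a\<in>A. N a) + of_nat c * (\<Sum>j\<in>UNIV. p j * N j) + (\<Sum>a\<in>A. D a) = 0" and a: "a \<in> A"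
  shows "N a = 0" "lam (D a) = 0"
proof -
  have "\<forall>j. \<exists>m. N j = of_nat m" using nat by (auto elim: Nats_cases)
  then obtain n where n: "\<And>j. N j = of_nat (n j)" by metis
  have l: "lam (of_nat m * x) = of_nat m * lam x" "lam (x * of_nat m) = of_nat m * lam x" for m x
    by (simp_all add: generic_functional_def algebra_simps)
  have "(\<Sum>a\<in>A. real (n a)) + real c * (\<Sum>j\<in>UNIV. real (n j) * lam (p j)) + (\<Sum>a\<in>A. lam (D a)) = 0"
    using arg_cong[OF id, of lam] by (simp add: n lam_sum l)
  moreover have "(\<Sum>a\<in>A. real (n a)) \<ge> 0" "(\<Sum>a\<in>A. lam (D a)) \<ge> 0" using D by (simp_all add: sum_nonneg)
  moreover have "real c * (\<Sum>j\<in>UNIV. real (n j) * lam (p j)) \<ge> 0" using nonneg by (simp add: sum_nonneg)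
  ultimately have 0: "(\<Sum>a\<in>A. real (n a)) = 0" "(\<Sum>a\<in>A. lam (D a)) = 0" by linarith+
  show "N a = 0" using 0(1) A a by (simp add: sum_nonneg_eq_0_iff n)
  show "lam (D a) = 0" using 0(2) A a D by (simp add: sum_nonneg_eq_0_iff)
qed

text \<open>If the constant terms \<open>I\<close> at infinity satisfy the identity exactly, the identity for \<open>N = I - Z\<close>
  holds with the defects \<open>D\<close> of \<open>Z\<close>. The conclusions involve \<open>I\<close> only through differences, which are linear in \<open>p\<close>.\<close>

lemma balance_defect:
  assumes nat: "\<And>j. N j \<in> \<nat>" and N: "\<And>j. N j = I j - Z j"
    and Zd: "\<And>a. D a = Z a + (\<Sum>j\<in>UNIV. p j * Z j)" and D: "D \<in> defects p"
    and A: "finite A" "b \<in> A" and I: "(\<Sum>a\<in>A. I a) + of_nat (card A) * (\<Sum>j\<in>UNIV. p j * I j) = 0"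
  shows "lam (D m) \<le> lam (I m - I b)" "m \<in> A \<Longrightarrow> lam (D m) = 0" "m \<in> A \<Longrightarrow> lam (I m - I b) = 0"
proof -
  have id: "(\<Sum>a\<in>A. N a) + of_nat (card A) * (\<Sum>j\<in>UNIV. p j * N j) + (\<Sum>a\<in>A. D a) = 0"
  proof -
    have "(\<Sum>a\<in>A. N a) + (\<Sum>a\<in>A. D a) = (\<Sum>a\<in>A. I a) + of_nat (card A) * (\<Sum>j\<in>UNIV. p j * Z j)"
      by (simp add: N Zd sum.distrib sum_subtractf)
    moreover have "(\<Sum>j\<in>UNIV. p j * N j) = (\<Sum>j\<in>UNIV. p j * I j) - (\<Sum>j\<in>UNIV. p j * Z j)"
      by (simp add: N right_diff_distrib sum_subtractf)
    ultimately show ?thesis using I by algebra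
  qed
  note bal = balance[OF nat defect_nonneg[OF D] A(1) id]
  have e: "lam (N m) + lam (D m) = lam (N b) + lam (D b) + lam (I m - I b)" for m
    by (simp add: N Zd)
  have "lam (N m) \<ge> 0" using nat[of m] by (elim Nats_cases) simp
  then show "lam (D m) \<le> lam (I m - I b)" using e[of m] bal[OF A(2)] by simp
  show "lam (D m) = 0" "lam (I m - I b) = 0" if "m \<in> A"
    using e[of m] bal[OF A(2)] bal[OF that] by simp_all
qed


text \<open>In each of the five types \<open>A\<close> consists of indices of one parity at which the vector \<open>v\<close> is not zero. Once the identity
  for \<open>I\<close> is checked, linear arithmetic treats every possible defect.\<close>

lemma parameters_a1:
  assumes nat: "\<And>j. N j \<in> \<nat>" and N: "\<And>j. N j = inf_a1 p j - Z j"
    and Zd: "\<And>a. D a = Z a + (\<Sum>j\<in>UNIV. p j * Z j)" and D: "D \<in> defects p"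
  shows "p 2 = 0 \<and> p 3 = 0 \<and> p 4 = 0 \<and> p 5 = 0"
proof -
  have I: "(\<Sum>a\<in>{0}. inf_a1 p a) + of_nat (card ({0} :: 6 set)) * (\<Sum>j\<in>UNIV. p j * inf_a1 p j) = 0"
    by (simp add: sum_six inf_a1_def Let_def p0 algebra_simps add_divide_distrib)
  have d: "inf_a1 p 1 - inf_a1 p 0 = 0" "inf_a1 p 2 - inf_a1 p 0 = - p 3 - p 5" "inf_a1 p 3 - inf_a1 p 0 = - p 2" "inf_a1 p 4 - inf_a1 p 0 = - p 5" "inf_a1 p 5 - inf_a1 p 0 = - p 2 - p 4"
    by (simp_all add: inf_a1_def Let_def p0 algebra_simps add_divide_distrib)
  have le: "lam (D m) \<le> lam (inf_a1 p m - inf_a1 p 0)" for m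
    by (rule balance_defect(1)[OF nat N Zd D _ _ I]) simp_all
  have eq: "lam (D m) = 0" "lam (inf_a1 p m - inf_a1 p 0) = 0" if "m \<in> {0}" for m
    by (rule balance_defect(2)[where A = "{0}" and b = 0, OF nat N Zd D _ _ I that]; simp)
      (rule balance_defect(3)[where A = "{0}" and b = 0, OF nat N Zd D _ _ I that]; simp)
  have z: "lam (D 0) = 0" by (rule eq; simp)+
  have "lam (p 2) = 0 \<and> lam (p 3) = 0 \<and> lam (p 4) = 0 \<and> lam (p 5) = 0"
    using defects_cases[OF D] le[of 1, unfolded d] le[of 2, unfolded d] le[of 3, unfolded d] le[of 4, unfolded d] le[of 5, unfolded d]
      z nonneg[of 0] nonneg[of 1] nonneg[of 2] nonneg[of 3] nonneg[of 4] nonneg[of 5] lam_total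
    unfolding insert_iff empty_iff by (elim disjE; simp; (intro conjI)?; linarith)
  then show ?thesis using lam_zero lam_eq by blast
qed

lemma parameters_a2:
  assumes nat: "\<And>j. N j \<in> \<nat>" and N: "\<And>j. N j = inf_a2 p j - Z j"
    and Zd: "\<And>a. D a = Z a + (\<Sum>j\<in>UNIV. p j * Z j)" and D: "D \<in> defects p"
  shows "p 1 = 0 \<and> p 2 = 0 \<and> p 4 = 0 \<and> p 5 = 0"
proof -
  have I: "(\<Sum>a\<in>{0}. inf_a2 p a) + of_nat (card ({0} :: 6 set)) * (\<Sum>j\<in>UNIV. p j * inf_a2 p j) = 0"
    by (simp add: sum_six inf_a2_def Let_def p0 algebra_simps add_divide_distrib)
  have d: "inf_a2 p 1 - inf_a2 p 0 = - p 2" "inf_a2 p 2 - inf_a2 p 0 = - p 1" "inf_a2 p 3 - inf_a2 p 0 = 0" "inf_a2 p 4 - inf_a2 p 0 = - p 5" "inf_a2 p 5 - inf_a2 p 0 = - p 4"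
    by (simp_all add: inf_a2_def Let_def p0 algebra_simps add_divide_distrib)
  have le: "lam (D m) \<le> lam (inf_a2 p m - inf_a2 p 0)" for m
    by (rule balance_defect(1)[OF nat N Zd D _ _ I]) simp_all
  have eq: "lam (D m) = 0" "lam (inf_a2 p m - inf_a2 p 0) = 0" if "m \<in> {0}" for m
    by (rule balance_defect(2)[where A = "{0}" and b = 0, OF nat N Zd D _ _ I that]; simp)
      (rule balance_defect(3)[where A = "{0}" and b = 0, OF nat N Zd D _ _ I that]; simp)
  have z: "lam (D 0) = 0" by (rule eq; simp)+
  have "lam (p 1) = 0 \<and> lam (p 2) = 0 \<and> lam (p 4) = 0 \<and> lam (p 5) = 0"
    using defects_cases[OF D] le[of 1, unfolded d] le[of 2, unfolded d] le[of 3, unfolded d] le[of 4, unfolded d] le[of 5, unfolded d]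
      z nonneg[of 0] nonneg[of 1] nonneg[of 2] nonneg[of 3] nonneg[of 4] nonneg[of 5] lam_total
    unfolding insert_iff empty_iff by (elim disjE; simp; (intro conjI)?; linarith)
  then show ?thesis using lam_zero lam_eq by blast
qed

lemma parameters_a3:
  assumes nat: "\<And>j. N j \<in> \<nat>" and N: "\<And>j. N j = inf_a3 p j - Z j"
    and Zd: "\<And>a. D a = Z a + (\<Sum>j\<in>UNIV. p j * Z j)" and D: "D \<in> defects p"
  shows "p 0 = 0 \<and> p 2 = 0 \<and> p 3 = 0 \<and> p 4 = 0 \<and> p 5 = 0"
proof -
  have I: "(\<Sum>a\<in>{1}. inf_a3 p a) + of_nat (card ({1} :: 6 set)) * (\<Sum>j\<in>UNIV. p j * inf_a3 p j) = 0"
    by (simp add: sum_six inf_a3_def Let_def p0 algebra_simps add_divide_distrib)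
  have d: "inf_a3 p 0 - inf_a3 p 1 = - p 3" "inf_a3 p 2 - inf_a3 p 1 = - p 5" "inf_a3 p 3 - inf_a3 p 1 = - p 0 - p 4 - 2 * p 5" "inf_a3 p 4 - inf_a3 p 1 = - p 3 - p 5" "inf_a3 p 5 - inf_a3 p 1 = - p 2 - p 4 - 2 * p 3"
    by (simp_all add: inf_a3_def Let_def p0 algebra_simps add_divide_distrib)
  have le: "lam (D m) \<le> lam (inf_a3 p m - inf_a3 p 1)" for m
    by (rule balance_defect(1)[OF nat N Zd D _ _ I]) simp_all
  have eq: "lam (D m) = 0" "lam (inf_a3 p m - inf_a3 p 1) = 0" if "m \<in> {1}" for m
    by (rule balance_defect(2)[where A = "{1}" and b = 1, OF nat N Zd D _ _ I that]; simp)
      (rule balance_defect(3)[where A = "{1}" and b = 1, OF nat N Zd D _ _ I that]; simp)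
  have z: "lam (D 1) = 0" by (rule eq; simp)+
  have "lam (p 0) = 0 \<and> lam (p 2) = 0 \<and> lam (p 3) = 0 \<and> lam (p 4) = 0 \<and> lam (p 5) = 0"
    using defects_cases[OF D] le[of 0, unfolded d] le[of 2, unfolded d] le[of 3, unfolded d] le[of 4, unfolded d] le[of 5, unfolded d]
      z nonneg[of 0] nonneg[of 1] nonneg[of 2] nonneg[of 3] nonneg[of 4] nonneg[of 5] lam_total
    unfolding insert_iff empty_iff by (elim disjE; simp; (intro conjI)?; linarith)
  then show ?thesis using lam_zero lam_eq by blast
qed

lemma parameters_b:
  assumes nat: "\<And>j. N j \<in> \<nat>" and N: "\<And>j. N j = inf_b p j - Z j"
    and Zd: "\<And>a. D a = Z a + (\<Sum>j\<in>UNIV. p j * Z j)" and D: "D \<in> defects p"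
  shows "p 4 = 0 \<and> p 5 = 0 \<and> p 0 = p 2 \<and> p 1 = p 3"
proof -
  have I: "(\<Sum>a\<in>{0, 2}. inf_b p a) + of_nat (card ({0, 2} :: 6 set)) * (\<Sum>j\<in>UNIV. p j * inf_b p j) = 0"
    by (simp add: sum_six inf_b_def Let_def p0 algebra_simps add_divide_distrib)
  have d: "inf_b p 1 - inf_b p 0 = 1/2 - p 1 - p 2" "inf_b p 2 - inf_b p 0 = 1 - p 1 - 2 * p 2 - p 3 - p 5" "inf_b p 3 - inf_b p 0 = 1/2 - p 2 - p 3 - p 5" "inf_b p 4 - inf_b p 0 = - 2 * p 5" "inf_b p 5 - inf_b p 0 = 1/2 - p 2 - p 3 - p 5 - 2 * p 4"
    by (simp_all add: inf_b_def Let_def p0 algebra_simps add_divide_distrib)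
  have le: "lam (D m) \<le> lam (inf_b p m - inf_b p 0)" for m
    by (rule balance_defect(1)[OF nat N Zd D _ _ I]) simp_all
  have eq: "lam (D m) = 0" "lam (inf_b p m - inf_b p 0) = 0" if "m \<in> {0, 2}" for m
    by (rule balance_defect(2)[where A = "{0, 2}" and b = 0, OF nat N Zd D _ _ I that]; simp)
      (rule balance_defect(3)[where A = "{0, 2}" and b = 0, OF nat N Zd D _ _ I that]; simp)
  have z: "lam (D 0) = 0" "lam (D 2) = 0" by (rule eq; simp)+
  have y: "lam (1 - p 1 - 2 * p 2 - p 3 - p 5) = 0"
    using eq(2)[of 2] unfolding d by simp_all
  have "lam (p 4) = 0 \<and> lam (p 5) = 0 \<and> lam (p 0) = lam (p 2) \<and> lam (p 1) = lam (p 3)"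
    using defects_cases[OF D] le[of 1, unfolded d] le[of 2, unfolded d] le[of 3, unfolded d] le[of 4, unfolded d] le[of 5, unfolded d]
      z y nonneg[of 0] nonneg[of 1] nonneg[of 2] nonneg[of 3] nonneg[of 4] nonneg[of 5] lam_total
    unfolding insert_iff empty_iff by (elim disjE; simp; (intro conjI)?; linarith)
  then show ?thesis using lam_zero lam_eq by blast
qed

lemma parameters_c:
  assumes nat: "\<And>j. N j \<in> \<nat>" and N: "\<And>j. N j = inf_c p j - Z j"
    and Zd: "\<And>a. D a = Z a + (\<Sum>j\<in>UNIV. p j * Z j)" and D: "D \<in> defects p"
  shows "p 0 = p 2 \<and> p 2 = p 4 \<and> p 1 = p 3 \<and> p 3 = p 5"
proof -
  have I: "(\<Sum>a\<in>{0, 2, 4}. inf_c p a) + of_nat (card ({0, 2, 4} :: 6 set)) * (\<Sum>j\<in>UNIV. p j * inf_c p j) = 0"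
    by (simp add: sum_six inf_c_def Let_def p0 algebra_simps add_divide_distrib) (simp add: field_simps)
  have d: "inf_c p 1 - inf_c p 0 = p 0 - p 1 - p 2 + p 5" "inf_c p 2 - inf_c p 0 = 2 * p 0 - 2 * p 2 - p 3 + p 5" "inf_c p 3 - inf_c p 0 = 2 * p 0 + p 1 - p 2 - 2 * p 3 - p 4 + p 5" "inf_c p 4 - inf_c p 0 = 2 * p 0 + p 1 - p 3 - 2 * p 4" "inf_c p 5 - inf_c p 0 = p 0 + p 1 - p 4 - p 5"
    by (simp_all add: inf_c_def Let_def p0 algebra_simps add_divide_distrib)
  have le: "lam (D m) \<le> lam (inf_c p m - inf_c p 0)" for m
    by (rule balance_defect(1)[OF nat N Zd D _ _ I]) simp_all
  have eq: "lam (D m) = 0" "lam (inf_c p m - inf_c p 0) = 0" if "m \<in> {0, 2, 4}" for m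
    by (rule balance_defect(2)[where A = "{0, 2, 4}" and b = 0, OF nat N Zd D _ _ I that]; simp)
      (rule balance_defect(3)[where A = "{0, 2, 4}" and b = 0, OF nat N Zd D _ _ I that]; simp)
  have z: "lam (D 0) = 0" "lam (D 2) = 0" "lam (D 4) = 0" by (rule eq; simp)+
  have y: "lam (2 * p 0 - 2 * p 2 - p 3 + p 5) = 0" "lam (2 * p 0 + p 1 - p 3 - 2 * p 4) = 0"
    using eq(2)[of 2] eq(2)[of 4] unfolding d by simp_all
  have "lam (p 0) = lam (p 2) \<and> lam (p 2) = lam (p 4) \<and> lam (p 1) = lam (p 3) \<and> lam (p 3) = lam (p 5)"
    using defects_cases[OF D] le[of 1, unfolded d] le[of 2, unfolded d] le[of 3, unfolded d] le[of 4, unfolded d] le[of 5, unfolded d]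
      z y nonneg[of 0] nonneg[of 1] nonneg[of 2] nonneg[of 3] nonneg[of 4] nonneg[of 5] lam_total
    unfolding insert_iff empty_iff by (elim disjE; simp; (intro conjI)?; linarith)
  then show ?thesis using lam_zero lam_eq by blast
qed

end

section \<open>Transporting solutions along substitutions\<close>

lemma (in substitution) ev_solution:
  assumes g: "\<And>i. d * rat_deriv (g i) = t * (g i * quadr 1 g i) + rat_const (\<alpha> i) - rat_const (parsum \<alpha> i) * g i"
    and U: "U * del T = ev d"
  shows "U * del (ev (g i)) = ev t * (ev (g i) * quadr 1 (\<lambda>i. ev (g i)) i) + emb (\<alpha> i) - emb (parsum \<alpha> i) * ev (g i)"
proof -
  have "U * del (ev (g i)) = (U * del T) * ev (rat_deriv (g i))" by (simp add: ev_deriv)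
  also have "\<dots> = ev (d * rat_deriv (g i))" by (simp add: U ev_mult)
  finally show ?thesis unfolding g by (simp add: ev_add ev_diff ev_mult ev_const ev_quadr)
qed

lemma (in substitution) ev_parsum: "ev (parsum f i) = parsum (\<lambda>i. ev (f i)) i"
  by (simp add: parsum_def ev_add)

lemma (in substitution) ev_ham: "ev (ham x p f j) = ham (ev x) (\<lambda>i. ev (p i)) (\<lambda>i. ev (f i)) j"
  by (simp add: ham_def quart_def bilin_def ev_parsum ev_add ev_diff ev_mult)

lemma substitution_compose:
  assumes "substitution rat_const rat_deriv r" and "fls_deriv (place_inf r) \<noteq> 0"
  shows "place_inf (substitution.ev rat_const r x) = substitution.ev fls_const (place_inf r) x"
proof -
  interpret r: substitution rat_const rat_deriv r by fact
  interpret s: substitution "fls_const :: complex \<Rightarrow> _" fls_deriv "place_inf r" by (rule substitution_fls) fact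
  have p: "place_inf (r.peval p) = s.peval p" for p
    by (induction p) (simp_all add: r.peval_pCons s.peval_pCons r.peval_0 s.peval_0 inf_hom)
  obtain p q where x: "x = Fract p q" "q \<noteq> 0" by (cases x) auto
  then show ?thesis by (simp add: r.ev_Fract s.ev_Fract inf_hom p)
qed

text \<open>A polynomial of degree \<open>d\<close>, evaluated at an element with a pole of order \<open>m\<close>, has a pole of order \<open>m d\<close>.\<close>

lemma pole_evaluation:
  fixes S :: "complex fls"
  assumes S: "ord_ge (- int m) S" "S $$ (- int m) \<noteq> 0" "m > 0" and sub: "substitution (fls_const :: complex \<Rightarrow> _) fls_deriv S"
    and p: "p \<noteq> 0"
  shows "fls_subdegree (substitution.peval fls_const S p) = - int (m * degree p)"
proof -
  interpret substitution "fls_const :: complex \<Rightarrow> _" fls_deriv S by fact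
  have S0: "S \<noteq> 0" using S(2) by auto
  have sS: "fls_subdegree S = - int m"
    using S by (intro fls_subdegree_eqI) (auto simp: ord_ge_def)
  show ?thesis using p
  proof (induction p)
    case (pCons a p)
    show ?case
    proof (cases "p = 0")
      case True
      then show ?thesis using pCons by (simp add: peval_pCons peval_0)
    next
      case False
      then have nz: "S * peval p \<noteq> 0" using S0 by (simp add: peval_eq_0)
      have d: "fls_subdegree (S * peval p) = - int (m * degree (pCons a p))"
        using False S0 pCons(2) sS by (simp add: peval_eq_0)
      have "0 < m * degree (pCons a p)" using S(3) False by simp
      then have neg: "- int (m * degree (pCons a p)) < 0" by linarith
      show ?thesis unfolding peval_pCons
      proof (rule fls_subdegree_eqI)
        show "(fls_const a + S * peval p) $$ (- int (m * degree (pCons a p))) \<noteq> 0"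
          using nz neg unfolding d[symmetric] by simp
        show "(fls_const a + S * peval p) $$ k = 0" if "k < - int (m * degree (pCons a p))" for k
          using that neg unfolding d[symmetric] by simp
      qed
    qed
  qed simp
qed

text \<open>The value at infinity of a rational function is invariant under substituting \<open>S\<close> for the variable,
  if \<open>S\<close> itself has a pole: after subtracting the value, the degree of the denominator exceeds that of the numerator.\<close>

lemma value_substitution:
  fixes S :: "complex fls"
  assumes S: "ord_ge (- int m) S" "S $$ (- int m) \<noteq> 0" "m > 0" and sub: "substitution (fls_const :: complex \<Rightarrow> _) fls_deriv S"
    and x: "ord_ge 0 (place_inf x)"
  shows "substitution.ev fls_const S x $$ 0 = place_inf x $$ 0"
proof -
  interpret S: substitution "fls_const :: complex \<Rightarrow> _" fls_deriv S by fact
  interpret I: substitution "fls_const :: complex \<Rightarrow> _" fls_deriv fls_X_inv by (rule subst_inf)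
  define c where "c = place_inf x $$ 0"
  obtain p q where pq: "x - rat_const c = Fract p q" "q \<noteq> 0" by (cases "x - rat_const c") auto
  show ?thesis
  proof (cases "p = 0")
    case True
    then have "Fract p q = 0" using pq(2) by (simp add: eq_fract Zero_fract_def)
    then have "x = rat_const c" using pq(1) by simp
    then show ?thesis by (simp add: S.ev_const inf_hom)
  next
    case False
    have e: "S.ev x = S.ev (Fract p q) + fls_const c" "place_inf x = I.ev (Fract p q) + fls_const c"
      unfolding pq(1)[symmetric] place_inf_def by (simp_all add: S.ev_diff S.ev_const I.ev_diff I.ev_const)
    have "ord_ge 0 (I.ev (Fract p q))" using x unfolding e(2) by (auto simp: ord_ge_def)
    moreover have "I.ev (Fract p q) $$ 0 = 0" using c_def unfolding e(2) by simp
    ultimately have "ord_ge 1 (I.ev (Fract p q))" using ord_ge_Suc[of 0] by simp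
    moreover have "fls_subdegree (I.ev (Fract p q)) = int (degree q) - int (degree p)"
      unfolding I.ev_Fract[OF pq(2)] using False pq(2)
      by (simp add: fls_divide_subdegree I.peval_eq_0 pole_evaluation[of 1 fls_X_inv, OF _ _ _ subst_inf] ord_ge_def)
    ultimately have "degree p < degree q" using False pq(2) by (simp add: ord_ge_iff I.ev_eq_0 Zero_fract_def eq_fract)
    then have "fls_subdegree (S.ev (Fract p q)) > 0"
      unfolding S.ev_Fract[OF pq(2)] using False pq(2) S(3)
      by (simp add: fls_divide_subdegree S.peval_eq_0 pole_evaluation[OF S sub])
    then have "S.ev (Fract p q) $$ 0 = 0" by simp
    then show ?thesis unfolding e(1) by (simp add: c_def[symmetric])
  qed
qed


section \<open>Even rational functions\<close>

lemma rat_deriv_neg_t: "rat_deriv (- rat_t) = - 1"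
  using rat_deriv_diff[of 0 rat_t] by simp

lemma rat_deriv_square: "rat_deriv (rat_t\<^sup>2) = 2 * rat_t"
  by (simp add: power2_eq_square rat_deriv_mult)

lemma subst_neg: "substitution rat_const rat_deriv (- rat_t)"
  by (rule substitution_ratfun) (simp add: rat_deriv_neg_t)

lemma subst_square: "substitution rat_const rat_deriv (rat_t\<^sup>2)"
  by (rule substitution_ratfun) (simp add: rat_deriv_square)

text \<open>Peels off two coefficients at a time; the second of them is 0.\<close>

lemma even_poly:
  assumes "pcompose p [:0, -1:] = p"
  shows "\<exists>q. Fract p 1 = substitution.peval rat_const (rat_t\<^sup>2) q"
  using assms
proof (induction "degree p" arbitrary: p rule: less_induct)
  case less
  interpret s: substitution rat_const rat_deriv "rat_t\<^sup>2" by (rule subst_square)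
  obtain a p1 where p1: "p = pCons a p1" by (cases p)
  obtain b p2 where p2: "p1 = pCons b p2" by (cases p1)
  have "pcompose p1 [:0, -1:] = - p1"
    using less.prems unfolding p1 by (simp add: pcompose_pCons minus_equation_iff[of _ p1] eq_commute[of "- p1"])
  then have "b = - b" and e: "pcompose p2 [:0, -1:] = p2"
    unfolding p2 by (simp_all add: pcompose_pCons)
  then have b: "b = 0" by simp
  show ?case
  proof (cases "p2 = 0")
    case True
    then have "Fract p 1 = s.peval [:a:]" unfolding p1 p2 b by (simp add: s.peval_pCons rat_const_def)
    then show ?thesis by blast
  next
    case False
    then have "degree p2 < degree p" unfolding p1 p2 by simp
    then obtain q where q: "Fract p2 1 = s.peval q" using less.hyps e by blast
    have "Fract p 1 = rat_const a + rat_t\<^sup>2 * Fract p2 1"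
      unfolding p1 p2 b by (simp add: rat_const_def rat_t_def power2_eq_square)
    then have "Fract p 1 = s.peval (pCons a q)" unfolding q s.peval_pCons .
    then show ?thesis by blast
  qed
qed

text \<open>Multiplying numerator and denominator by \<open>q(-t)\<close> makes the denominator \<open>q(t) q(-t)\<close> even, and then the numerator is even too.\<close>

lemma even_ratfun:
  assumes "substitution.ev rat_const (- rat_t) r = r"
  shows "\<exists>R. r = substitution.ev rat_const (rat_t\<^sup>2) R"
proof -
  interpret n: substitution rat_const rat_deriv "- rat_t" by (rule subst_neg)
  interpret s: substitution rat_const rat_deriv "rat_t\<^sup>2" by (rule subst_square)
  define c where "c p = pcompose p [:0, -1::complex:]" for p
  have np: "n.peval p = Fract (c p) 1" for p
  proof (induction p)
    case 0
    then show ?case by (simp add: n.peval_0 c_def Zero_fract_def)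
  next
    case (pCons a p)
    show ?case unfolding n.peval_pCons pCons(2)
      by (simp add: c_def pcompose_pCons rat_const_def rat_t_def)
  qed
  have cc: "c (c p) = p" for p
  proof -
    have "c (c p) = pcompose p (pcompose [:0, -1:] [:0, -1:])" by (simp add: c_def pcompose_assoc)
    also have "pcompose [:0, -1:] [:0, -1 :: complex:] = [:0, 1:]" by (simp add: pcompose_pCons)
    finally show ?thesis by (simp add: pcompose_idR)
  qed
  have cm: "c (p * q) = c p * c q" for p q by (simp add: c_def pcompose_mult)
  obtain p q where r: "r = Fract p q" "q \<noteq> 0" by (cases r) auto
  have cq: "c q \<noteq> 0" using cc[of q] r(2) by (auto simp: c_def)
  have "Fract (c p) (c q) = Fract p q"
    using assms unfolding r(1) n.ev_Fract[OF r(2)] np by simp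
  then have e: "c p * q = p * c q" using r(2) cq by (simp add: eq_fract)
  have "c (p * c q) = p * c q" "c (q * c q) = q * c q" unfolding cm cc e by simp_all
  then obtain N D where N: "Fract (p * c q) 1 = s.peval N" and D: "Fract (q * c q) 1 = s.peval D"
    using even_poly unfolding c_def by blast
  have "s.peval D \<noteq> 0" unfolding D[symmetric] using r(2) cq by (simp add: Zero_fract_def eq_fract)
  then have D0: "D \<noteq> 0" by auto
  have "r = Fract (p * c q) 1 / Fract (q * c q) 1" using r cq by (simp add: eq_fract)
  then have "r = s.ev (Fract N D)" unfolding N D s.ev_Fract[OF D0] .
  then show ?thesis by blast
qed

section \<open>Solutions as functions of the square of the variable\<close>

text \<open>The rescaled system in the variable \<open>x = t\<^sup>2\<close>; here the indeterminate \<open>rat_t\<close> plays the part of \<open>x\<close>.\<close>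

definition x_solution :: "(6 \<Rightarrow> complex) \<Rightarrow> (6 \<Rightarrow> ratfun) \<Rightarrow> bool" where
  "x_solution \<alpha> G \<longleftrightarrow>
    (\<forall>i. rat_t * rat_deriv (G i) = rat_t * (G i * quadr 1 G i) + rat_const (\<alpha> i) - rat_const (parsum \<alpha> i) * G i)
    \<and> (\<forall>i. parsum G i = 1)"

lemma x_solution_place:
  assumes "x_solution \<alpha> G"
  shows "local_sol (fls_const a + fls_X) (fls_const a + fls_X) \<alpha> (\<lambda>i. place a (G i))"
proof -
  interpret substitution "fls_const :: complex \<Rightarrow> _" fls_deriv "fls_const a + fls_X" by (rule subst_place)
  have G: "rat_t * rat_deriv (G i) = rat_t * (G i * quadr 1 G i) + rat_const (\<alpha> i) - rat_const (parsum \<alpha> i) * G i"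
    and s: "parsum G i = 1" for i using assms by (simp_all add: x_solution_def)
  have "(fls_const a + fls_X) * fls_deriv (fls_const a + fls_X) = ev rat_t" by (simp add: ev_t)
  from ev_solution[OF G this] show ?thesis
    unfolding local_sol_def place_def ev_parsum[symmetric] s by (simp add: ev_t)
qed

lemma x_solution_inf:
  assumes "x_solution \<alpha> G"
  shows "local_sol (- fls_X) fls_X_inv \<alpha> (\<lambda>i. place_inf (G i))"
proof -
  interpret substitution "fls_const :: complex \<Rightarrow> _" fls_deriv fls_X_inv by (rule subst_inf)
  have G: "rat_t * rat_deriv (G i) = rat_t * (G i * quadr 1 G i) + rat_const (\<alpha> i) - rat_const (parsum \<alpha> i) * G i"
    and s: "parsum G i = 1" for i using assms by (simp_all add: x_solution_def)
  have "- fls_X * fls_deriv fls_X_inv = ev rat_t"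
  proof -
    have "- fls_X * (- (fls_X_inv\<^sup>2)) = (fls_X_inv :: complex fls)" using fls_X_X_inv by algebra
    then show ?thesis by (simp add: ev_t)
  qed
  from ev_solution[OF G this] show ?thesis
    unfolding local_sol_def place_inf_def ev_parsum[symmetric] s by (simp add: ev_t)
qed

text \<open>By \<open>ham_derivative\<close> the leading coefficient of the derivative of \<open>h\<^sub>j\<close>, a double pole, is \<open>a\<close> times the one of
  \<open>ham_cubic\<close>; integrating changes the sign, and dividing by \<open>x\<close> removes the factor \<open>a\<close>.\<close>

lemma finite_residue:
  assumes a: "a \<noteq> 0" and sol: "local_sol (fls_const a + fls_X) (fls_const a + fls_X) \<alpha> F"
    and total: "\<And>i. parsum \<alpha> i + parsum \<alpha> (i+1) = 1"
  shows "(ham (fls_const a + fls_X) (\<lambda>i. fls_const (\<alpha> i)) F j / (fls_const a + fls_X)) $$ (-1) \<in> \<nat>"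
proof -
  define T :: "complex fls" where "T = fls_const a + fls_X"
  define H where "H = ham T (\<lambda>i. fls_const (\<alpha> i)) F j"
  define C where "C = ham_cubic F j"
  have T: "ord_ge 0 T" "T $$ 0 = a" using a by (auto simp: T_def ord_ge_def)
  then have T0: "T \<noteq> 0" using a by auto
  note fin = finite_place[OF a sol, of j, folded C_def] finite_place(1)[OF a sol]
  have H': "fls_deriv H = T * C + fls_const (\<alpha> (j+2)) * F (j+1) - fls_const (\<alpha> (j+4)) * F (j+5)"
  proof -
    have pc: "parsum (\<lambda>i. fls_const (\<alpha> i)) i = fls_const (parsum \<alpha> i)" for i
      by (simp add: parsum_def fls_plus_const)
    have "T * fls_deriv H = T * (T * C + fls_const (\<alpha> (j+2)) * F (j+1) - fls_const (\<alpha> (j+4)) * F (j+5))"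
      unfolding H_def C_def
    proof (rule ham_derivative)
      show "T * fls_deriv (u + v) = T * fls_deriv u + T * fls_deriv v" for u v by (simp add: algebra_simps)
      show "T * fls_deriv (u * v) = u * (T * fls_deriv v) + T * fls_deriv u * v" for u v by (simp add: algebra_simps)
      show "T * fls_deriv T = T" by (simp add: T_def)
      show "T * fls_deriv (fls_const (\<alpha> i)) = 0" for i by simp
      show "T * fls_deriv (F i) = T * (F i * quadr 1 F i) + fls_const (\<alpha> i) - parsum (\<lambda>i. fls_const (\<alpha> i)) i * F i" for i
        using sol unfolding local_sol_def pc T_def by blast
      show "parsum F i = 1" for i using sol unfolding local_sol_def by blast
      show "parsum (\<lambda>i. fls_const (\<alpha> i)) i + parsum (\<lambda>i. fls_const (\<alpha> i)) (i + 1) = 1" for i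
        unfolding pc fls_plus_const total by simp
    qed
    then show ?thesis using T0 by simp
  qed
  have cF: "ord_ge (-1) (fls_const c * F i)" for c i
    using ord_ge_mult[OF ord_ge_const[of 0 c] fin(4)[of i]] by simp
  have TC: "ord_ge (-2) (T * C)" "(T * C) $$ (-2) = a * C $$ (-2)"
    using ord_ge_mult[OF T(1) fin(2)] nth_mult_lead[OF T(1) fin(2), of "-2"] by (simp_all add: T(2))
  have v: "ord_ge (-2) (fls_deriv H)" unfolding H'
    by (intro ord_ge_diff ord_ge_add TC ord_ge_mono[OF cF]) simp_all
  have cF2: "(fls_const c * F i) $$ (-2) = 0" for c i
    using cF[of c i, unfolded ord_ge_def, rule_format, of "-2"] by simp
  have "fls_deriv H $$ (-2) = a * C $$ (-2)"
    unfolding H' fls_minus_nth fls_plus_nth cF2 TC(2) by simp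
  then have lead: "- (H $$ (-1)) = a * C $$ (-2)" by simp
  have vH: "ord_ge (-1) H" unfolding ord_ge_def
  proof (intro allI impI)
    fix k :: int assume k: "k < -1"
    then show "H $$ k = 0" using v[unfolded ord_ge_def, rule_format, of "k - 1"] by simp
  qed
  define Y where "Y = H / T"
  have Y: "T * Y = H" using T0 by (simp add: Y_def)
  have "ord_ge (-1 - 0) Y" by (rule ord_ge_cancel[of _ T]) (use Y vH T a in simp_all)
  then have "a * Y $$ (-1) = H $$ (-1)"
    using nth_mult_lead[OF T(1), of "-1" Y "-1"] by (simp add: Y T(2))
  then have "a * Y $$ (-1) = a * (- (C $$ (-2)))" using lead by (metis minus_minus mult_minus_right)
  then have "Y $$ (-1) = - (C $$ (-2))" using a by (metis mult_cancel_left)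
  then show ?thesis using fin(3) by (simp add: Y_def H_def T_def)
qed

lemma Nats_sum: "(\<And>a. a \<in> A \<Longrightarrow> h a \<in> \<nat>) \<Longrightarrow> sum h A \<in> \<nat>"
  by (induction A rule: infinite_finite_induct) auto

text \<open>The residue theorem for \<open>h\<^sub>j / x\<close>: at infinity and at 0 the residues are the constant terms of \<open>h\<^sub>j\<close>, up to the sign at infinity.\<close>

lemma residue_count:
  assumes sol: "x_solution \<alpha> G" and total: "\<And>i. parsum \<alpha> i + parsum \<alpha> (i+1) = 1"
  shows "ham fls_X_inv (\<lambda>i. fls_const (\<alpha> i)) (\<lambda>i. place_inf (G i)) j $$ 0
     - ham fls_X (\<lambda>i. fls_const (\<alpha> i)) (\<lambda>i. place 0 (G i)) j $$ 0 \<in> \<nat>"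
proof -
  define r where "r = ham rat_t (\<lambda>i. rat_const (\<alpha> i)) G j / rat_t"
  have pl: "place a r = ham (fls_const a + fls_X) (\<lambda>i. fls_const (\<alpha> i)) (\<lambda>i. place a (G i)) j / (fls_const a + fls_X)" for a
    unfolding r_def place_hom(6) substitution.ev_ham[OF subst_place, folded place_def] place_hom by (rule refl)
  have pi: "place_inf r = ham fls_X_inv (\<lambda>i. fls_const (\<alpha> i)) (\<lambda>i. place_inf (G i)) j / fls_X_inv"
    unfolding r_def inf_hom(6) substitution.ev_ham[OF subst_inf, folded place_inf_def] inf_hom by (rule refl)
  have "h / fls_X_inv = fls_X * h" for h :: "complex fls"
  proof -
    have "fls_X_inv \<noteq> (0 :: complex fls)" using fls_X_X_inv by (metis mult_zero_right zero_neq_one)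
    moreover have "h = (fls_X * h) * fls_X_inv" using fls_X_X_inv by algebra
    ultimately show ?thesis by (rule iffD2[OF nonzero_divide_eq_eq])
  qed
  then have "place_inf r = fls_X * ham fls_X_inv (\<lambda>i. fls_const (\<alpha> i)) (\<lambda>i. place_inf (G i)) j"
    unfolding pi .
  then have 1: "place_inf r $$ 1 = ham fls_X_inv (\<lambda>i. fls_const (\<alpha> i)) (\<lambda>i. place_inf (G i)) j $$ 0"
    by (simp add: fls_X_mult_nth)
  have "fls_X * (h / fls_X) = h" for h :: "complex fls"
  proof -
    have "fls_X \<noteq> (0 :: complex fls)" by simp
    then show ?thesis by (simp only: times_divide_eq_right nonzero_mult_div_cancel_left not_False_eq_True)
  qed
  then have "fls_X * place 0 r = ham fls_X (\<lambda>i. fls_const (\<alpha> i)) (\<lambda>i. place 0 (G i)) j"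
    unfolding pl fls_const_0 add_0_left .
  then have 2: "place 0 r $$ (-1) = ham fls_X (\<lambda>i. fls_const (\<alpha> i)) (\<lambda>i. place 0 (G i)) j $$ 0"
    by (metis fls_X_mult_nth diff_0)
  have 3: "place a r $$ (-1) \<in> \<nat>" if "a \<noteq> 0" for a
    unfolding pl by (rule finite_residue[OF that x_solution_place[OF sol] total])
  obtain S where S: "finite S" "\<forall>a. a \<notin> S \<longrightarrow> place a r $$ (-1) = 0" "(\<Sum>a\<in>S. place a r $$ (-1)) = place_inf r $$ 1"
    using residues_sum[of r] unfolding residues_sum_def by blast
  have "(\<Sum>a\<in>S. place a r $$ (-1)) = (\<Sum>a\<in>insert 0 S. place a r $$ (-1))"
    using S(1,2) by (intro sum.mono_neutral_left) auto
  also have "\<dots> = place 0 r $$ (-1) + (\<Sum>a\<in>S - {0}. place a r $$ (-1))"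
    using S(1) by (simp add: sum.insert_remove)
  finally have "place_inf r $$ 1 - place 0 r $$ (-1) = (\<Sum>a\<in>S - {0}. place a r $$ (-1))"
    unfolding S(3) by simp
  also have "\<dots> \<in> \<nat>" using 3 by (intro Nats_sum) auto
  finally show ?thesis unfolding 1 2 .
qed

text \<open>The system for \<open>f\<^sub>i / t\<close> in the original variable; \<open>t/2 d/dt\<close> is the derivation \<open>x d/dx\<close>.\<close>

definition t_solution :: "(6 \<Rightarrow> complex) \<Rightarrow> (6 \<Rightarrow> ratfun) \<Rightarrow> bool" where
  "t_solution \<alpha> g \<longleftrightarrow>
    (\<forall>i. rat_t / 2 * rat_deriv (g i) = rat_t\<^sup>2 * (g i * quadr 1 g i) + rat_const (\<alpha> i) - rat_const (parsum \<alpha> i) * g i)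
    \<and> (\<forall>i. parsum g i = 1)"

lemma t_solution_of_A5:
  assumes "A5_rational_solution \<alpha> f"
  shows "t_solution \<alpha> (\<lambda>i. f i / rat_t)"
  unfolding t_solution_def
proof (intro conjI allI)
  fix i
  have t0: "rat_t \<noteq> 0" by simp
  define g where "g i = f i / rat_t" for i
  have f: "f i = rat_t * g i" for i using t0 by (simp add: g_def)
  have "parsum f i = rat_t" using assms by (simp add: A5_normal_form)
  then show "parsum (\<lambda>i. f i / rat_t) i = 1" using t0 by (simp add: parsum_def flip: add_divide_distrib)
  have d: "rat_deriv (f i) = rat_t * rat_deriv (g i) + g i" by (simp add: f rat_deriv_mult)
  have q: "quadr rat_t f i = rat_t * rat_t * quadr 1 g i" unfolding quadr_def f by algebra
  have h: "(2::ratfun) * (1/2) = 1" by simp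
  have "rat_t * (1/2) * (rat_t * rat_deriv (g i) + g i) = rat_t * g i * (rat_t * rat_t * quadr 1 g i)
        + (1/2 - rat_const (parsum \<alpha> i)) * (rat_t * g i) + rat_const (\<alpha> i) * rat_t"
    using A5_eqD(1)[OF assms, of i] unfolding d q unfolding f by simp
  then have "rat_t * (rat_t * (1/2) * rat_deriv (g i)) = rat_t * (rat_t * rat_t * (g i * quadr 1 g i) + rat_const (\<alpha> i) - rat_const (parsum \<alpha> i) * g i)"
    by algebra
  then show "rat_t / 2 * rat_deriv (f i / rat_t) = rat_t\<^sup>2 * (f i / rat_t * quadr 1 (\<lambda>i. f i / rat_t) i) + rat_const (\<alpha> i) - rat_const (parsum \<alpha> i) * (f i / rat_t)"
    using t0 unfolding g_def[symmetric] by (simp add: power2_eq_square)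
qed

lemma t_solution_inf:
  assumes "t_solution \<alpha> g"
  shows "local_sol (- (fls_const (1/2) * fls_X)) (fls_X_inv\<^sup>2) \<alpha> (\<lambda>i. place_inf (g i))"
proof -
  interpret substitution "fls_const :: complex \<Rightarrow> _" fls_deriv fls_X_inv by (rule subst_inf)
  have g: "rat_t / 2 * rat_deriv (g i) = rat_t\<^sup>2 * (g i * quadr 1 g i) + rat_const (\<alpha> i) - rat_const (parsum \<alpha> i) * g i"
    and s: "parsum g i = 1" for i using assms by (simp_all add: t_solution_def)
  have h: "2 * fls_const (1/2) = (1 :: complex fls)"
    by (rule fls_eqI) simp
  have "- (fls_const (1/2) * fls_X) * fls_deriv fls_X_inv = ev (rat_t / 2)"
  proof -
    have "2 * (- (fls_const (1/2) * fls_X) * (- (fls_X_inv\<^sup>2))) = (fls_X_inv :: complex fls)" using fls_X_X_inv h by algebra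
    then show ?thesis by (simp add: ev_t ev_divide field_simps)
  qed
  from ev_solution[OF g this] show ?thesis
    unfolding local_sol_def place_inf_def ev_parsum[symmetric] s by (simp add: ev_t ev_mult power2_eq_square)
qed

lemma t_solution_neg:
  assumes "t_solution \<alpha> g"
  shows "t_solution \<alpha> (\<lambda>i. substitution.ev rat_const (- rat_t) (g i))"
proof -
  interpret substitution rat_const rat_deriv "- rat_t" by (rule subst_neg)
  have g: "rat_t / 2 * rat_deriv (g i) = rat_t\<^sup>2 * (g i * quadr 1 g i) + rat_const (\<alpha> i) - rat_const (parsum \<alpha> i) * g i"
    and s: "parsum g i = 1" for i using assms by (simp_all add: t_solution_def)
  have "rat_t / 2 * rat_deriv (- rat_t) = ev (rat_t / 2)" by (simp add: rat_deriv_neg_t ev_divide ev_t)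
  from ev_solution[OF g this] show ?thesis
    unfolding t_solution_def ev_parsum[symmetric] s by (simp add: ev_t ev_mult power2_eq_square)
qed

lemma t_inf_order: "ord_ge 1 (- (fls_const (1/2) * fls_X :: complex fls))" "ord_ge (-2) (fls_X_inv\<^sup>2 :: complex fls)"
  "(fls_X_inv\<^sup>2 :: complex fls) $$ (-2) \<noteq> 0"
proof -
  have X: "ord_ge (-1) (fls_X_inv :: complex fls)" "(fls_X_inv :: complex fls) $$ (-1) = 1" by (auto simp: ord_ge_def)
  show "ord_ge (-2) (fls_X_inv\<^sup>2 :: complex fls)" "(fls_X_inv\<^sup>2 :: complex fls) $$ (-2) \<noteq> 0"
    using ord_ge_mult[OF X(1) X(1)] nth_mult_lead[OF X(1) X(1), of "-2"] X(2) by (simp_all add: power2_eq_square)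
  show "ord_ge 1 (- (fls_const (1/2) * fls_X :: complex fls))" by (auto simp: ord_ge_def)
qed

text \<open>\<open>g(-t)\<close> solves the same system with the same values at infinity, so uniqueness applies.\<close>

lemma t_solution_even:
  assumes sol: "t_solution \<alpha> g" and w: "(\<lambda>i. place_inf (g i) $$ 0) \<in> infinity_types"
  shows "substitution.ev rat_const (- rat_t) (g i) = g i"
proof -
  interpret n: substitution rat_const rat_deriv "- rat_t" by (rule subst_neg)
  have S: "place_inf (- rat_t) = - fls_X_inv" by (simp add: inf_hom)
  have D: "fls_deriv (- fls_X_inv :: complex fls) \<noteq> 0"
  proof -
    have "fls_deriv (- fls_X_inv :: complex fls) $$ (-2) = 1" by (subst fls_deriv_nth) simp
    then show ?thesis by (metis fls_zero_nth zero_neq_one)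
  qed
  note l = t_solution_inf[OF sol] and l' = t_solution_inf[OF t_solution_neg[OF sol]]
  have reg: "ord_ge 0 (place_inf (g i))" "ord_ge 0 (place_inf (n.ev (g i)))" for i
    using infinity_regular(1)[OF l t_inf_order] infinity_regular(1)[OF l' t_inf_order] by simp_all
  have val: "place_inf (n.ev (g i)) $$ 0 = place_inf (g i) $$ 0" for i
  proof -
    have "place_inf (n.ev (g i)) = substitution.ev fls_const (- fls_X_inv) (g i)"
      using substitution_compose[OF subst_neg, of "g i"] D unfolding S by simp
    also have "\<dots> $$ 0 = place_inf (g i) $$ 0"
      by (rule value_substitution[of 1]) (use reg D in \<open>auto simp: ord_ge_def intro!: substitution_fls\<close>)
    finally show ?thesis .
  qed
  have "(\<lambda>i. place_inf (n.ev (g i))) = (\<lambda>i. place_inf (g i))"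
    by (rule local_sol_unique[OF l' l t_inf_order _ reg(2) reg(1) val refl w]) simp
  then have "place_inf (n.ev (g i)) = place_inf (g i)" by (simp add: fun_eq_iff)
  then show ?thesis unfolding place_inf_def by (simp add: substitution.ev_inject[OF subst_inf])
qed

lemma x_solution_of_t_solution:
  assumes sol: "t_solution \<alpha> g" and w: "(\<lambda>i. place_inf (g i) $$ 0) \<in> infinity_types"
  obtains G where "x_solution \<alpha> G" "\<And>i. g i = substitution.ev rat_const (rat_t\<^sup>2) (G i)"
    "\<And>i. place_inf (G i) $$ 0 = place_inf (g i) $$ 0"
proof -
  interpret s: substitution rat_const rat_deriv "rat_t\<^sup>2" by (rule subst_square)
  have "\<forall>i. \<exists>R. g i = s.ev R" using even_ratfun t_solution_even[OF sol w] by blast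
  then obtain G where G: "\<And>i. g i = s.ev (G i)" by metis
  have g: "rat_t / 2 * rat_deriv (g i) = rat_t\<^sup>2 * (g i * quadr 1 g i) + rat_const (\<alpha> i) - rat_const (parsum \<alpha> i) * g i"
    and p: "parsum g i = 1" for i using sol by (simp_all add: t_solution_def)
  have x: "x_solution \<alpha> G" unfolding x_solution_def
  proof (intro conjI allI)
    fix i
    have "s.ev (rat_t * rat_deriv (G i)) = rat_t / 2 * rat_deriv (g i)"
      unfolding G s.ev_deriv s.ev_mult s.ev_t rat_deriv_square by (simp add: power2_eq_square)
    also have "\<dots> = s.ev (rat_t * (G i * quadr 1 G i) + rat_const (\<alpha> i) - rat_const (parsum \<alpha> i) * G i)"
      unfolding g by (simp add: s.ev_add s.ev_diff s.ev_mult s.ev_const s.ev_t quadr_def G)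
    finally show "rat_t * rat_deriv (G i) = rat_t * (G i * quadr 1 G i) + rat_const (\<alpha> i) - rat_const (parsum \<alpha> i) * G i"
      by (simp only: s.ev_inject)
    have "s.ev (parsum G i) = s.ev 1" using p[of i] by (simp add: parsum_def s.ev_add G)
    then show "parsum G i = 1" by (simp only: s.ev_inject)
  qed
  have S: "place_inf (rat_t\<^sup>2) = fls_X_inv\<^sup>2" by (simp add: power2_eq_square inf_hom)
  have D: "fls_deriv (fls_X_inv\<^sup>2 :: complex fls) \<noteq> 0"
  proof -
    have "fls_deriv (fls_X_inv\<^sup>2 :: complex fls) $$ (-3) = -2 * (fls_X_inv\<^sup>2 :: complex fls) $$ (-2)" by (subst fls_deriv_nth) simp
    then have "fls_deriv (fls_X_inv\<^sup>2 :: complex fls) $$ (-3) \<noteq> 0"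
      using t_inf_order(3) by (metis mult_eq_0_iff neg_equal_0_iff_equal zero_neq_numeral)
    then show ?thesis by (metis fls_zero_nth)
  qed
  have "ord_ge 0 (place_inf (G i))" for i
    by (rule infinity_regular(1)[OF x_solution_inf[OF x], of "-1"]) (auto simp: ord_ge_def)
  then have "place_inf (G i) $$ 0 = place_inf (g i) $$ 0" for i
    unfolding G substitution_compose[OF subst_square D[folded S]] S
    using value_substitution[of 2 "fls_X_inv\<^sup>2", OF _ _ _ substitution_fls[OF D], of "G i"] t_inf_order by simp
  then show ?thesis using that[OF x G] by blast
qed

section \<open>Conclusion\<close>

lemma int_span_mult: "x \<in> int_span \<alpha> \<Longrightarrow> of_int m * x \<in> int_span \<alpha>"
proof -
  assume "x \<in> int_span \<alpha>"
  then obtain n n0 n1 n2 n3 n4 n5 where x: "x = of_int n + of_int n0 * \<alpha> 0 + of_int n1 * \<alpha> 1 + of_int n2 * \<alpha> 2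
      + of_int n3 * \<alpha> 3 + of_int n4 * \<alpha> 4 + of_int n5 * \<alpha> 5" by (auto simp: int_span_def)
  show ?thesis unfolding x
    by (rule int_spanI[of _ "m*n" "m*n0" _ "m*n1" "m*n2" "m*n3" "m*n4" "m*n5"]) (simp add: algebra_simps)
qed

lemma int_span_subset:
  assumes "\<And>i. \<beta> i \<in> int_span \<alpha>" "z \<in> int_span \<beta>"
  shows "z \<in> int_span \<alpha>"
proof -
  obtain n n0 n1 n2 n3 n4 n5 where z: "z = of_int n + of_int n0 * \<beta> 0 + of_int n1 * \<beta> 1 + of_int n2 * \<beta> 2
      + of_int n3 * \<beta> 3 + of_int n4 * \<beta> 4 + of_int n5 * \<beta> 5" using assms(2) by (auto simp: int_span_def)
  show ?thesis unfolding z by (intro int_span_add int_span_int int_span_mult assms(1))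
qed

lemma infinity_types_crit: "v \<in> infinity_types \<Longrightarrow> v i * quadr 1 v i = 0"
  and infinity_types_par: "v \<in> infinity_types \<Longrightarrow> parsum v i = 1"
  unfolding infinity_types_def insert_iff empty_iff using six_exhaust[of i]
  by (elim disjE; simp add: quadr_def parsum_def)+

text \<open>The hypothesis on the parameters says that the constant vector \<open>v\<close> is itself a solution.\<close>

lemma constant_solution:
  assumes sol: "x_solution \<alpha> G" and v: "(\<lambda>i. place_inf (G i) $$ 0) = v" "v \<in> infinity_types"
    and \<alpha>: "\<And>i. \<alpha> i = parsum \<alpha> i * v i"
  shows "G i = rat_const (v i)"
proof -
  have c: "local_sol (- fls_X) fls_X_inv \<alpha> (\<lambda>i. fls_const (v i))"
  proof -
    have q: "fls_const (v i) * quadr 1 (\<lambda>i. fls_const (v i)) i = 0" for i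
    proof -
      have "quadr 1 (\<lambda>i. fls_const (v i)) i = fls_const (quadr 1 v i)"
        unfolding quadr_def by (rule fls_eqI) (simp add: fls_const_mult_const)
      then show ?thesis using infinity_types_crit[OF v(2), of i] by (simp add: fls_const_mult_const)
    qed
    have "fls_const (\<alpha> i) = fls_const (parsum \<alpha> i) * fls_const (v i)" for i
      using \<alpha>[of i] by (simp add: fls_const_mult_const)
    moreover have "parsum (\<lambda>i. fls_const (v i)) i = 1" for i
      using infinity_types_par[OF v(2), of i] by (simp add: parsum_def fls_plus_const)
    ultimately show ?thesis unfolding local_sol_def q by simp
  qed
  have T: "ord_ge 1 (- fls_X :: complex fls)" "ord_ge (-1) (fls_X_inv :: complex fls)" "(fls_X_inv :: complex fls) $$ (-1) \<noteq> 0"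
    by (auto simp: ord_ge_def)
  note l = x_solution_inf[OF sol]
  have "(\<lambda>i. place_inf (G i)) = (\<lambda>i. fls_const (v i))"
    by (rule local_sol_unique[OF l c T _ infinity_regular(1)[OF l T] ord_ge_const _ _ v(2)])
      (use v(1) in \<open>auto simp: fun_eq_iff\<close>)
  then have "place_inf (G i) = place_inf (rat_const (v i))" by (simp add: inf_hom fun_eq_iff)
  then show ?thesis unfolding place_inf_def by (simp add: substitution.ev_inject[OF subst_inf])
qed

lemma (in alcove) x_solution_seed:
  assumes sol: "x_solution p G" and v: "(\<lambda>i. place_inf (G i) $$ 0) = v" "v \<in> infinity_types"
  shows "(v = vec6 1 1 0 0 0 0 \<and> p 2 = 0 \<and> p 3 = 0 \<and> p 4 = 0 \<and> p 5 = 0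
      \<or> v = vec6 1 0 0 1 0 0 \<and> p 1 = 0 \<and> p 2 = 0 \<and> p 4 = 0 \<and> p 5 = 0
      \<or> v = vec6 1 1 1 0 (-1) 0 \<and> p 0 = 0 \<and> p 2 = 0 \<and> p 3 = 0 \<and> p 4 = 0 \<and> p 5 = 0
      \<or> v = vec6 (1/2) (1/2) (1/2) (1/2) 0 0 \<and> p 4 = 0 \<and> p 5 = 0 \<and> p 0 = p 2 \<and> p 1 = p 3
      \<or> v = vec6 (1/3) (1/3) (1/3) (1/3) (1/3) (1/3) \<and> p 0 = p 2 \<and> p 2 = p 4 \<and> p 1 = p 3 \<and> p 3 = p 5)
    \<and> (\<forall>i. G i = rat_const (v i))" (is "?seed \<and> _")
proof -
  have par: "parsum p i + parsum p (i+1) = 1" for i using total by (simp add: total_parsum)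
  define I where "I j = ham fls_X_inv (\<lambda>i. fls_const (p i)) (\<lambda>i. place_inf (G i)) j $$ 0" for j
  define Z where "Z j = ham fls_X (\<lambda>i. fls_const (p i)) (\<lambda>i. place 0 (G i)) j $$ 0" for j
  define N where "N j = I j - Z j" for j
  define D where "D a = Z a + (\<Sum>j\<in>UNIV. p j * Z j)" for a
  have nat: "N j \<in> \<nat>" for j unfolding N_def I_def Z_def by (rule residue_count[OF sol par])
  have "local_sol fls_X fls_X p (\<lambda>i. place 0 (G i))" using x_solution_place[OF sol, of 0] by simp
  note zp = zero_place[OF this par]
  have D: "D \<in> defects p"
    unfolding D_def Z_def by (rule zero_defect[OF total zp])
  note ip = infinity_place[OF x_solution_inf[OF sol] total, unfolded v(1), OF v(2), folded I_def]
  have seed: ?seed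
    using ip
  proof (elim disjE conjE)
    assume "v = vec6 1 1 0 0 0 0" "I = inf_a1 p"
    then show ?thesis using parameters_a1[of N Z D, OF nat _ D_def D] by (simp add: N_def)
  next
    assume "v = vec6 1 0 0 1 0 0" "I = inf_a2 p"
    then show ?thesis using parameters_a2[of N Z D, OF nat _ D_def D] by (simp add: N_def)
  next
    assume "v = vec6 1 1 1 0 (-1) 0" "I = inf_a3 p"
    then show ?thesis using parameters_a3[of N Z D, OF nat _ D_def D] by (simp add: N_def)
  next
    assume "v = vec6 (1/2) (1/2) (1/2) (1/2) 0 0" "I = inf_b p"
    then show ?thesis using parameters_b[of N Z D, OF nat _ D_def D] by (simp add: N_def)
  next
    assume "v = vec6 (1/3) (1/3) (1/3) (1/3) (1/3) (1/3)" "I = inf_c p"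
    then show ?thesis using parameters_c[of N Z D, OF nat _ D_def D] by (simp add: N_def)
  qed
  have "p i = parsum p i * v i" for i
    using seed six_exhaust[of i] by (elim disjE conjE; simp add: parsum_def)
  then show ?thesis using seed constant_solution[OF sol v] by blast
qed

lemma backlund_rotate:
  assumes "A5_rational_solution \<beta> g" "T \<in> backlund" "T s = (\<beta>, g)"
  shows "\<exists>T' \<in> backlund. T' s = ((\<lambda>j. \<beta> (j + k)), (\<lambda>j. g (j + k))) \<and> A5_rational_solution (\<lambda>j. \<beta> (j + k)) (\<lambda>j. g (j + k))"
proof -
  have "\<exists>T' \<in> backlund. T' s = ((\<lambda>j. \<beta> (j + of_nat n)), (\<lambda>j. g (j + of_nat n)))
      \<and> A5_rational_solution (\<lambda>j. \<beta> (j + of_nat n)) (\<lambda>j. g (j + of_nat n))" for n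
  proof (induction n)
    case 0
    then show ?case using assms by auto
  next
    case (Suc n)
    then obtain T' where T': "T' \<in> backlund" "T' s = ((\<lambda>j. \<beta> (j + of_nat n)), (\<lambda>j. g (j + of_nat n)))"
      "A5_rational_solution (\<lambda>j. \<beta> (j + of_nat n)) (\<lambda>j. g (j + of_nat n))" by blast
    show ?case
    proof (rule bexI[of _ "bt_pi \<circ> T'"])
      show "bt_pi \<circ> T' \<in> backlund" using T'(1) by (rule backlund.pi)
      show "(bt_pi \<circ> T') s = ((\<lambda>j. \<beta> (j + of_nat (Suc n))), (\<lambda>j. g (j + of_nat (Suc n))))
          \<and> A5_rational_solution (\<lambda>j. \<beta> (j + of_nat (Suc n))) (\<lambda>j. g (j + of_nat (Suc n)))"
        using bt_pi_solution[OF T'(3)] T'(2) by (simp add: bt_pi_def add.assoc)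
    qed
  qed
  moreover obtain n where "k = of_nat n"
  proof -
    have "k \<in> of_nat ` {0, 1, 2, 3, 4, 5}" using six_exhaust[of k] by auto
    then show ?thesis using that by blast
  qed
  ultimately show ?thesis by blast
qed

theorem theorem0p1:
  fixes \<alpha> :: "6 \<Rightarrow> complex" and f :: "6 \<Rightarrow> ratfun"
  assumes "\<alpha> 0 + \<alpha> 1 + \<alpha> 2 + \<alpha> 3 + \<alpha> 4 + \<alpha> 5 = 1"
    and "A5_rational_solution \<alpha> f"
  shows "\<exists>T \<in> backlund. \<exists>\<beta> g. T (\<alpha>, f) = (\<beta>, g) \<and>
    ((\<exists>a. (\<beta> 0, \<beta> 1, \<beta> 2, \<beta> 3, \<beta> 4, \<beta> 5) = (a, 1 - a, 0, 0, 0, 0) \<and>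
          (g 0, g 1, g 2, g 3, g 4, g 5) = (rat_t, rat_t, 0, 0, 0, 0))
   \<or> (\<exists>a. (\<beta> 0, \<beta> 1, \<beta> 2, \<beta> 3, \<beta> 4, \<beta> 5) = (a, 0, 0, 1 - a, 0, 0) \<and>
          (g 0, g 1, g 2, g 3, g 4, g 5) = (rat_t, 0, 0, rat_t, 0, 0))
   \<or> ((\<beta> 0, \<beta> 1, \<beta> 2, \<beta> 3, \<beta> 4, \<beta> 5) = (0, 1, 0, 0, 0, 0) \<and>
          (g 0, g 1, g 2, g 3, g 4, g 5) \<in>
            {(rat_t, rat_t, 0, 0, 0, 0),
             (0, rat_t, rat_t, 0, 0, 0),
             (0, rat_t, 0, 0, rat_t, 0),
             (rat_t, rat_t, rat_t, 0, - rat_t, 0)})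
   \<or> (\<exists>a. (\<beta> 0, \<beta> 1, \<beta> 2, \<beta> 3, \<beta> 4, \<beta> 5) = (a, - a + 1/2, a, - a + 1/2, 0, 0) \<and>
          (g 0, g 1, g 2, g 3, g 4, g 5) =
            (rat_t/2, rat_t/2, rat_t/2, rat_t/2, 0, 0))
   \<or> (\<exists>a. (\<beta> 0, \<beta> 1, \<beta> 2, \<beta> 3, \<beta> 4, \<beta> 5) =
            (a, - a + 1/3, a, - a + 1/3, a, - a + 1/3) \<and>
          (g 0, g 1, g 2, g 3, g 4, g 5) =
            (rat_t/3, rat_t/3, rat_t/3, rat_t/3, rat_t/3, rat_t/3)))"
proof -
  obtain e where e: "\<And>z. z \<in> int_span \<alpha> \<Longrightarrow> generic_functional e z = 0 \<Longrightarrow> z = 0"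
    using generic_functional_injective[of \<alpha>] by blast
  obtain T \<beta>' g' where T: "T \<in> backlund" "T (\<alpha>, f) = (\<beta>', g')" "A5_rational_solution \<beta>' g'"
    and b': "\<beta>' 0 + \<beta>' 1 + \<beta>' 2 + \<beta>' 3 + \<beta>' 4 + \<beta>' 5 = 1" "\<And>i. \<beta>' i \<in> int_span \<alpha>" "\<And>i. generic_functional e (\<beta>' i) \<ge> 0"
    using reach_alcove[OF assms(2,1), of e] by blast
  \<comment> \<open>The rotation \<open>\<pi>\<close> brings the values at infinity to one of the five listed vectors; it preserves the alcove.\<close>
  obtain k where k: "(\<lambda>i. place_inf (g' (i + k) / rat_t) $$ 0) \<in> infinity_types"
    using infinity_regular(2)[OF t_solution_inf[OF t_solution_of_A5[OF T(3)]] t_inf_order] by auto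
  define \<beta> where "\<beta> = (\<lambda>j. \<beta>' (j + k))"
  define g where "g = (\<lambda>j. g' (j + k))"
  obtain T' where T': "T' \<in> backlund" "T' (\<alpha>, f) = (\<beta>, g)" "A5_rational_solution \<beta> g"
    using backlund_rotate[OF T(3,1,2), of k] by (auto simp: \<beta>_def g_def)
  have total: "\<beta> 0 + \<beta> 1 + \<beta> 2 + \<beta> 3 + \<beta> 4 + \<beta> 5 = 1"
    using b'(1) sum_six_shift[of \<beta>' k] unfolding sum_six \<beta>_def by simp
  interpret alcove \<beta> e
  proof
    show "\<beta> 0 + \<beta> 1 + \<beta> 2 + \<beta> 3 + \<beta> 4 + \<beta> 5 = 1" by (rule total)
    show "generic_functional e (\<beta> i) \<ge> 0" for i by (simp add: \<beta>_def b')
    show "z = 0" if "z \<in> int_span \<beta>" "generic_functional e z = 0" for z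
      using e[OF int_span_subset[of \<beta>]] that b'(2) by (simp add: \<beta>_def)
  qed
  have w: "(\<lambda>i. place_inf (g i / rat_t) $$ 0) \<in> infinity_types" using k by (simp add: g_def)
  obtain G where G: "x_solution \<beta> G" "\<And>i. g i / rat_t = substitution.ev rat_const (rat_t\<^sup>2) (G i)"
    "\<And>i. place_inf (G i) $$ 0 = place_inf (g i / rat_t) $$ 0"
    using x_solution_of_t_solution[OF t_solution_of_A5[OF T'(3)] w] by blast
  define v where "v = (\<lambda>i. place_inf (G i) $$ 0)"
  have v: "v \<in> infinity_types" unfolding v_def G(3) by (rule w)
  note seed = x_solution_seed[OF G(1) v_def[symmetric] v]
  have g: "g i = rat_const (v i) * rat_t" for i
  proof -
    have "g i / rat_t = rat_const (v i)"
      using G(2)[of i] seed by (simp add: substitution.ev_const[OF subst_square])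
    then show ?thesis by (simp add: field_simps)
  qed
  have half: "rat_const (1/2) = 1/2" "rat_const (1/3) = 1/3" "rat_const (-1) = -1"
    by simp_all
  have p: "\<beta> 1 = 1 - \<beta> 0 - \<beta> 2 - \<beta> 3 - \<beta> 4 - \<beta> 5" using total by algebra
  show ?thesis
  proof (rule bexI[OF _ T'(1)], intro exI conjI, rule T'(2))
    from seed show "(\<exists>a. (\<beta> 0, \<beta> 1, \<beta> 2, \<beta> 3, \<beta> 4, \<beta> 5) = (a, 1 - a, 0, 0, 0, 0) \<and>
          (g 0, g 1, g 2, g 3, g 4, g 5) = (rat_t, rat_t, 0, 0, 0, 0))
   \<or> (\<exists>a. (\<beta> 0, \<beta> 1, \<beta> 2, \<beta> 3, \<beta> 4, \<beta> 5) = (a, 0, 0, 1 - a, 0, 0) \<and>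
          (g 0, g 1, g 2, g 3, g 4, g 5) = (rat_t, 0, 0, rat_t, 0, 0))
   \<or> ((\<beta> 0, \<beta> 1, \<beta> 2, \<beta> 3, \<beta> 4, \<beta> 5) = (0, 1, 0, 0, 0, 0) \<and>
          (g 0, g 1, g 2, g 3, g 4, g 5) \<in>
            {(rat_t, rat_t, 0, 0, 0, 0),
             (0, rat_t, rat_t, 0, 0, 0),
             (0, rat_t, 0, 0, rat_t, 0),
             (rat_t, rat_t, rat_t, 0, - rat_t, 0)})
   \<or> (\<exists>a. (\<beta> 0, \<beta> 1, \<beta> 2, \<beta> 3, \<beta> 4, \<beta> 5) = (a, - a + 1/2, a, - a + 1/2, 0, 0) \<and>
          (g 0, g 1, g 2, g 3, g 4, g 5) =
            (rat_t/2, rat_t/2, rat_t/2, rat_t/2, 0, 0))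
   \<or> (\<exists>a. (\<beta> 0, \<beta> 1, \<beta> 2, \<beta> 3, \<beta> 4, \<beta> 5) =
            (a, - a + 1/3, a, - a + 1/3, a, - a + 1/3) \<and>
          (g 0, g 1, g 2, g 3, g 4, g 5) =
            (rat_t/3, rat_t/3, rat_t/3, rat_t/3, rat_t/3, rat_t/3))"
    proof (elim conjE disjE)
      assume "v = vec6 1 1 0 0 0 0" "\<beta> 2 = 0" "\<beta> 3 = 0" "\<beta> 4 = 0" "\<beta> 5 = 0"
      then show ?thesis by (intro disjI1) (use p in \<open>simp add: g\<close>)
    next
      assume "v = vec6 1 0 0 1 0 0" "\<beta> 1 = 0" "\<beta> 2 = 0" "\<beta> 4 = 0" "\<beta> 5 = 0"
      then show ?thesis using total by (intro disjI1 disjI2) (simp add: g eq_diff_eq add.commute)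
    next
      assume "v = vec6 1 1 1 0 (-1) 0" "\<beta> 0 = 0" "\<beta> 2 = 0" "\<beta> 3 = 0" "\<beta> 4 = 0" "\<beta> 5 = 0"
      then show ?thesis by (intro disjI1 disjI2) (use p in \<open>simp add: g half\<close>)
    next
      assume a: "v = vec6 (1/2) (1/2) (1/2) (1/2) 0 0" "\<beta> 4 = 0" "\<beta> 5 = 0" "\<beta> 0 = \<beta> 2" "\<beta> 1 = \<beta> 3"
      then have "\<beta> 3 = - \<beta> 2 + 1/2" using total by (simp add: field_simps)
      then show ?thesis by (intro disjI1 disjI2) (use a in \<open>simp add: g half\<close>)
    next
      assume a: "v = vec6 (1/3) (1/3) (1/3) (1/3) (1/3) (1/3)" "\<beta> 0 = \<beta> 2" "\<beta> 2 = \<beta> 4" "\<beta> 1 = \<beta> 3" "\<beta> 3 = \<beta> 5"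
      then have "\<beta> 5 = - \<beta> 4 + 1/3" using total by (simp add: field_simps)
      then show ?thesis by (intro disjI2) (use a in \<open>simp add: g half\<close>)
    qed
  qed
qed

end
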